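(* For $n\ge1$ let $E_n$ be the directed graph consisting of a loop $L$ with $n$ edges and $n$ distinct vertices $v_1,\dots,v_n$, together with vertices $w_j$ ($j\geq1$), an edge from $w_{j+1}$ to $w_j$ for each $j\ge1$, and an edge from $w_1$ to $v_1$ (an infinite path coming in to the loop). Let $F_n$ be the core of $C^*(E_n)$. Then $C^*(E_n)\cong C(S^1)\otimes\mathcal{K}$ for all $n$, but $n$ is an invariant of the pair of algebras $(C^*(E_n),F_n)$: if there is an isomorphism $C^*(E_n)\to C^*(E_m)$ carrying $F_n$ onto $F_m$, then $n=m$.
   Context: For a directed graph $E=(E^0,E^1,r,s)$ in which each vertex emits finitely many edges, $C^*(E)$ is the universal $C^*$-algebra generated by mutually orthogonal projections $p_v$ ($v\in E^0$) and partial isometries $S_e$ ($e\in E^1$) with $S_e^*S_e=p_{r(e)}$ and $p_v=\sum_{s(e)=v}S_eS_e^*$ whenever $v$ emits at least one edge. The gauge action $\gamma$ of $S^1$ is $\gamma_z(S_e)=zS_e$, $\gamma_z(p_v)=p_v$, and the core of $C^*(E)$ is its fixed point algebra $C^*(E)^\gamma$. $\mathcal{K}$ denotes the compact operators on a separable infinite dimensional Hilbert space. *)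

theory Defs
  imports "HOL-Analysis.Analysis" "HOL-Library.Poly_Mapping" "Graph_Theory.Digraph"
begin

section \<open>\<open>*\<close>-algebras and \<open>*\<close>-isomorphisms\<close>

text \<open>
  Only the algebraic data of a C*-algebra are recorded: its norm is determined by its
  \<open>*\<close>-algebra structure, and an isomorphism of C*-algebras is a bijective \<open>*\<close>-homomorphism
  (it is automatically isometric).
\<close>

record 'a star_algebra =
  elts :: "'a set"
  add :: "'a \<Rightarrow> 'a \<Rightarrow> 'a"
  mult :: "'a \<Rightarrow> 'a \<Rightarrow> 'a"
  smul :: "complex \<Rightarrow> 'a \<Rightarrow> 'a"
  star :: "'a \<Rightarrow> 'a"

definition star_iso :: "('a \<Rightarrow> 'b) \<Rightarrow> 'a star_algebra \<Rightarrow> 'b star_algebra \<Rightarrow> bool" where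
  "star_iso h A B \<longleftrightarrow>
     bij_betw h (elts A) (elts B) \<and>
     (\<forall>x\<in>elts A. \<forall>y\<in>elts A. h (add A x y) = add B (h x) (h y)) \<and>
     (\<forall>x\<in>elts A. \<forall>y\<in>elts A. h (mult A x y) = mult B (h x) (h y)) \<and>
     (\<forall>c. \<forall>x\<in>elts A. h (smul A c x) = smul B c (h x)) \<and>
     (\<forall>x\<in>elts A. h (star A x) = star B (h x))"

definition star_isomorphic :: "'a star_algebra \<Rightarrow> 'b star_algebra \<Rightarrow> bool" where
  "star_isomorphic A B \<longleftrightarrow> (\<exists>h. star_iso h A B)"


section \<open>Free \<open>*\<close>-algebras\<close>

text \<open>
  A letter \<open>(g, False)\<close> stands for the generator \<open>g\<close>, a letter \<open>(g, True)\<close> for its adjoint.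
  The complex-valued finitely supported functions on words, with the convolution product of
  \<open>poly_mapping\<close>, form the free unital \<open>*\<close>-algebra.
\<close>

datatype 'g word = Word (letters: "('g \<times> bool) list")

instantiation word :: (type) monoid_add
begin

definition zero_word :: "'a word" where
  "zero_word = Word []"

definition plus_word :: "'a word \<Rightarrow> 'a word \<Rightarrow> 'a word" where
  "plus_word u v = Word (letters u @ letters v)"

instance
  by standard (simp_all add: zero_word_def plus_word_def)

end

type_synonym 'g free_alg = "'g word \<Rightarrow>\<^sub>0 complex"

definition gen :: "'g \<Rightarrow> 'g free_alg" where
  "gen g = Poly_Mapping.single (Word [(g, False)]) 1"

definition fscale :: "complex \<Rightarrow> 'g free_alg \<Rightarrow> 'g free_alg" where
  "fscale c x = Poly_Mapping.single 0 c * x"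

definition word_star :: "'g word \<Rightarrow> 'g word" where
  "word_star w = Word (rev (map (\<lambda>(g, b). (g, \<not> b)) (letters w)))"

definition fstar :: "'g free_alg \<Rightarrow> 'g free_alg" where
  "fstar x = (\<Sum>w\<in>Poly_Mapping.keys x.
     Poly_Mapping.single (word_star w) (cnj (Poly_Mapping.lookup x w)))"

text \<open>
  The free non-unital \<open>*\<close>-algebra on \<open>G\<close>: the empty word is excluded, since C*-algebras (in
  particular those of graphs with infinitely many vertices) need not have a unit.
\<close>

definition free_star :: "'g set \<Rightarrow> 'g free_alg set" where
  "free_star G = {x. \<forall>w\<in>Poly_Mapping.keys x. letters w \<noteq> [] \<and> fst ` set (letters w) \<subseteq> G}"

text \<open>The \<open>*\<close>-homomorphism of the free algebra that sends each generator \<open>g\<close> to \<open>\<phi> g\<close>.\<close>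

definition free_subst :: "('g \<Rightarrow> 'h free_alg) \<Rightarrow> 'g free_alg \<Rightarrow> 'h free_alg" where
  "free_subst \<phi> x = (\<Sum>w\<in>Poly_Mapping.keys x.
     fscale (Poly_Mapping.lookup x w)
       (prod_list (map (\<lambda>(g, b). if b then fstar (\<phi> g) else \<phi> g) (letters w))))"


section \<open>The universal C*-algebra on generators and relations\<close>

text \<open>
  The universal C*-algebra generated by \<open>G\<close> subject to the relations \<open>r = 0\<close> for \<open>r \<in> R\<close> is the
  Hausdorff completion of the free \<open>*\<close>-algebra on \<open>G\<close> in the largest C*-seminorm that vanishes
  on \<open>R\<close>.  This avoids a quantification over all C*-algebras, which HOL types do not permit:
  C*-seminorms vanishing on \<open>R\<close> are exactly the functions \<open>x \<mapsto> \<parallel>\<pi> x\<parallel>\<close> for the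
  \<open>*\<close>-homomorphisms \<open>\<pi>\<close> from the free \<open>*\<close>-algebra to some C*-algebra that satisfy the relations.
\<close>

definition cstar_seminorms :: "'g set \<Rightarrow> 'g free_alg set \<Rightarrow> ('g free_alg \<Rightarrow> real) set" where
  "cstar_seminorms G R = {\<rho>.
     (\<forall>x\<in>free_star G. 0 \<le> \<rho> x) \<and>
     (\<forall>x\<in>free_star G. \<forall>y\<in>free_star G. \<rho> (x + y) \<le> \<rho> x + \<rho> y) \<and>
     (\<forall>c. \<forall>x\<in>free_star G. \<rho> (fscale c x) = cmod c * \<rho> x) \<and>
     (\<forall>x\<in>free_star G. \<forall>y\<in>free_star G. \<rho> (x * y) \<le> \<rho> x * \<rho> y) \<and>
     (\<forall>x\<in>free_star G. \<rho> (fstar x * x) = (\<rho> x)\<^sup>2) \<and>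
     (\<forall>r\<in>R. \<rho> r = 0)}"

text \<open>
  The supremum is only meaningful if it is finite, as it is for the relations of a graph:
  see \<open>graph_seminorms_bdd\<close> below.
\<close>

definition universal_norm :: "'g set \<Rightarrow> 'g free_alg set \<Rightarrow> 'g free_alg \<Rightarrow> real" where
  "universal_norm G R x = (SUP \<rho>\<in>cstar_seminorms G R. \<rho> x)"

text \<open>Elements of the completion are classes of Cauchy sequences modulo null sequences.\<close>

definition cauchy_seqs :: "'g set \<Rightarrow> 'g free_alg set \<Rightarrow> (nat \<Rightarrow> 'g free_alg) set" where
  "cauchy_seqs G R = {x. (\<forall>k. x k \<in> free_star G) \<and>
     (\<forall>\<epsilon>>0. \<exists>N. \<forall>j\<ge>N. \<forall>k\<ge>N. universal_norm G R (x j - x k) < \<epsilon>)}"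

definition cls :: "'g set \<Rightarrow> 'g free_alg set \<Rightarrow> (nat \<Rightarrow> 'g free_alg) \<Rightarrow> (nat \<Rightarrow> 'g free_alg) set" where
  "cls G R x = {y \<in> cauchy_seqs G R. (\<lambda>k. universal_norm G R (y k - x k)) \<longlonglongrightarrow> 0}"

definition rep :: "(nat \<Rightarrow> 'g free_alg) set \<Rightarrow> nat \<Rightarrow> 'g free_alg" where
  "rep X = (SOME x. x \<in> X)"

definition universal_cstar ::
    "'g set \<Rightarrow> 'g free_alg set \<Rightarrow> (nat \<Rightarrow> 'g free_alg) set star_algebra" where
  "universal_cstar G R =
     \<lparr>elts = cls G R ` cauchy_seqs G R,
      add = (\<lambda>X Y. cls G R (\<lambda>k. rep X k + rep Y k)),
      mult = (\<lambda>X Y. cls G R (\<lambda>k. rep X k * rep Y k)),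
      smul = (\<lambda>c X. cls G R (\<lambda>k. fscale c (rep X k))),
      star = (\<lambda>X. cls G R (\<lambda>k. fstar (rep X k)))\<rparr>"


section \<open>Graph C*-algebras, the gauge action and the core\<close>

text \<open>
  Here \<open>s = tail\<close> and \<open>r = head\<close>; the generators are the \<open>p\<^sub>v\<close> and the \<open>S\<^sub>e\<close>.
\<close>

definition proj :: "'v \<Rightarrow> ('v + 'e) free_alg" where
  "proj v = gen (Inl v)"

definition piso :: "'e \<Rightarrow> ('v + 'e) free_alg" where
  "piso e = gen (Inr e)"

definition graph_gens :: "('v, 'e) pre_digraph \<Rightarrow> ('v + 'e) set" where
  "graph_gens E = Inl ` verts E \<union> Inr ` arcs E"

text \<open>Intended for graphs in which every vertex emits finitely many edges, as the sum requires.\<close>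

definition graph_rels :: "('v, 'e) pre_digraph \<Rightarrow> ('v + 'e) free_alg set" where
  "graph_rels E =
     {fstar (proj v) - proj v | v. v \<in> verts E} \<union>
     {proj v * proj v - proj v | v. v \<in> verts E} \<union>
     {proj v * proj w | v w. v \<in> verts E \<and> w \<in> verts E \<and> v \<noteq> w} \<union>
     {piso e * fstar (piso e) * piso e - piso e | e. e \<in> arcs E} \<union>
     {fstar (piso e) * piso e - proj (head E e) | e. e \<in> arcs E} \<union>
     {proj v - (\<Sum>e\<in>out_arcs E v. piso e * fstar (piso e)) | v. v \<in> verts E \<and> out_arcs E v \<noteq> {}}"

definition graph_cstar ::
    "('v, 'e) pre_digraph \<Rightarrow> (nat \<Rightarrow> ('v + 'e) free_alg) set star_algebra" where
  "graph_cstar E = universal_cstar (graph_gens E) (graph_rels E)"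

text \<open>
  For \<open>\<bar>z\<bar> = 1\<close> the automorphism \<open>p\<^sub>v \<mapsto> p\<^sub>v\<close>, \<open>S\<^sub>e \<mapsto> z S\<^sub>e\<close> of the free \<open>*\<close>-algebra permutes the
  C*-seminorms that vanish on the relations, hence preserves the universal norm and extends to
  the completion.
\<close>

definition gauge_free :: "complex \<Rightarrow> ('v + 'e) free_alg \<Rightarrow> ('v + 'e) free_alg" where
  "gauge_free z = free_subst (case_sum proj (\<lambda>e. fscale z (piso e)))"

definition gauge ::
    "('v, 'e) pre_digraph \<Rightarrow> complex \<Rightarrow> (nat \<Rightarrow> ('v + 'e) free_alg) set
      \<Rightarrow> (nat \<Rightarrow> ('v + 'e) free_alg) set" where
  "gauge E z X = cls (graph_gens E) (graph_rels E) (\<lambda>k. gauge_free z (rep X k))"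

definition core :: "('v, 'e) pre_digraph \<Rightarrow> (nat \<Rightarrow> ('v + 'e) free_alg) set set" where
  "core E = {X \<in> elts (graph_cstar E). \<forall>z. cmod z = 1 \<longrightarrow> gauge E z X = X}"


subsection \<open>Finiteness of the universal norm\<close>

lemma fscale_single: "fscale c (Poly_Mapping.single w a) = Poly_Mapping.single w (c * a)"
  by (simp add: fscale_def mult_single)

lemma single_in_free_star:
  assumes "letters w \<noteq> []" "fst ` set (letters w) \<subseteq> G"
  shows "Poly_Mapping.single w a \<in> free_star G"
  using assms by (auto simp: free_star_def)

lemma fstar_gen: "fstar (gen g) = Poly_Mapping.single (Word [(g, True)]) 1"
  by (simp add: fstar_def gen_def word_star_def)

lemma zero_in_free_star: "0 \<in> free_star G"
  by (simp add: free_star_def)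

lemma add_in_free_star:
  assumes "x \<in> free_star G" "y \<in> free_star G"
  shows "x + y \<in> free_star G"
  using assms Poly_Mapping.keys_add[of x y] unfolding free_star_def by blast

lemma diff_in_free_star:
  assumes "x \<in> free_star G" "y \<in> free_star G"
  shows "x - y \<in> free_star G"
  using assms keys_diff[of x y] unfolding free_star_def by blast

lemma sum_in_free_star:
  assumes "\<And>i. i \<in> I \<Longrightarrow> f i \<in> free_star G"
  shows "sum f I \<in> free_star G"
  using assms
  by (induction I rule: infinite_finite_induct)
    (simp_all add: add_in_free_star zero_in_free_star)

lemma seminorm_diff_zero:
  assumes \<rho>: "\<rho> \<in> cstar_seminorms G R" and xy: "x \<in> free_star G" "y \<in> free_star G"
    and r: "\<rho> (x - y) = 0"
  shows "\<rho> x \<le> \<rho> y"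
proof -
  have d: "x - y \<in> free_star G"
    using xy by (rule diff_in_free_star)
  have "\<rho> ((x - y) + y) \<le> \<rho> (x - y) + \<rho> y"
    using \<rho> d xy unfolding cstar_seminorms_def by blast
  then show ?thesis using r by simp
qed

lemma seminorm_square_le:
  fixes t :: real
  assumes "t\<^sup>2 \<le> t" shows "t \<le> 1"
proof (rule ccontr)
  assume "\<not> t \<le> 1"
  then have "t * 1 < t * t" by (intro mult_strict_left_mono) auto
  then show False using assms by (simp add: power2_eq_square)
qed

text \<open>
  Every generator has norm at most 1 in every C*-seminorm vanishing on the relations, so that
  these seminorms are dominated by the \<open>\<ell>\<^sup>1\<close>-norm of the coefficients.
\<close>

theorem graph_seminorms_bdd:
  assumes E: "wf_digraph E" and x: "x \<in> free_star (graph_gens E)"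
    and \<rho>: "\<rho> \<in> cstar_seminorms (graph_gens E) (graph_rels E)"
  shows "\<rho> x \<le> (\<Sum>w\<in>Poly_Mapping.keys x. cmod (Poly_Mapping.lookup x w))"
proof -
  let ?G = "graph_gens E"
  let ?s = "\<lambda>w. Poly_Mapping.single w (1::complex)"
  have pos: "0 \<le> \<rho> y" if "y \<in> free_star ?G" for y
    using \<rho> that by (auto simp: cstar_seminorms_def)
  have tri: "\<rho> (y + z) \<le> \<rho> y + \<rho> z" if "y \<in> free_star ?G" "z \<in> free_star ?G" for y z
    using \<rho> that by (auto simp: cstar_seminorms_def)
  have sc: "\<rho> (fscale c y) = cmod c * \<rho> y" if "y \<in> free_star ?G" for c y
    using \<rho> that by (auto simp: cstar_seminorms_def)
  have mul: "\<rho> (y * z) \<le> \<rho> y * \<rho> z" if "y \<in> free_star ?G" "z \<in> free_star ?G" for y z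
    using \<rho> that by (auto simp: cstar_seminorms_def)
  have cst: "\<rho> (fstar y * y) = (\<rho> y)\<^sup>2" if "y \<in> free_star ?G" for y
    using \<rho> that by (auto simp: cstar_seminorms_def)
  have rel: "\<rho> r = 0" if "r \<in> graph_rels E" for r
    using \<rho> that by (auto simp: cstar_seminorms_def)
  have letter: "?s (Word [l]) \<in> free_star ?G" if "fst l \<in> ?G" for l
    using that by (intro single_in_free_star) auto
  have gen_in: "gen g \<in> free_star ?G" if "g \<in> ?G" for g
    using letter[of "(g, False)"] that by (simp add: gen_def)
  have star_in: "fstar (gen g) \<in> free_star ?G" if "g \<in> ?G" for g
    using letter[of "(g, True)"] that by (simp add: fstar_gen)
  have prod_in: "fstar (gen g) * gen g \<in> free_star ?G" if "g \<in> ?G" for g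
    unfolding fstar_gen unfolding gen_def mult_single
    by (rule single_in_free_star) (use that in \<open>auto simp: plus_word_def\<close>)
  have star_le: "\<rho> (fstar (gen g)) \<le> 1" if g: "g \<in> ?G" and le: "\<rho> (gen g) \<le> 1" for g
  proof -
    have eq: "fstar (fstar (gen g)) = gen g"
      by (simp add: fstar_gen) (simp add: fstar_def gen_def word_star_def)
    have "(\<rho> (fstar (gen g)))\<^sup>2 = \<rho> (gen g * fstar (gen g))"
      using cst[OF star_in[OF g]] eq by simp
    also have "\<dots> \<le> \<rho> (gen g) * \<rho> (fstar (gen g))"
      using mul gen_in star_in g by blast
    also have "\<dots> \<le> \<rho> (fstar (gen g))"
      using le pos[OF star_in[OF g]] by (simp add: mult_left_le_one_le pos[OF gen_in[OF g]])
    finally show ?thesis by (rule seminorm_square_le)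
  qed
  have proj_le: "\<rho> (proj v) \<le> 1" if v: "v \<in> verts E" for v
  proof -
    have g: "Inl v \<in> ?G" using v by (simp add: graph_gens_def)
    note pin = gen_in[OF g, folded proj_def]
    have r1: "\<rho> (fstar (proj v) - proj v) = 0"
      by (rule rel) (use v in \<open>unfold graph_rels_def, blast\<close>)
    have r2: "\<rho> (proj v * proj v - proj v) = 0"
      by (rule rel) (use v in \<open>unfold graph_rels_def, blast\<close>)
    have pp: "proj v * proj v \<in> free_star ?G"
      unfolding proj_def gen_def mult_single
      by (rule single_in_free_star) (use g in \<open>auto simp: plus_word_def\<close>)
    have "\<rho> (fstar (proj v)) \<le> \<rho> (proj v)"
      by (rule seminorm_diff_zero[OF \<rho> star_in[OF g, folded proj_def] pin r1])
    have d: "fstar (proj v) - proj v \<in> free_star ?G"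
      using star_in[OF g, folded proj_def] pin by (rule diff_in_free_star)
    have "(\<rho> (proj v))\<^sup>2 = \<rho> (fstar (proj v) * proj v)"
      using cst[OF pin] by simp
    also have "\<dots> = \<rho> ((fstar (proj v) - proj v) * proj v + proj v * proj v)"
      by (simp add: algebra_simps)
    also have "\<dots> \<le> \<rho> ((fstar (proj v) - proj v) * proj v) + \<rho> (proj v * proj v)"
    proof (rule tri[OF _ pp])
      show "(fstar (proj v) - proj v) * proj v \<in> free_star ?G"
        unfolding left_diff_distrib
        by (rule diff_in_free_star[OF prod_in[OF g, folded proj_def] pp])
    qed
    also have "\<dots> \<le> 0 + \<rho> (proj v)"
      using mul[OF d pin] r1 seminorm_diff_zero[OF \<rho> pp pin r2] by auto
    finally show ?thesis by (simp add: seminorm_square_le)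
  qed
  have gen_le: "\<rho> (gen g) \<le> 1" if g: "g \<in> ?G" for g
  proof (cases g)
    case (Inl v)
    then show ?thesis using g proj_le[of v] by (auto simp: graph_gens_def proj_def)
  next
    case (Inr e)
    then have e: "e \<in> arcs E" using g by (auto simp: graph_gens_def)
    then have h: "head E e \<in> verts E" using wf_digraph.head_in_verts[OF E] by blast
    have hin: "proj (head E e) \<in> free_star ?G"
      unfolding proj_def by (rule gen_in) (use h in \<open>simp add: graph_gens_def\<close>)
    have r: "\<rho> (fstar (gen g) * gen g - proj (head E e)) = 0"
      unfolding Inr piso_def[symmetric]
      by (rule rel) (use e in \<open>unfold graph_rels_def, blast\<close>)
    have "(\<rho> (gen g))\<^sup>2 \<le> \<rho> (proj (head E e))"
      using seminorm_diff_zero[OF \<rho> prod_in[OF g] hin r] cst[OF gen_in[OF g]] by simp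
    also have "\<dots> \<le> 1" by (rule proj_le[OF h])
    finally show ?thesis by (simp add: abs_square_le_1)
  qed
  have letter_le: "\<rho> (?s (Word [l])) \<le> 1" if "fst l \<in> ?G" for l
  proof (cases l)
    case (Pair g b)
    then show ?thesis
      using that gen_le[of g] star_le[of g, unfolded fstar_gen]
      by (cases b) (simp_all add: gen_def)
  qed
  have word_le: "\<rho> (?s (Word ls)) \<le> 1" if "ls \<noteq> []" "fst ` set ls \<subseteq> ?G" for ls
    using that
  proof (induction ls rule: list_nonempty_induct)
    case (single l)
    then show ?case using letter_le by simp
  next
    case (cons l ls)
    have in1: "?s (Word [l]) \<in> free_star ?G" and in2: "?s (Word ls) \<in> free_star ?G"
      using cons.hyps cons.prems by (simp_all add: single_in_free_star)
    have "?s (Word (l # ls)) = ?s (Word [l]) * ?s (Word ls)"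
      by (simp add: mult_single plus_word_def)
    then have "\<rho> (?s (Word (l # ls))) \<le> \<rho> (?s (Word [l])) * \<rho> (?s (Word ls))"
      using mul[OF in1 in2] by simp
    also have "\<dots> \<le> 1"
      using letter_le[of l] cons pos[OF in1] pos[OF in2] by (intro mult_le_one) auto
    finally show ?case .
  qed
  let ?t = "\<lambda>w. Poly_Mapping.single w (Poly_Mapping.lookup x w)"
  have term_in: "?t w \<in> free_star ?G" if "w \<in> Poly_Mapping.keys x" for w
    using x that by (intro single_in_free_star) (auto simp: free_star_def)
  have term_le: "\<rho> (?t w) \<le> cmod (Poly_Mapping.lookup x w)" if w: "w \<in> Poly_Mapping.keys x" for w
  proof -
    have in1: "?s w \<in> free_star ?G" and le: "\<rho> (?s w) \<le> 1"
      using x w word_le[of "letters w"] by (auto intro!: single_in_free_star simp: free_star_def)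
    have "\<rho> (?t w) = cmod (Poly_Mapping.lookup x w) * \<rho> (?s w)"
      using sc[OF in1, of "Poly_Mapping.lookup x w"] by (simp add: fscale_single)
    then show ?thesis using le by (simp add: mult_left_le)
  qed
  have zero: "\<rho> 0 = 0"
    using sc[OF zero_in_free_star, of 0] by (simp add: fscale_def)
  have "\<rho> (sum ?t W) \<le> (\<Sum>w\<in>W. cmod (Poly_Mapping.lookup x w))"
    if "finite W" "W \<subseteq> Poly_Mapping.keys x" for W
    using that
  proof (induction W rule: finite_induct)
    case empty
    then show ?case using zero by simp
  next
    case (insert w W)
    have "\<rho> (?t w + sum ?t W) \<le> \<rho> (?t w) + \<rho> (sum ?t W)"
      using insert term_in by (intro tri sum_in_free_star) auto
    then show ?case using insert term_le[of w] by auto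
  qed
  moreover have "sum ?t (Poly_Mapping.keys x) = x"
    by (rule poly_mapping_eqI)
      (simp add: lookup_sum lookup_single when_def in_keys_iff sum.delta)
  ultimately show ?thesis
    using finite_keys[of x] by (metis order_refl)
qed


section \<open>The graphs \<open>E\<^sub>n\<close>\<close>

datatype vertex = V nat | W nat

datatype edge = LoopEdge nat | Entry | PathEdge nat

definition loop_graph :: "nat \<Rightarrow> (vertex, edge) pre_digraph" where
  "loop_graph n =
     \<lparr>verts = V ` {1..n} \<union> W ` {1..},
      arcs = LoopEdge ` {1..n} \<union> {Entry} \<union> PathEdge ` {1..},
      tail = (\<lambda>e. case e of LoopEdge i \<Rightarrow> V i | Entry \<Rightarrow> W 1 | PathEdge j \<Rightarrow> W (j + 1)),
      head = (\<lambda>e. case e of LoopEdge i \<Rightarrow> V (if i = n then 1 else i + 1)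
                          | Entry \<Rightarrow> V 1 | PathEdge j \<Rightarrow> W j)\<rparr>"

lemma wf_loop_graph: "n \<ge> 1 \<Longrightarrow> wf_digraph (loop_graph n)"
  by unfold_locales (auto simp: loop_graph_def)

lemma finite_out_arcs_loop_graph: "finite (out_arcs (loop_graph n) v)"
proof (rule finite_subset)
  show "out_arcs (loop_graph n) v \<subseteq>
      (case v of V i \<Rightarrow> {LoopEdge i} | W j \<Rightarrow> {Entry, PathEdge (j - 1)})"
    by (auto simp: out_arcs_def loop_graph_def split: vertex.splits)
  show "finite (case v of V i \<Rightarrow> {LoopEdge i} | W j \<Rightarrow> {Entry, PathEdge (j - 1)})"
    by (simp split: vertex.splits)
qed


section \<open>The Hilbert spaces \<open>\<ell>\<^sup>2(I)\<close>\<close>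

typedef 'i ell2 = "{x :: 'i \<Rightarrow> complex. (\<lambda>i. (cmod (x i))\<^sup>2) summable_on UNIV}"
  morphisms coord Abs_ell2
  by (rule exI[of _ "\<lambda>_. 0"]) simp

setup_lifting type_definition_ell2

lemma ell2_add:
  fixes x y :: "'i \<Rightarrow> complex"
  assumes "(\<lambda>i. (cmod (x i))\<^sup>2) summable_on UNIV" "(\<lambda>i. (cmod (y i))\<^sup>2) summable_on UNIV"
  shows "(\<lambda>i. (cmod (x i + y i))\<^sup>2) summable_on UNIV"
proof (rule summable_on_comparison_test)
  show "(\<lambda>i. 2 * (cmod (x i))\<^sup>2 + 2 * (cmod (y i))\<^sup>2) summable_on UNIV"
    using assms by (intro summable_on_add summable_on_cmult_right)
  fix i
  have "(cmod (x i + y i))\<^sup>2 \<le> (cmod (x i) + cmod (y i))\<^sup>2"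
    by (intro power_mono norm_triangle_ineq) simp
  also have "\<dots> \<le> 2 * (cmod (x i))\<^sup>2 + 2 * (cmod (y i))\<^sup>2"
    using sum_squares_bound[of "cmod (x i)" "cmod (y i)"] by (simp add: power2_sum)
  finally show "(cmod (x i + y i))\<^sup>2 \<le> 2 * (cmod (x i))\<^sup>2 + 2 * (cmod (y i))\<^sup>2" .
qed simp_all

lemma ell2_scale:
  fixes x :: "'i \<Rightarrow> complex"
  assumes "(\<lambda>i. (cmod (x i))\<^sup>2) summable_on UNIV"
  shows "(\<lambda>i. (cmod (c * x i))\<^sup>2) summable_on UNIV"
  using summable_on_cmult_right[OF assms, of "(cmod c)\<^sup>2"] by (simp add: norm_mult power_mult_distrib)

lemma ell2_inner:
  fixes x y :: "'i \<Rightarrow> complex"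
  assumes "(\<lambda>i. (cmod (x i))\<^sup>2) summable_on UNIV" "(\<lambda>i. (cmod (y i))\<^sup>2) summable_on UNIV"
  shows "(\<lambda>i. x i \<bullet> y i) summable_on UNIV"
proof (rule abs_summable_summable, rule summable_on_comparison_test)
  show "(\<lambda>i. (cmod (x i))\<^sup>2 + (cmod (y i))\<^sup>2) summable_on UNIV"
    using assms by (rule summable_on_add)
  fix i
  have "norm (x i \<bullet> y i) \<le> cmod (x i) * cmod (y i)"
    using Cauchy_Schwarz_ineq2 by simp
  also have "\<dots> \<le> (cmod (x i))\<^sup>2 + (cmod (y i))\<^sup>2"
  proof -
    have "0 \<le> cmod (x i) * cmod (y i)" by simp
    then show ?thesis using sum_squares_bound[of "cmod (x i)" "cmod (y i)"] by linarith
  qed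
  finally show "norm (x i \<bullet> y i) \<le> (cmod (x i))\<^sup>2 + (cmod (y i))\<^sup>2" .
qed simp_all

lift_definition scaleC :: "complex \<Rightarrow> 'i ell2 \<Rightarrow> 'i ell2" (infixr "*\<^sub>C" 75)
  is "\<lambda>c x i. c * x i"
  by (rule ell2_scale)

text \<open>
  The real inner product below is the real part of the complex one, \<open>cinner\<close>, so that the
  norm is the usual norm of \<open>\<ell>\<^sup>2(I)\<close>.
\<close>

instantiation ell2 :: (type) real_inner
begin

lift_definition zero_ell2 :: "'a ell2" is "\<lambda>_. 0" by simp

lift_definition plus_ell2 :: "'a ell2 \<Rightarrow> 'a ell2 \<Rightarrow> 'a ell2" is "\<lambda>x y i. x i + y i"
  by (rule ell2_add)

lift_definition uminus_ell2 :: "'a ell2 \<Rightarrow> 'a ell2" is "\<lambda>x i. - x i" by simp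

definition minus_ell2 :: "'a ell2 \<Rightarrow> 'a ell2 \<Rightarrow> 'a ell2" where
  "minus_ell2 x y = x + - y"

definition scaleR_ell2 :: "real \<Rightarrow> 'a ell2 \<Rightarrow> 'a ell2" where
  "scaleR_ell2 r x = complex_of_real r *\<^sub>C x"

definition inner_ell2 :: "'a ell2 \<Rightarrow> 'a ell2 \<Rightarrow> real" where
  "inner_ell2 x y = (\<Sum>\<^sub>\<infinity>i. coord x i \<bullet> coord y i)"

definition norm_ell2 :: "'a ell2 \<Rightarrow> real" where
  "norm_ell2 x = sqrt (x \<bullet> x)"

definition sgn_ell2 :: "'a ell2 \<Rightarrow> 'a ell2" where
  "sgn_ell2 x = inverse (norm x) *\<^sub>R x"

definition dist_ell2 :: "'a ell2 \<Rightarrow> 'a ell2 \<Rightarrow> real" where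
  "dist_ell2 x y = norm (x - y)"

definition uniformity_ell2 :: "('a ell2 \<times> 'a ell2) filter" where
  "uniformity_ell2 = (INF e\<in>{0 <..}. principal {(x, y). dist x y < e})"

definition open_ell2 :: "'a ell2 set \<Rightarrow> bool" where
  "open_ell2 U \<longleftrightarrow> (\<forall>x\<in>U. \<forall>\<^sub>F (x', y) in uniformity. x' = x \<longrightarrow> y \<in> U)"

instance
proof
  have sq: "(\<lambda>i. (cmod (coord x i))\<^sup>2) summable_on UNIV" for x :: "'a ell2"
    using coord[of x] by simp
  fix x y z :: "'a ell2" and a b :: real
  show "x + y + z = x + (y + z)" by transfer (simp add: add.assoc)
  show "x + y = y + x" by transfer (simp add: add.commute)
  show "0 + x = x" by transfer simp
  show "- x + x = 0" by transfer simp
  show "x - y = x + - y" by (rule minus_ell2_def)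
  show "a *\<^sub>R (x + y) = a *\<^sub>R x + a *\<^sub>R y"
    unfolding scaleR_ell2_def by transfer (simp add: algebra_simps)
  show "(a + b) *\<^sub>R x = a *\<^sub>R x + b *\<^sub>R x"
    unfolding scaleR_ell2_def by transfer (simp add: algebra_simps)
  show "a *\<^sub>R b *\<^sub>R x = (a * b) *\<^sub>R x"
    unfolding scaleR_ell2_def by transfer (simp add: algebra_simps)
  show "1 *\<^sub>R x = x" unfolding scaleR_ell2_def by transfer simp
  show "sgn x = inverse (norm x) *\<^sub>R x" by (rule sgn_ell2_def)
  show "dist x y = norm (x - y)" by (rule dist_ell2_def)
  show "(uniformity :: ('a ell2 \<times> 'a ell2) filter) = (INF e\<in>{0 <..}. principal {(x, y). dist x y < e})"
    by (rule uniformity_ell2_def)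
  show "open U \<longleftrightarrow> (\<forall>x\<in>U. \<forall>\<^sub>F (x', y) in uniformity. x' = x \<longrightarrow> y \<in> U)" for U :: "'a ell2 set"
    by (rule open_ell2_def)
  show "x \<bullet> y = y \<bullet> x" unfolding inner_ell2_def by (simp add: inner_commute)
  show "(x + y) \<bullet> z = x \<bullet> z + y \<bullet> z"
    unfolding inner_ell2_def plus_ell2.rep_eq inner_add_left
    by (intro infsum_add ell2_inner sq)
  show "(a *\<^sub>R x) \<bullet> y = a * (x \<bullet> y)"
    unfolding inner_ell2_def scaleR_ell2_def scaleC.rep_eq
    by (simp add: scaleR_conv_of_real[symmetric] infsum_cmult_right')
  show "0 \<le> x \<bullet> x" unfolding inner_ell2_def by (intro infsum_nonneg) simp
  show "x \<bullet> x = 0 \<longleftrightarrow> x = 0"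
  proof
    assume "x \<bullet> x = 0"
    then have "coord x i \<bullet> coord x i = 0" for i
      unfolding inner_ell2_def
      using nonneg_infsum_le_0D[of "\<lambda>i. coord x i \<bullet> coord x i" UNIV i] ell2_inner[OF sq sq]
      by simp
    then show "x = 0" by (auto simp: coord_inject[symmetric] zero_ell2.rep_eq)
  qed (simp add: inner_ell2_def zero_ell2.rep_eq)
  show "norm x = sqrt (x \<bullet> x)" by (rule norm_ell2_def)
qed

end

definition cinner :: "'i ell2 \<Rightarrow> 'i ell2 \<Rightarrow> complex" where
  "cinner x y = (\<Sum>\<^sub>\<infinity>i. cnj (coord x i) * coord y i)"


section \<open>Algebras of operators and the algebra \<open>C(S\<^sup>1) \<otimes> K\<close>\<close>

text \<open>
  Operators are real-linear bounded maps \<open>\<Rightarrow>\<^sub>L\<close>; complex linearity is imposed by \<open>clinear_op\<close>.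
\<close>

type_synonym 'i oper = "'i ell2 \<Rightarrow>\<^sub>L 'i ell2"

definition clinear_op :: "'i oper \<Rightarrow> bool" where
  "clinear_op T \<longleftrightarrow> (\<forall>c x. blinfun_apply T (c *\<^sub>C x) = c *\<^sub>C blinfun_apply T x)"

definition cscale_op :: "complex \<Rightarrow> 'i oper \<Rightarrow> 'i oper" where
  "cscale_op c T = Blinfun (\<lambda>x. c *\<^sub>C blinfun_apply T x)"

definition adj_op :: "'i oper \<Rightarrow> 'i oper" where
  "adj_op T = (THE S. \<forall>x y. cinner (blinfun_apply T x) y = cinner x (blinfun_apply S y))"

definition operator_algebra :: "'i oper set \<Rightarrow> 'i oper star_algebra" where
  "operator_algebra S =
     \<lparr>elts = S, add = (+), mult = (o\<^sub>L), smul = cscale_op, star = adj_op\<rparr>"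

definition compact_ops :: "nat oper set" where
  "compact_ops = {T. clinear_op T \<and> compact (closure (blinfun_apply T ` cball 0 1))}"

text \<open>
  \<open>C(S\<^sup>1)\<close> is represented faithfully, by multiplication operators, on \<open>\<ell>\<^sup>2(S\<^sup>1)\<close> (\<open>S\<^sup>1\<close> as a discrete
  set); there the operator norm of a multiplication operator is the supremum norm.
\<close>

typedef circle = "sphere (0 :: complex) 1"
  morphisms point Abs_circle
  by (rule exI[of _ 1]) simp

definition mult_op :: "(complex \<Rightarrow> complex) \<Rightarrow> circle oper" where
  "mult_op f = Blinfun (\<lambda>x. Abs_ell2 (\<lambda>t. f (point t) * coord x t))"

definition circle_functions :: "circle oper set" where
  "circle_functions = {mult_op f | f. continuous_on (sphere 0 1) f}"

definition vec_tensor :: "'i ell2 \<Rightarrow> 'j ell2 \<Rightarrow> ('i \<times> 'j) ell2" where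
  "vec_tensor x y = Abs_ell2 (\<lambda>(i, j). coord x i * coord y j)"

definition op_tensor :: "'i oper \<Rightarrow> 'j oper \<Rightarrow> ('i \<times> 'j) oper" where
  "op_tensor a b = (THE T. \<forall>x y.
     blinfun_apply T (vec_tensor x y) = vec_tensor (blinfun_apply a x) (blinfun_apply b y))"

text \<open>
  The spatial tensor product of two C*-algebras of operators: the norm closure of the algebraic
  tensor product in the operators on the tensor product of the Hilbert spaces.  (The real span is
  the complex span, since the first factor is closed under complex multiples.)
\<close>

definition spatial_tensor :: "'i oper set \<Rightarrow> 'j oper set \<Rightarrow> ('i \<times> 'j) oper set" where
  "spatial_tensor A B = closure (span {op_tensor a b | a b. a \<in> A \<and> b \<in> B})"

definition circle_tensor_compacts :: "(circle \<times> nat) oper star_algebra" where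
  "circle_tensor_compacts = operator_algebra (spatial_tensor circle_functions compact_ops)"

end

theory Submission
  imports Defs
begin

text \<open>
  Every vertex of \<open>E\<^sub>n\<close> emits exactly one edge.  Numbering the vertices suitably by \<open>0, 1, 2, \<dots>\<close>,
  the edges lead from \<open>a + 1\<close> to \<open>a\<close>, and one further edge leads from \<open>0\<close> to \<open>n - 1\<close>; the loop
  consists of the vertices below \<open>n\<close>.  Modulo the relations, every word in the generators and
  their adjoints is therefore either zero or determined by an arrow \<open>(a, k, b)\<close>: its two end
  vertices and the number \<open>k\<close> of times, counted with sign, that it runs through the edge
  \<open>0 \<rightarrow> n - 1\<close>.  Such a word acts on \<open>\<ell>\<^sup>2(S\<^sup>1 \<times> \<nat>)\<close> as \<open>z\<^sup>k \<otimes> e\<^sub>a\<^sub>b\<close>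
  (\<open>arrow_op\<close>), which gives a representation \<open>graph_op n\<close> of the relations.

  The main point is that the operator norm in this representation is the universal norm
  (\<open>graph_universal_norm\<close>).  Let \<open>\<rho>\<close> be any C*-seminorm that vanishes on the relations.  Words with
  the same arrow agree modulo \<open>\<rho>\<close>, and generators have seminorm at most \<open>1\<close>, so \<open>\<rho> x\<close> is at most
  the sum of the moduli of the coefficients of \<open>x\<close> at the arrows.  Each coefficient is a Fourier
  coefficient of a matrix entry of \<open>graph_op n x\<close>, hence bounded by the operator norm.  So
  \<open>\<rho> x \<le> C (2 D + 1) \<parallel>graph_op n x\<parallel>\<close>, where \<open>D\<close> bounds the length of the words in \<open>x\<close> and \<open>C\<close> depends only on
  the vertices involved.  Applied to the powers \<open>H\<^sup>m\<close> of \<open>H = x\<^sup>* x\<close> for \<open>m = 2\<^sup>j\<close>, where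
  \<open>\<rho> (H\<^sup>m) = (\<rho> x)\<^sup>2\<^sup>m\<close> by the C*-identity while \<open>D\<close> grows only linearly in \<open>m\<close>, this yields
  \<open>\<rho> x \<le> \<parallel>graph_op n x\<parallel>\<close> after taking roots (\<open>seminorm_le_graph_op\<close>).

  Consequently \<open>C\<^sup>*(E\<^sub>n)\<close> is isomorphic to the norm closure of the range of \<open>graph_op n\<close>
  (\<open>star_iso_compl_op\<close>).  By the Stone-Weierstrass theorem and the approximation of
  compact operators by finite matrices, this closure is \<open>C(S\<^sup>1) \<otimes> K\<close> for every \<open>n\<close>
  (\<open>graph_range_eq\<close>).

  The gauge automorphism for \<open>\<zeta>\<close> becomes conjugation by a unitary that multiplies
  \<open>z\<^sup>k \<otimes> e\<^sub>a\<^sub>b\<close> by \<open>\<zeta>\<close> to the power \<open>a + n k - b\<close>.  Comparing matrix entries shows that the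
  \<open>(a, b)\<close> entry of an element of the core is zero unless \<open>a\<close> and \<open>b\<close> are congruent modulo \<open>n\<close>, and that an
  entry that is nonzero at one point of the circle is nonzero everywhere (\<open>core_entry\<close>): the core is a sum of \<open>n\<close> copies of \<open>K\<close>.
  Hence \<open>n\<close> is the largest number of nonzero elements \<open>x\<^sub>i\<close> of the core with \<open>x\<^sub>i y x\<^sub>j = 0\<close> for all
  \<open>i \<noteq> j\<close> and all \<open>y\<close> in the core.  This number is preserved by isomorphisms of the cores
  (\<open>core_iso_le\<close>), so it determines \<open>n\<close>.
\<close>

section \<open>The Hilbert spaces \<open>\<ell>\<^sup>2(I)\<close>: coordinates and completeness\<close>

lemma coord_sq_summable: "(\<lambda>i. (cmod (coord x i))\<^sup>2) summable_on UNIV"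
  using coord[of x] by simp

lemma ell2_eqI: "(\<And>i. coord x i = coord y i) \<Longrightarrow> x = y"
  by (auto simp: coord_inject[symmetric])

lemma coord_add [simp]: "coord (x + y) i = coord x i + coord y i"
  by (simp add: plus_ell2.rep_eq)

lemma coord_zero [simp]: "coord 0 i = 0"
  by (simp add: zero_ell2.rep_eq)

lemma coord_minus [simp]: "coord (- x) i = - coord x i"
  by (simp add: uminus_ell2.rep_eq)

lemma coord_diff [simp]: "coord (x - y) i = coord x i - coord y i"
  unfolding minus_ell2_def by (simp only: coord_add coord_minus) simp

lemma coord_scaleC [simp]: "coord (c *\<^sub>C x) i = c * coord x i"
  by (simp add: scaleC.rep_eq)

lemma coord_scaleR [simp]: "coord (r *\<^sub>R x) i = complex_of_real r * coord x i"
  by (simp add: scaleR_ell2_def)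

lemma coord_sum [simp]: "coord (sum f A) i = (\<Sum>a\<in>A. coord (f a) i)"
  by (induction A rule: infinite_finite_induct) auto

lemma norm_ell2_sq: "(norm x)\<^sup>2 = (\<Sum>\<^sub>\<infinity>i. (cmod (coord x i))\<^sup>2)"
  by (simp add: power2_norm_eq_inner inner_ell2_def)

lemma sum_coord_le: "finite F \<Longrightarrow> (\<Sum>i\<in>F. (cmod (coord x i))\<^sup>2) \<le> (norm x)\<^sup>2"
  unfolding norm_ell2_sq by (rule finite_sum_le_infsum[OF coord_sq_summable]) auto

lemma coord_le_norm: "cmod (coord x i) \<le> norm x"
  using sum_coord_le[of "{i}" x] by (simp add: power2_le_iff_abs_le)

text \<open>
  Square summability and a norm bound are both read off from the finite partial sums; this is
  how the operators \<open>weighted_op\<close> and \<open>field_op\<close> below are seen to be well defined and bounded.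
\<close>

lemma ell2_bounded:
  fixes f :: "'i \<Rightarrow> complex"
  assumes "\<And>F. finite F \<Longrightarrow> (\<Sum>i\<in>F. (cmod (f i))\<^sup>2) \<le> B\<^sup>2" "0 \<le> B"
  shows "coord (Abs_ell2 f) = f" "norm (Abs_ell2 f) \<le> B"
proof -
  have s: "(\<lambda>i. (cmod (f i))\<^sup>2) summable_on UNIV"
    by (rule nonneg_bdd_above_summable_on) (use assms in \<open>auto intro!: bdd_aboveI2[of _ _ "B\<^sup>2"]\<close>)
  show c: "coord (Abs_ell2 f) = f"
    using s by (simp add: Abs_ell2_inverse)
  have "(norm (Abs_ell2 f))\<^sup>2 \<le> B\<^sup>2"
    unfolding norm_ell2_sq c using s assms by (intro infsum_le_finite_sums) auto
  then show "norm (Abs_ell2 f) \<le> B"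
    using assms(2) by (rule power2_le_imp_le)
qed

lemma norm_ell2_leI:
  assumes "\<And>F. finite F \<Longrightarrow> (\<Sum>i\<in>F. (cmod (coord x i))\<^sup>2) \<le> B\<^sup>2" "0 \<le> B"
  shows "norm x \<le> B"
  using ell2_bounded(2)[of "coord x" B, OF assms] by (simp add: coord_inverse)

lemma norm_scaleC [simp]: "norm (c *\<^sub>C x) = cmod c * norm x"
proof -
  have "(norm (c *\<^sub>C x))\<^sup>2 = (cmod c * norm x)\<^sup>2"
    by (simp add: norm_ell2_sq power_mult_distrib norm_mult infsum_cmult_right')
  then show ?thesis by (simp add: power2_eq_iff_nonneg)
qed

lemma scaleC_simps [simp]:
  "c *\<^sub>C (x + y) = c *\<^sub>C x + c *\<^sub>C y" "c *\<^sub>C (x - y) = c *\<^sub>C x - c *\<^sub>C y" "c *\<^sub>C 0 = 0"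
  "c *\<^sub>C d *\<^sub>C x = (c * d) *\<^sub>C x" "1 *\<^sub>C x = x" "0 *\<^sub>C x = 0"
  by (auto intro!: ell2_eqI simp: algebra_simps)

text \<open>
  Completeness, through coordinatewise limits.  It makes the bounded operators complete, so that
  Cauchy sequences in the free algebra have limits among the operators.
\<close>

instance ell2 :: (type) banach
proof
  fix X :: "nat \<Rightarrow> 'a ell2"
  assume C: "Cauchy X"
  have "Cauchy (\<lambda>k. coord (X k) i)" for i
  proof (rule CauchyI)
    fix e :: real assume "0 < e"
    then obtain N where N: "\<And>m n. m \<ge> N \<Longrightarrow> n \<ge> N \<Longrightarrow> norm (X m - X n) < e"
      using CauchyD[OF C] by blast
    have "norm (coord (X m) i - coord (X n) i) < e" if "m \<ge> N" "n \<ge> N" for m n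
      using coord_le_norm[of "X m - X n" i] N[OF that] by simp
    then show "\<exists>N. \<forall>m\<ge>N. \<forall>n\<ge>N. norm (coord (X m) i - coord (X n) i) < e" by blast
  qed
  then have "\<exists>f. \<forall>i. (\<lambda>k. coord (X k) i) \<longlonglongrightarrow> f i"
    by (intro choice allI) (metis Cauchy_convergent_iff convergent_def)
  then obtain f where f: "\<And>i. (\<lambda>k. coord (X k) i) \<longlonglongrightarrow> f i" by blast
  have tail: "coord (Abs_ell2 (\<lambda>i. coord (X m) i - f i)) = (\<lambda>i. coord (X m) i - f i)"
    "norm (Abs_ell2 (\<lambda>i. coord (X m) i - f i)) \<le> e"
    if N: "\<And>k. k \<ge> N \<Longrightarrow> norm (X m - X k) \<le> e" and e: "e > 0" for e N m
  proof -
    have "(\<Sum>i\<in>F. (cmod (coord (X m) i - f i))\<^sup>2) \<le> e\<^sup>2" if "finite F" for F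
    proof (rule tendsto_upperbound)
      show "(\<lambda>k. \<Sum>i\<in>F. (cmod (coord (X m) i - coord (X k) i))\<^sup>2)
          \<longlonglongrightarrow> (\<Sum>i\<in>F. (cmod (coord (X m) i - f i))\<^sup>2)"
        by (intro tendsto_intros f)
      show "\<forall>\<^sub>F k in sequentially. (\<Sum>i\<in>F. (cmod (coord (X m) i - coord (X k) i))\<^sup>2) \<le> e\<^sup>2"
        using eventually_ge_at_top[of N]
      proof eventually_elim
        case (elim k)
        have "(norm (X m - X k))\<^sup>2 \<le> e\<^sup>2"
          using N[OF elim] by (intro power_mono) auto
        then show ?case using sum_coord_le[OF that, of "X m - X k"] by simp
      qed
    qed simp
    from ell2_bounded[OF this] e show "coord (Abs_ell2 (\<lambda>i. coord (X m) i - f i)) = (\<lambda>i. coord (X m) i - f i)"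
      "norm (Abs_ell2 (\<lambda>i. coord (X m) i - f i)) \<le> e" by auto
  qed
  obtain N1 where N1: "\<And>m n. m \<ge> N1 \<Longrightarrow> n \<ge> N1 \<Longrightarrow> norm (X m - X n) < 1"
    using CauchyD[OF C, of 1] by auto
  define y where "y = X N1 - Abs_ell2 (\<lambda>i. coord (X N1) i - f i)"
  have y: "coord y = f"
    unfolding y_def using tail(1)[of N1 N1 1] N1[of N1] by (auto simp: less_imp_le)
  have "X \<longlonglongrightarrow> y"
  proof (rule LIMSEQ_I)
    fix e :: real assume "0 < e"
    then obtain N where N: "\<And>m n. m \<ge> N \<Longrightarrow> n \<ge> N \<Longrightarrow> norm (X m - X n) < e / 2"
      using CauchyD[OF C, of "e / 2"] by auto
    have "norm (X m - y) < e" if "m \<ge> N" for m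
    proof -
      have "X m - y = Abs_ell2 (\<lambda>i. coord (X m) i - f i)"
        by (rule ell2_eqI) (use tail(1)[of N m "e / 2"] N[OF that] \<open>0 < e\<close> in \<open>auto simp: y less_imp_le\<close>)
      then show ?thesis
        using tail(2)[of N m "e / 2"] N[OF that] \<open>0 < e\<close> by (auto simp: less_imp_le)
    qed
    then show "\<exists>N. \<forall>m\<ge>N. norm (X m - y) < e" by blast
  qed
  then show "convergent X" by (auto simp: convergent_def)
qed

text \<open>
  The standard basis vectors, and the coordinate projection \<open>truncation F\<close> onto the vectors
  supported in \<open>F\<close>.
\<close>

definition ket :: "'i \<Rightarrow> 'i ell2" where
  "ket i = Abs_ell2 (\<lambda>j. if j = i then 1 else 0)"

definition truncation :: "'i set \<Rightarrow> 'i ell2 \<Rightarrow> 'i ell2" where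
  "truncation F x = Abs_ell2 (\<lambda>i. if i \<in> F then coord x i else 0)"

lemma
  shows coord_truncation [simp]: "coord (truncation F x) i = (if i \<in> F then coord x i else 0)"
    and norm_truncation_le: "norm (truncation F x) \<le> norm x"
proof -
  have "(\<Sum>i\<in>A. (cmod (if i \<in> F then coord x i else 0))\<^sup>2) \<le> (norm x)\<^sup>2" if "finite A" for A
    by (rule order_trans[OF sum_mono sum_coord_le[OF that, of x]]) auto
  note * = ell2_bounded[OF this norm_ge_zero]
  show "coord (truncation F x) i = (if i \<in> F then coord x i else 0)" "norm (truncation F x) \<le> norm x"
    using * by (simp_all add: truncation_def)
qed

lemma coord_ket [simp]: "coord (ket i) j = (if j = i then 1 else 0)"
  and norm_ket_le: "norm (ket i) \<le> 1"
proof -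
  have "(\<Sum>j\<in>F. (cmod (if j = i then 1 else 0))\<^sup>2) \<le> 1\<^sup>2" if "finite F" for F
    using that by (simp add: if_distrib[of cmod] if_distrib[of "\<lambda>x. x\<^sup>2"] cong: if_cong)
  note * = ell2_bounded[OF this]
  show "coord (ket i) j = (if j = i then 1 else 0)" "norm (ket i) \<le> 1"
    using * by (simp_all add: ket_def)
qed

lemma truncation_eq_sum: "finite F \<Longrightarrow> truncation F x = (\<Sum>i\<in>F. coord x i *\<^sub>C ket i)"
  by (rule ell2_eqI) (simp add: if_distrib cong: if_cong)

lemma truncation_approx:
  assumes "e > 0"
  obtains F where "finite F" "\<And>F'. F \<subseteq> F' \<Longrightarrow> norm (x - truncation F' x) < e"
proof -
  let ?f = "\<lambda>i. (cmod (coord x i))\<^sup>2"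
  have "(?f has_sum (norm x)\<^sup>2) UNIV"
    unfolding norm_ell2_sq using coord_sq_summable by (rule has_sum_infsum)
  then have "\<forall>\<^sub>F F in finite_subsets_at_top UNIV. dist (sum ?f F) ((norm x)\<^sup>2) < (e / 2)\<^sup>2"
    using assms unfolding has_sum_def by (intro tendstoD) auto
  then obtain F where F: "finite F"
    "\<And>A. finite A \<Longrightarrow> F \<subseteq> A \<Longrightarrow> dist (sum ?f A) ((norm x)\<^sup>2) < (e / 2)\<^sup>2"
    by (auto simp: eventually_finite_subsets_at_top)
  show ?thesis
  proof
    show "finite F" by fact
    fix F' assume F': "F \<subseteq> F'"
    have "norm (x - truncation F' x) \<le> e / 2"
    proof (rule norm_ell2_leI)
      fix A :: "'a set" assume A: "finite A"
      have "(\<Sum>i\<in>A. (cmod (coord (x - truncation F' x) i))\<^sup>2)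
          = (\<Sum>i\<in>A - F. (cmod (coord (x - truncation F' x) i))\<^sup>2)"
        using A F' by (intro sum.mono_neutral_right) auto
      also have "\<dots> \<le> (\<Sum>i\<in>A - F. ?f i)"
        by (intro sum_mono) simp
      also have "\<dots> = sum ?f (A \<union> F) - sum ?f F"
        using A F(1) by (simp add: sum_diff[symmetric] Un_Diff)
      also have "\<dots> \<le> (norm x)\<^sup>2 - sum ?f F"
        using sum_coord_le[of "A \<union> F" x] A F(1) by simp
      also have "\<dots> \<le> (e / 2)\<^sup>2"
        using F(2)[OF F(1)] by (simp add: dist_real_def)
      finally show "(\<Sum>i\<in>A. (cmod (coord (x - truncation F' x) i))\<^sup>2) \<le> (e / 2)\<^sup>2" .
    qed (use assms in simp)
    then show "norm (x - truncation F' x) < e" using assms by simp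
  qed
qed

text \<open>A bounded real-linear operator is determined by its values on the multiples of the basis.\<close>

lemma oper_eqI:
  fixes T T' :: "'i ell2 \<Rightarrow>\<^sub>L 'j ell2"
  assumes "\<And>c i. blinfun_apply T (c *\<^sub>C ket i) = blinfun_apply T' (c *\<^sub>C ket i)"
  shows "T = T'"
proof -
  have 0: "blinfun_apply (T - T') (truncation F x) = 0" if "finite F" for F x
    by (simp add: truncation_eq_sum that blinfun.sum_right blinfun.diff_left assms)
  have "blinfun_apply (T - T') x = 0" for x
  proof (rule ccontr)
    let ?D = "T - T'"
    assume "blinfun_apply ?D x \<noteq> 0"
    then have D: "norm (blinfun_apply ?D x) > 0" by simp
    have "norm ?D \<noteq> 0" using D by auto
    then have nD: "norm ?D > 0" by simp
    obtain F where F: "finite F" "\<And>F'. F \<subseteq> F' \<Longrightarrow> norm (x - truncation F' x) < norm (blinfun_apply ?D x) / norm ?D"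
      using truncation_approx[of "norm (blinfun_apply ?D x) / norm ?D" x] D nD by auto
    have "norm (blinfun_apply ?D x) = norm (blinfun_apply ?D (x - truncation F x))"
      using 0[OF F(1)] by (simp add: blinfun.diff_right)
    also have "\<dots> \<le> norm ?D * norm (x - truncation F x)" by (rule norm_blinfun)
    also have "\<dots> < norm ?D * (norm (blinfun_apply ?D x) / norm ?D)"
      using F(2)[of F] nD by (intro mult_strict_left_mono) auto
    finally show False using nD by simp
  qed
  then show ?thesis
    by (intro blinfun_eqI) (simp add: blinfun.diff_left)
qed

section \<open>Adjoints and weighted partial permutations\<close>

text \<open>
  For complex linear operators, adjoints for the complex and for the real inner product agree; this
  formula allows the use of the real one throughout.
\<close>

lemma cinner_eq_inner: "cinner x y = Complex (x \<bullet> y) ((\<i> *\<^sub>C x) \<bullet> y)"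
proof -
  have s: "(\<lambda>i. cnj (coord x i) * coord y i) summable_on UNIV"
  proof (rule abs_summable_summable, rule summable_on_comparison_test)
    show "(\<lambda>i. (cmod (coord x i))\<^sup>2 + (cmod (coord y i))\<^sup>2) summable_on UNIV"
      by (intro summable_on_add coord_sq_summable)
    fix i
    have "0 \<le> cmod (coord x i) * cmod (coord y i)" by simp
    then have "cmod (coord x i) * cmod (coord y i) \<le> (cmod (coord x i))\<^sup>2 + (cmod (coord y i))\<^sup>2"
      using sum_squares_bound[of "cmod (coord x i)" "cmod (coord y i)"] by linarith
    then show "norm (cnj (coord x i) * coord y i) \<le> (cmod (coord x i))\<^sup>2 + (cmod (coord y i))\<^sup>2"
      by (simp add: norm_mult)
  qed simp
  have "Re (cinner x y) = x \<bullet> y"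
    unfolding cinner_def inner_ell2_def infsum_Re[OF s, symmetric]
    by (simp add: inner_complex_def)
  moreover have "Im (cinner x y) = (\<i> *\<^sub>C x) \<bullet> y"
    unfolding cinner_def inner_ell2_def infsum_Im[OF s, symmetric]
    by (simp add: inner_complex_def algebra_simps)
  ultimately show ?thesis by (simp add: complex_eq_iff)
qed

text \<open>
  \<open>S\<close> is the adjoint of the complex linear operator \<open>T\<close>, stated with the real inner product.  As a
  relation it needs no existence theorem for adjoints and passes to limits.
\<close>

definition is_adj :: "'i oper \<Rightarrow> 'i oper \<Rightarrow> bool" where
  "is_adj T S \<longleftrightarrow> clinear_op T \<and> clinear_op S \<and>
     (\<forall>x y. blinfun_apply T x \<bullet> y = x \<bullet> blinfun_apply S y)"

lemma adj_op_eq: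
  assumes "is_adj T S" shows "adj_op T = S"
  unfolding adj_op_def
proof (rule the_equality)
  show "\<forall>x y. cinner (blinfun_apply T x) y = cinner x (blinfun_apply S y)"
    using assms unfolding is_adj_def clinear_op_def cinner_eq_inner by metis
  fix S' assume S': "\<forall>x y. cinner (blinfun_apply T x) y = cinner x (blinfun_apply S' y)"
  have "x \<bullet> blinfun_apply S' y = x \<bullet> blinfun_apply S y" for x y
    using S'[rule_format, of x y] assms by (simp add: cinner_eq_inner is_adj_def)
  then have "(blinfun_apply S' y - blinfun_apply S y) \<bullet> (blinfun_apply S' y - blinfun_apply S y) = 0" for y
    by (simp add: inner_diff_right)
  then show "S' = S" by (intro blinfun_eqI) simp
qed

lemma is_adj_sym: "is_adj T S \<Longrightarrow> is_adj S T"
  unfolding is_adj_def by (metis inner_commute)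

lemma is_adj_norm:
  assumes "is_adj T S" shows "norm S = norm T" "norm (S o\<^sub>L T) = (norm T)\<^sup>2"
proof -
  have le: "(norm T)\<^sup>2 \<le> norm (S o\<^sub>L T)" if "is_adj T S" for T S :: "'a oper"
  proof -
    have "norm T \<le> sqrt (norm (S o\<^sub>L T))"
    proof (rule norm_blinfun_bound)
      fix x
      have "(norm (blinfun_apply T x))\<^sup>2 = x \<bullet> blinfun_apply (S o\<^sub>L T) x"
        using that by (simp add: is_adj_def power2_norm_eq_inner)
      also have "\<dots> \<le> norm x * norm (blinfun_apply (S o\<^sub>L T) x)" by (rule norm_cauchy_schwarz)
      also have "\<dots> \<le> norm x * (norm (S o\<^sub>L T) * norm x)"
        by (intro mult_left_mono norm_blinfun) simp
      also have "\<dots> = (sqrt (norm (S o\<^sub>L T)) * norm x)\<^sup>2"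
        by (simp add: power_mult_distrib power2_eq_square)
      finally show "norm (blinfun_apply T x) \<le> sqrt (norm (S o\<^sub>L T)) * norm x"
        by (rule power2_le_imp_le) simp
    qed simp
    then have "(norm T)\<^sup>2 \<le> (sqrt (norm (S o\<^sub>L T)))\<^sup>2" by (intro power_mono) auto
    then show ?thesis by simp
  qed
  have le2: "norm T \<le> norm S" if "is_adj T S" for T S :: "'a oper"
  proof (cases "norm T = 0")
    case False
    have "norm T * norm T \<le> norm S * norm T"
      using le[OF that] norm_blinfun_compose[of S T] by (simp add: power2_eq_square)
    then show ?thesis using False by simp
  qed simp
  show 1: "norm S = norm T" using le2[OF assms] le2[OF is_adj_sym[OF assms]] by simp
  show "norm (S o\<^sub>L T) = (norm T)\<^sup>2"
    using le[OF assms] norm_blinfun_compose[of S T] 1 by (simp add: power2_eq_square)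
qed

lemma bounded_linear_scaleC_apply: "bounded_linear (\<lambda>x. c *\<^sub>C blinfun_apply T x)"
proof (rule bounded_linear_intro[where K = "cmod c * norm T"])
  fix x
  have "cmod c * norm (blinfun_apply T x) \<le> cmod c * (norm T * norm x)"
    by (intro mult_left_mono norm_blinfun) simp
  then show "norm (c *\<^sub>C blinfun_apply T x) \<le> norm x * (cmod c * norm T)"
    by (simp add: mult_ac)
qed (auto simp: blinfun.add_right blinfun.scaleR_right intro!: ell2_eqI)

lemma cscale_op_apply [simp]: "blinfun_apply (cscale_op c T) x = c *\<^sub>C blinfun_apply T x"
  by (simp add: cscale_op_def bounded_linear_Blinfun_apply bounded_linear_scaleC_apply)

lemma norm_cscale_op [simp]: "norm (cscale_op c T) = cmod c * norm T"
proof -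
  have le: "norm (cscale_op c T) \<le> cmod c * norm T" for c and T :: "'a oper"
  proof (rule norm_blinfun_bound)
    fix x
    have "cmod c * norm (blinfun_apply T x) \<le> cmod c * (norm T * norm x)"
      by (intro mult_left_mono norm_blinfun) simp
    then show "norm (blinfun_apply (cscale_op c T) x) \<le> cmod c * norm T * norm x"
      by simp
  qed simp
  show ?thesis
  proof (cases "c = 0")
    case True
    then show ?thesis using le[of c T] by simp
  next
    case False
    have "T = cscale_op (inverse c) (cscale_op c T)"
      using False by (intro blinfun_eqI) simp
    then have "norm T \<le> cmod (inverse c) * norm (cscale_op c T)"
      using le by metis
    then show ?thesis using le[of c T] False by (simp add: norm_inverse field_simps norm_divide)
  qed
qed

lemma cscale_op_simps:
  "cscale_op c (S + T) = cscale_op c S + cscale_op c T"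
  "cscale_op (c + d) T = cscale_op c T + cscale_op d T"
  "cscale_op c (cscale_op d T) = cscale_op (c * d) T"
  "cscale_op 1 T = T" "cscale_op 0 T = 0" "cscale_op c 0 = 0"
  "cscale_op c S o\<^sub>L T = cscale_op c (S o\<^sub>L T)"
  by (auto intro!: blinfun_eqI ell2_eqI simp: blinfun.add_left algebra_simps)

lemma bounded_linear_cscale_op: "bounded_linear (cscale_op c)"
  by (rule bounded_linear_intro[where K = "cmod c"])
    (auto simp: cscale_op_simps mult.commute blinfun.scaleR_left intro!: blinfun_eqI ell2_eqI)

lemma compose_cscale_op:
  "clinear_op S \<Longrightarrow> S o\<^sub>L cscale_op c T = cscale_op c (S o\<^sub>L T)"
  by (rule blinfun_eqI) (simp add: clinear_op_def)

lemma is_adj_simps: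
  "is_adj 0 0"
  "is_adj id_blinfun id_blinfun"
  "is_adj T S \<Longrightarrow> is_adj T' S' \<Longrightarrow> is_adj (T + T') (S + S')"
  "is_adj T S \<Longrightarrow> is_adj T' S' \<Longrightarrow> is_adj (T o\<^sub>L T') (S' o\<^sub>L S)"
  by (auto simp: is_adj_def clinear_op_def blinfun.add_left inner_add_left inner_add_right)

lemma inner_scaleC: "(c *\<^sub>C x) \<bullet> y = x \<bullet> (cnj c *\<^sub>C y)"
  unfolding inner_ell2_def by (simp add: inner_complex_def algebra_simps)

lemma is_adj_cscale: "is_adj T S \<Longrightarrow> is_adj (cscale_op c T) (cscale_op (cnj c) S)"
  by (auto simp: is_adj_def clinear_op_def inner_scaleC mult.commute)

lemma is_adj_tendsto:
  assumes "\<And>k. is_adj (T k) (S k)" and T: "T \<longlonglongrightarrow> T0" and S: "S \<longlonglongrightarrow> S0"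
  shows "is_adj T0 S0"
proof -
  have ap: "(\<lambda>k. blinfun_apply (R k) x) \<longlonglongrightarrow> blinfun_apply R0 x" if "R \<longlonglongrightarrow> R0"
    for R and R0 :: "'a oper" and x
    using that by (intro tendsto_intros)
  have scC: "(\<lambda>k. c *\<^sub>C f k) \<longlonglongrightarrow> c *\<^sub>C l" if "f \<longlonglongrightarrow> l" for f and l :: "'a ell2" and c
  proof -
    have "bounded_linear (\<lambda>x. c *\<^sub>C blinfun_apply id_blinfun (x :: 'a ell2))"
      by (rule bounded_linear_scaleC_apply)
    then show ?thesis using bounded_linear.tendsto[OF _ that] by simp
  qed
  have cl: "clinear_op R0" if "\<And>k. clinear_op (R k)" "R \<longlonglongrightarrow> R0" for R and R0 :: "'a oper"
    unfolding clinear_op_def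
  proof (intro allI)
    fix c x
    have "(\<lambda>k. blinfun_apply (R k) (c *\<^sub>C x)) \<longlonglongrightarrow> c *\<^sub>C blinfun_apply R0 x"
      using that(1) scC[OF ap[OF that(2)]] by (simp add: clinear_op_def)
    then show "blinfun_apply R0 (c *\<^sub>C x) = c *\<^sub>C blinfun_apply R0 x"
      using ap[OF that(2)] LIMSEQ_unique by blast
  qed
  have "blinfun_apply T0 x \<bullet> y = x \<bullet> blinfun_apply S0 y" for x y
  proof (rule LIMSEQ_unique)
    show "(\<lambda>k. blinfun_apply (T k) x \<bullet> y) \<longlonglongrightarrow> blinfun_apply T0 x \<bullet> y"
      by (intro tendsto_intros T)
    show "(\<lambda>k. blinfun_apply (T k) x \<bullet> y) \<longlonglongrightarrow> x \<bullet> blinfun_apply S0 y"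
      using tendsto_inner[OF tendsto_const ap[OF S], of x y] assms(1) by (simp add: is_adj_def)
  qed
  then show ?thesis
    using cl[OF _ T] cl[OF _ S] assms(1) by (auto simp: is_adj_def)
qed

text \<open>
  The operator with \<open>(T x) i = \<phi> i * x (\<sigma> i)\<close>.  It is bounded when \<open>\<phi>\<close> is bounded and \<open>\<sigma>\<close> is injective
  where \<open>\<phi>\<close> does not vanish; multiplication operators, matrix units, the operators of arrows and the
  gauge unitaries are all of this form.
\<close>

definition weighted_op :: "('i \<Rightarrow> complex) \<Rightarrow> ('i \<Rightarrow> 'i) \<Rightarrow> 'i oper" where
  "weighted_op \<phi> \<sigma> = Blinfun (\<lambda>x. Abs_ell2 (\<lambda>i. \<phi> i * coord x (\<sigma> i)))"

lemma
  fixes \<phi> :: "'i \<Rightarrow> complex"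
  assumes inj: "inj_on \<sigma> {i. \<phi> i \<noteq> 0}" and B: "\<And>i. cmod (\<phi> i) \<le> B"
  shows coord_weighted_op: "coord (blinfun_apply (weighted_op \<phi> \<sigma>) x) i = \<phi> i * coord x (\<sigma> i)"
    and norm_weighted_op_le: "norm (weighted_op \<phi> \<sigma>) \<le> B"
    and clinear_weighted_op: "clinear_op (weighted_op \<phi> \<sigma>)"
proof -
  have B0: "0 \<le> B" using B[of undefined] norm_ge_zero order_trans by blast
  define T where "T = (\<lambda>x. Abs_ell2 (\<lambda>i. \<phi> i * coord x (\<sigma> i)))"
  have "(\<Sum>i\<in>F. (cmod (\<phi> i * coord x (\<sigma> i)))\<^sup>2) \<le> (B * norm x)\<^sup>2" if F: "finite F" for F x
  proof -
    let ?F = "F \<inter> {i. \<phi> i \<noteq> 0}"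
    have "(\<Sum>i\<in>F. (cmod (\<phi> i * coord x (\<sigma> i)))\<^sup>2) = (\<Sum>i\<in>?F. (cmod (\<phi> i * coord x (\<sigma> i)))\<^sup>2)"
      using F by (intro sum.mono_neutral_right) auto
    also have "\<dots> \<le> (\<Sum>i\<in>?F. B\<^sup>2 * (cmod (coord x (\<sigma> i)))\<^sup>2)"
      unfolding norm_mult power_mult_distrib
      by (intro sum_mono mult_right_mono power_mono B) auto
    also have "\<dots> = B\<^sup>2 * (\<Sum>j\<in>\<sigma> ` ?F. (cmod (coord x j))\<^sup>2)"
      using inj by (subst sum.reindex) (auto simp: sum_distrib_left intro: inj_on_subset)
    also have "\<dots> \<le> B\<^sup>2 * (norm x)\<^sup>2"
      using F by (intro mult_left_mono sum_coord_le) auto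
    finally show ?thesis by (simp add: power_mult_distrib)
  qed
  note * = ell2_bounded[OF this]
  have c: "coord (T x) i = \<phi> i * coord x (\<sigma> i)" for x i
    using *(1) B0 by (simp add: T_def)
  have n: "norm (T x) \<le> B * norm x" for x
    using *(2) B0 by (simp add: T_def)
  have bl: "bounded_linear T"
    by (rule bounded_linear_intro[where K = B])
      (auto intro!: ell2_eqI n[THEN order_trans] simp: c algebra_simps)
  have app: "blinfun_apply (weighted_op \<phi> \<sigma>) x = T x" for x
    using bounded_linear_Blinfun_apply[OF bl] by (simp add: weighted_op_def T_def)
  show "coord (blinfun_apply (weighted_op \<phi> \<sigma>) x) i = \<phi> i * coord x (\<sigma> i)"
    by (simp add: app c)
  show "norm (weighted_op \<phi> \<sigma>) \<le> B"
    using B0 n by (intro norm_blinfun_bound) (auto simp: app)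
  show "clinear_op (weighted_op \<phi> \<sigma>)"
    by (auto simp: clinear_op_def app c intro!: ell2_eqI)
qed

lemma weighted_op_adj:
  fixes \<phi> :: "'i \<Rightarrow> complex"
  assumes B: "\<And>i. cmod (\<phi> i) \<le> B" "\<And>i. cmod (\<psi> i) \<le> B"
    and l: "\<And>i. \<phi> i \<noteq> 0 \<Longrightarrow> \<tau> (\<sigma> i) = i \<and> \<psi> (\<sigma> i) = cnj (\<phi> i)"
    and r: "\<And>i. \<psi> i \<noteq> 0 \<Longrightarrow> \<sigma> (\<tau> i) = i \<and> \<phi> (\<tau> i) = cnj (\<psi> i)"
  shows "is_adj (weighted_op \<phi> \<sigma>) (weighted_op \<psi> \<tau>)"
proof -
  have i1: "inj_on \<sigma> {i. \<phi> i \<noteq> 0}" by (rule inj_on_inverseI[of _ \<tau>]) (use l in auto)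
  have i2: "inj_on \<tau> {i. \<psi> i \<noteq> 0}" by (rule inj_on_inverseI[of _ \<sigma>]) (use r in auto)
  note c = coord_weighted_op[OF i1 B(1)] coord_weighted_op[OF i2 B(2)]
  have bij: "bij_betw \<sigma> {i. \<phi> i \<noteq> 0} {i. \<psi> i \<noteq> 0}"
    by (rule bij_betw_byWitness[of _ \<tau>]) (use l r in auto)
  have "blinfun_apply (weighted_op \<phi> \<sigma>) x \<bullet> y = x \<bullet> blinfun_apply (weighted_op \<psi> \<tau>) y" for x y
  proof -
    have "blinfun_apply (weighted_op \<phi> \<sigma>) x \<bullet> y = (\<Sum>\<^sub>\<infinity>i\<in>{i. \<phi> i \<noteq> 0}. (\<phi> i * coord x (\<sigma> i)) \<bullet> coord y i)"
      unfolding inner_ell2_def c by (rule infsum_cong_neutral) auto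
    also have "\<dots> = (\<Sum>\<^sub>\<infinity>i\<in>{i. \<phi> i \<noteq> 0}. coord x (\<sigma> i) \<bullet> (\<psi> (\<sigma> i) * coord y (\<tau> (\<sigma> i))))"
      using l by (intro infsum_cong) (auto simp: inner_complex_def algebra_simps)
    also have "\<dots> = (\<Sum>\<^sub>\<infinity>j\<in>{i. \<psi> i \<noteq> 0}. coord x j \<bullet> (\<psi> j * coord y (\<tau> j)))"
      by (rule infsum_reindex_bij_betw[OF bij])
    also have "\<dots> = x \<bullet> blinfun_apply (weighted_op \<psi> \<tau>) y"
      unfolding inner_ell2_def c by (rule infsum_cong_neutral) auto
    finally show ?thesis .
  qed
  then show ?thesis
    by (simp add: is_adj_def clinear_weighted_op[OF i1 B(1)] clinear_weighted_op[OF i2 B(2)])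
qed

section \<open>Representations of the free \<open>*\<close>-algebra\<close>

lemma pm_expand: "x = (\<Sum>w\<in>Poly_Mapping.keys x. Poly_Mapping.single w (Poly_Mapping.lookup x w))"
  by (rule poly_mapping_eqI)
    (simp add: lookup_sum lookup_single when_def in_keys_iff sum.delta)

lemma poly_mapping_add_induct [case_names single add]:
  fixes x :: "'a \<Rightarrow>\<^sub>0 'b::comm_monoid_add"
  assumes single: "\<And>w c. P (Poly_Mapping.single w c)"
    and add: "\<And>x y. P x \<Longrightarrow> P y \<Longrightarrow> P (x + y)"
  shows "P x"
proof -
  have "P (\<Sum>w\<in>A. Poly_Mapping.single w (Poly_Mapping.lookup x w))" if "finite A" for A
    using that
  proof (induction A rule: finite_induct)
    case empty
    then show ?case using single[of undefined 0] by simp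
  qed (simp add: single add)
  from this[OF finite_keys, of x] show ?thesis using pm_expand[of x] by simp
qed

lemma free_star_induct [consumes 1, case_names single add]:
  assumes "x \<in> free_star G"
    and single: "\<And>w c. letters w \<noteq> [] \<Longrightarrow> fst ` set (letters w) \<subseteq> G \<Longrightarrow> P (Poly_Mapping.single w c)"
    and add: "\<And>x y. x \<in> free_star G \<Longrightarrow> y \<in> free_star G \<Longrightarrow> P x \<Longrightarrow> P y \<Longrightarrow> P (x + y)"
    and zero: "P 0"
  shows "P x"
proof -
  let ?t = "\<lambda>w. Poly_Mapping.single w (Poly_Mapping.lookup x w)"
  have "P (sum ?t A) \<and> sum ?t A \<in> free_star G" if "finite A" "A \<subseteq> Poly_Mapping.keys x" for A
    using that
  proof (induction A rule: finite_induct)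
    case empty
    then show ?case using zero zero_in_free_star by simp
  next
    case (insert w A)
    have w: "letters w \<noteq> []" "fst ` set (letters w) \<subseteq> G"
      using assms(1) insert.prems unfolding free_star_def by auto
    then show ?case
      using insert single_in_free_star[OF w] by (simp add: single add add_in_free_star)
  qed
  from this[OF finite_keys order_refl] show ?thesis using pm_expand[of x] by simp
qed

text \<open>
  The additive extension to finitely supported functions of a family \<open>F w\<close> of additive maps on the
  coefficients.  Adjoints, representations and substitutions on the free algebra are instances.
\<close>

definition lin :: "('k \<Rightarrow> complex \<Rightarrow> 'c::comm_monoid_add) \<Rightarrow> ('k \<Rightarrow>\<^sub>0 complex) \<Rightarrow> 'c" where
  "lin F x = (\<Sum>w\<in>Poly_Mapping.keys x. F w (Poly_Mapping.lookup x w))"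

lemma lin_superset:
  assumes "finite A" "Poly_Mapping.keys x \<subseteq> A" "\<And>w. F w 0 = 0"
  shows "lin F x = (\<Sum>w\<in>A. F w (Poly_Mapping.lookup x w))"
  unfolding lin_def using assms by (intro sum.mono_neutral_left) (auto simp: in_keys_iff)

lemma lin_add:
  assumes "\<And>w. F w 0 = 0" "\<And>w c d. F w (c + d) = F w c + F w d"
  shows "lin F (x + y) = lin F x + lin F y"
proof -
  let ?A = "Poly_Mapping.keys x \<union> Poly_Mapping.keys y"
  have "lin F z = (\<Sum>w\<in>?A. F w (Poly_Mapping.lookup z w))"
    if "Poly_Mapping.keys z \<subseteq> ?A" for z
    using that assms(1) by (intro lin_superset) auto
  moreover have "Poly_Mapping.keys (x + y) \<subseteq> ?A" by (rule Poly_Mapping.keys_add)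
  ultimately show ?thesis
    by (simp add: lookup_add assms(2) sum.distrib)
qed

lemma lin_single: "(\<And>w. F w 0 = 0) \<Longrightarrow> lin F (Poly_Mapping.single w c) = F w c"
  by (simp add: lin_def)

lemma lin_zero [simp]: "lin F 0 = 0"
  by (simp add: lin_def)

lemma fstar_lin: "fstar = lin (\<lambda>w c. Poly_Mapping.single (word_star w) (cnj c))"
  by (rule ext) (simp add: fstar_def lin_def)

lemma fstar_add: "fstar (x + y) = fstar x + fstar y"
  unfolding fstar_lin by (rule lin_add) (simp_all add: single_add)

lemma fstar_single: "fstar (Poly_Mapping.single w c) = Poly_Mapping.single (word_star w) (cnj c)"
  unfolding fstar_lin by (rule lin_single) simp

lemma fstar_zero [simp]: "fstar 0 = 0"
  by (simp add: fstar_lin)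

lemma fstar_minus: "fstar (x - y) = fstar x - fstar y"
  using fstar_add[of "x - y" y] by (simp add: algebra_simps)

lemma word_star_plus: "word_star (u + v) = word_star v + word_star u"
  by (simp add: word_star_def plus_word_def)

lemma word_star_star [simp]: "word_star (word_star w) = w"
  by (cases w) (simp add: word_star_def rev_map comp_def case_prod_beta)

lemma fstar_mult: "fstar (x * y) = fstar y * fstar x"
proof (induction x rule: poly_mapping_add_induct)
  case (single u c)
  show ?case
  proof (induction y rule: poly_mapping_add_induct)
    case (single v d)
    then show ?case by (simp add: mult_single fstar_single word_star_plus mult.commute)
  qed (simp add: fstar_add algebra_simps)
qed (simp add: fstar_add algebra_simps)

lemma fstar_fstar [simp]: "fstar (fstar x) = x"
  by (induction x rule: poly_mapping_add_induct) (simp_all add: fstar_single fstar_add)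

lemma fstar_in_free_star:
  assumes "x \<in> free_star G" shows "fstar x \<in> free_star G"
  using assms
proof (induction rule: free_star_induct)
  case (single w c)
  have "fst ` set (letters (word_star w)) = fst ` set (letters w)"
    by (auto simp: word_star_def image_image case_prod_beta)
  then show ?case
    unfolding fstar_single using single by (intro single_in_free_star) (auto simp: word_star_def)
qed (simp_all add: fstar_add add_in_free_star zero_in_free_star)

lemma mult_in_free_star:
  assumes "x \<in> free_star G" "y \<in> free_star G" shows "x * y \<in> free_star G"
  using assms
proof (induction rule: free_star_induct)
  case (single u c)
  from single(3) show ?case
  proof (induction rule: free_star_induct)
    case (single v d)
    then show ?case using \<open>letters u \<noteq> []\<close> \<open>fst ` set (letters u) \<subseteq> G\<close> unfolding mult_single
      by (intro single_in_free_star) (auto simp: plus_word_def)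
  qed (simp_all add: algebra_simps add_in_free_star zero_in_free_star)
qed (simp_all add: algebra_simps add_in_free_star zero_in_free_star)

lemma fscale_in_free_star: "x \<in> free_star G \<Longrightarrow> fscale c x \<in> free_star G"
  by (induction rule: free_star_induct)
    (simp_all add: fscale_single single_in_free_star add_in_free_star zero_in_free_star,
     simp_all add: fscale_def algebra_simps add_in_free_star zero_in_free_star)

text \<open>
  The operators of a word and of an element of the free algebra, when the letter \<open>l\<close> acts as \<open>M l\<close>.
  The empty word acts as the identity, which makes both multiplicative without exception.
\<close>

definition word_op :: "('g \<times> bool \<Rightarrow> 'i oper) \<Rightarrow> ('g \<times> bool) list \<Rightarrow> 'i oper" where
  "word_op M ls = foldr (\<lambda>l T. M l o\<^sub>L T) ls id_blinfun"

definition free_op :: "('g \<times> bool \<Rightarrow> 'i oper) \<Rightarrow> 'g free_alg \<Rightarrow> 'i oper" where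
  "free_op M = lin (\<lambda>w c. cscale_op c (word_op M (letters w)))"

lemma word_op_simps [simp]:
  "word_op M [] = id_blinfun" "word_op M (l # ls) = M l o\<^sub>L word_op M ls"
  by (simp_all add: word_op_def)

lemma compose_id [simp]: "T o\<^sub>L id_blinfun = T" "id_blinfun o\<^sub>L T = T"
  by (auto intro!: blinfun_eqI)

lemmas compose_add = bounded_bilinear.add_left[OF bounded_bilinear_blinfun_compose]
  bounded_bilinear.add_right[OF bounded_bilinear_blinfun_compose]

lemma word_op_append: "word_op M (u @ v) = word_op M u o\<^sub>L word_op M v"
  by (induction u) (auto intro!: blinfun_eqI)

lemma free_op_add: "free_op M (x + y) = free_op M x + free_op M y"
  unfolding free_op_def by (rule lin_add) (simp_all add: cscale_op_simps)

lemma free_op_single: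
  "free_op M (Poly_Mapping.single w c) = cscale_op c (word_op M (letters w))"
  unfolding free_op_def by (rule lin_single) (simp_all add: cscale_op_simps)

lemma free_op_zero [simp]: "free_op M 0 = 0"
  by (simp add: free_op_def)

lemma free_op_diff: "free_op M (x - y) = free_op M x - free_op M y"
  using free_op_add[of M "x - y" y] by (simp add: algebra_simps)

lemma free_op_fscale: "free_op M (fscale c x) = cscale_op c (free_op M x)"
proof (induction x rule: poly_mapping_add_induct)
  case (single w d)
  then show ?case by (simp add: fscale_single free_op_single cscale_op_simps)
qed (simp add: free_op_add cscale_op_simps fscale_def algebra_simps)

lemma free_op_gen: "free_op M (gen g) = M (g, False)"
  by (auto simp: gen_def free_op_single cscale_op_simps intro!: blinfun_eqI)

locale star_rep =
  fixes M :: "'g \<times> bool \<Rightarrow> 'i oper"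
  assumes adj: "is_adj (M (g, b)) (M (g, \<not> b))"
begin

lemma word_op_adj: "is_adj (word_op M ls) (word_op M (rev (map (\<lambda>(g, b). (g, \<not> b)) ls)))"
proof (induction ls)
  case (Cons l ls)
  obtain g b where [simp]: "l = (g, b)" by fastforce
  show ?case
    using is_adj_simps(4)[OF adj Cons.IH] by (simp add: word_op_append)
qed (simp add: is_adj_simps)

lemma free_op_adj: "is_adj (free_op M x) (free_op M (fstar x))"
proof (induction x rule: poly_mapping_add_induct)
  case (single w c)
  show ?case
    using is_adj_cscale[OF word_op_adj, of c "letters w"]
    by (simp add: free_op_single fstar_single word_star_def)
qed (simp add: free_op_add fstar_add is_adj_simps)

lemma clinear_free_op: "clinear_op (free_op M x)"
  using free_op_adj by (simp add: is_adj_def)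

lemma free_op_mult: "free_op M (x * y) = free_op M x o\<^sub>L free_op M y"
proof (induction x rule: poly_mapping_add_induct)
  case (single u c)
  show ?case
  proof (induction y rule: poly_mapping_add_induct)
    case (single v d)
    have "clinear_op (word_op M (letters u))" using word_op_adj by (simp add: is_adj_def)
    then show ?case
      by (simp add: mult_single free_op_single word_op_append plus_word_def cscale_op_simps
          compose_cscale_op mult.commute)
  qed (simp add: free_op_add algebra_simps compose_add)
qed (simp add: free_op_add algebra_simps compose_add)

lemma free_op_seminorm:
  assumes "\<And>r. r \<in> R \<Longrightarrow> free_op M r = 0"
  shows "(\<lambda>x. norm (free_op M x)) \<in> cstar_seminorms G R"
  unfolding cstar_seminorms_def
  using assms is_adj_norm[OF free_op_adj]
  by (auto simp: free_op_add free_op_mult free_op_fscale norm_triangle_ineq norm_blinfun_compose)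

end

section \<open>The completion as a norm closure of operators\<close>

text \<open>
  A representation whose norm on the free algebra is the universal norm.  The completion is then
  isometrically isomorphic to the closure of its range.
\<close>

locale faithful_rep = star_rep M for M :: "'g \<times> bool \<Rightarrow> 'i oper" +
  fixes G :: "'g set" and R :: "'g free_alg set"
  assumes universal_norm_eq: "x \<in> free_star G \<Longrightarrow> universal_norm G R x = norm (free_op M x)"
begin

text \<open>
  The limit operator of a Cauchy sequence in the free algebra, and the operator \<open>compl_op X\<close> of an
  element \<open>X\<close> of the completion, computed from the chosen representative sequence.
\<close>

definition lim_op :: "(nat \<Rightarrow> 'g free_alg) \<Rightarrow> 'i oper" where
  "lim_op x = lim (\<lambda>k. free_op M (x k))"

definition compl_op :: "(nat \<Rightarrow> 'g free_alg) set \<Rightarrow> 'i oper" where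
  "compl_op X = lim_op (rep X)"

lemma cauchy_seqs_iff:
  "x \<in> cauchy_seqs G R \<longleftrightarrow> (\<forall>k. x k \<in> free_star G) \<and> Cauchy (\<lambda>k. free_op M (x k))"
  by (auto simp: cauchy_seqs_def Cauchy_iff universal_norm_eq diff_in_free_star free_op_diff)

lemma lim_opI: "x \<in> cauchy_seqs G R \<Longrightarrow> (\<lambda>k. free_op M (x k)) \<longlonglongrightarrow> lim_op x"
  unfolding lim_op_def by (simp add: cauchy_seqs_iff Cauchy_convergent_iff convergent_LIMSEQ_iff)

lemma seqI:
  assumes "\<And>k. x k \<in> free_star G" "(\<lambda>k. free_op M (x k)) \<longlonglongrightarrow> T"
  shows "x \<in> cauchy_seqs G R" "lim_op x = T"
  using assms unfolding lim_op_def by (auto simp: cauchy_seqs_iff LIMSEQ_imp_Cauchy intro: limI)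

lemma cls_eq:
  assumes x: "x \<in> cauchy_seqs G R"
  shows "cls G R x = {y \<in> cauchy_seqs G R. lim_op y = lim_op x}"
proof -
  have "(\<lambda>k. universal_norm G R (y k - x k)) \<longlonglongrightarrow> 0 \<longleftrightarrow> lim_op y = lim_op x"
    if y: "y \<in> cauchy_seqs G R" for y
  proof -
    have eq: "universal_norm G R (y k - x k) = norm (free_op M (y k) - free_op M (x k))" for k
      using x y by (simp add: cauchy_seqs_iff universal_norm_eq diff_in_free_star free_op_diff)
    have l: "(\<lambda>k. free_op M (y k) - free_op M (x k)) \<longlonglongrightarrow> lim_op y - lim_op x"
      by (intro tendsto_diff lim_opI x y)
    have "(\<lambda>k. free_op M (y k) - free_op M (x k)) \<longlonglongrightarrow> 0 \<longleftrightarrow> lim_op y - lim_op x = 0"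
      using l LIMSEQ_unique[OF l, of 0] by auto
    then show ?thesis
      unfolding eq tendsto_norm_zero_iff by simp
  qed
  then show ?thesis unfolding cls_def by blast
qed

lemma
  assumes x: "x \<in> cauchy_seqs G R"
  shows rep_cls: "rep (cls G R x) \<in> cauchy_seqs G R"
    and compl_op_cls: "compl_op (cls G R x) = lim_op x"
proof -
  have "x \<in> cls G R x" using x by (simp add: cls_eq)
  then have "rep (cls G R x) \<in> cls G R x" unfolding rep_def by (rule someI[of "\<lambda>y. y \<in> cls G R x"])
  then show "rep (cls G R x) \<in> cauchy_seqs G R" "compl_op (cls G R x) = lim_op x"
    by (simp_all add: cls_eq[OF x] compl_op_def)
qed

lemma rep_seq:
  assumes "X \<in> elts (universal_cstar G R)"
  shows "rep X k \<in> free_star G" "(\<lambda>k. free_op M (rep X k)) \<longlonglongrightarrow> compl_op X"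
proof -
  obtain x where x: "x \<in> cauchy_seqs G R" "X = cls G R x"
    using assms unfolding universal_cstar_def by auto
  have "rep X \<in> cauchy_seqs G R" unfolding x(2) by (rule rep_cls[OF x(1)])
  then show "rep X k \<in> free_star G" "(\<lambda>k. free_op M (rep X k)) \<longlonglongrightarrow> compl_op X"
    using lim_opI[of "rep X"] unfolding cauchy_seqs_iff[of "rep X"] compl_op_def by blast+
qed

text \<open>
  The class of a sequence is determined by the limit of its operators: this is how the operations of the completion, defined through representatives, are evaluated.
\<close>

lemma clsI:
  assumes "\<And>k. x k \<in> free_star G" "(\<lambda>k. free_op M (x k)) \<longlonglongrightarrow> T"
  shows "cls G R x \<in> elts (universal_cstar G R)" "compl_op (cls G R x) = T"
  using seqI[of x T, OF assms] compl_op_cls by (auto simp: universal_cstar_def)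

lemma compl_op_inj: "inj_on compl_op (elts (universal_cstar G R))"
proof (rule inj_onI)
  fix X Y assume "X \<in> elts (universal_cstar G R)" "Y \<in> elts (universal_cstar G R)"
    and eq: "compl_op X = compl_op Y"
  then obtain x y where xy: "x \<in> cauchy_seqs G R" "X = cls G R x" "y \<in> cauchy_seqs G R" "Y = cls G R y"
    unfolding universal_cstar_def by auto
  with eq have "lim_op x = lim_op y" by (simp add: compl_op_cls)
  then show "X = Y" using xy by (simp add: cls_eq)
qed

lemma compl_op_image: "compl_op ` elts (universal_cstar G R) = closure (free_op M ` free_star G)"
proof (intro set_eqI iffI)
  fix T assume "T \<in> compl_op ` elts (universal_cstar G R)"
  then obtain X where X: "X \<in> elts (universal_cstar G R)" "T = compl_op X" by blast
  then show "T \<in> closure (free_op M ` free_star G)"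
    unfolding closure_sequential
    using rep_seq[OF X(1)] by (intro exI[of _ "\<lambda>k. free_op M (rep X k)"]) auto
next
  fix T assume "T \<in> closure (free_op M ` free_star G)"
  then obtain s where s: "\<And>k. s k \<in> free_op M ` free_star G" "s \<longlonglongrightarrow> T"
    unfolding closure_sequential by blast
  then have "\<forall>k. \<exists>x. x \<in> free_star G \<and> s k = free_op M x" by blast
  then obtain x where x: "\<And>k. x k \<in> free_star G" "\<And>k. s k = free_op M (x k)" by metis
  then have "s = (\<lambda>k. free_op M (x k))" by auto
  then show "T \<in> compl_op ` elts (universal_cstar G R)"
    using clsI[of x T] x(1) s(2) by force
qed

lemma elts_closed:
  assumes "X \<in> elts (universal_cstar G R)" "Y \<in> elts (universal_cstar G R)"
  shows "add (universal_cstar G R) X Y \<in> elts (universal_cstar G R)"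
    and "mult (universal_cstar G R) X Y \<in> elts (universal_cstar G R)"
  using rep_seq[OF assms(1)] rep_seq[OF assms(2)]
    clsI(1)[of "\<lambda>k. rep X k + rep Y k" "compl_op X + compl_op Y"]
    clsI(1)[of "\<lambda>k. rep X k * rep Y k" "compl_op X o\<^sub>L compl_op Y"]
    bounded_bilinear.tendsto[OF bounded_bilinear_blinfun_compose, OF rep_seq(2) rep_seq(2), OF assms]
  by (simp_all add: universal_cstar_def free_op_add tendsto_add add_in_free_star
      free_op_mult mult_in_free_star)

theorem star_iso_compl_op:
  "star_iso compl_op (universal_cstar G R) (operator_algebra (closure (free_op M ` free_star G)))"
proof -
  let ?A = "universal_cstar G R"
  note r = rep_seq
  have "compl_op (add ?A X Y) = compl_op X + compl_op Y" if "X \<in> elts ?A" "Y \<in> elts ?A" for X Y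
    using that r[of X] r[of Y] clsI(2)[of "\<lambda>k. rep X k + rep Y k" "compl_op X + compl_op Y"]
    by (simp add: universal_cstar_def free_op_add tendsto_add add_in_free_star)
  moreover have "compl_op (mult ?A X Y) = compl_op X o\<^sub>L compl_op Y" if "X \<in> elts ?A" "Y \<in> elts ?A" for X Y
    using that r[of X] r[of Y] clsI(2)[of "\<lambda>k. rep X k * rep Y k" "compl_op X o\<^sub>L compl_op Y"]
      bounded_bilinear.tendsto[OF bounded_bilinear_blinfun_compose, OF r(2) r(2)]
    by (simp add: universal_cstar_def free_op_mult mult_in_free_star)
  moreover have "compl_op (smul ?A c X) = cscale_op c (compl_op X)" if X: "X \<in> elts ?A" for X c
  proof -
    from bounded_linear.tendsto[OF bounded_linear_cscale_op r(2)[OF X]] show ?thesis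
      using r(1)[OF X] clsI(2)[of "\<lambda>k. fscale c (rep X k)" "cscale_op c (compl_op X)"]
      by (simp add: universal_cstar_def free_op_fscale fscale_in_free_star)
  qed
  moreover have "compl_op (star ?A X) = adj_op (compl_op X)" if X: "X \<in> elts ?A" for X
  proof -
    have C: "Cauchy (\<lambda>k. free_op M (fstar (rep X k)))"
      unfolding Cauchy_iff
    proof -
      have "norm (free_op M (fstar x) - free_op M (fstar y)) = norm (free_op M x - free_op M y)" for x y
        using is_adj_norm(1)[OF free_op_adj, of "x - y"] by (simp add: fstar_minus free_op_diff)
      then show "\<forall>e>0. \<exists>N. \<forall>m\<ge>N. \<forall>n\<ge>N.
          norm (free_op M (fstar (rep X m)) - free_op M (fstar (rep X n))) < e"
        using LIMSEQ_imp_Cauchy[OF r(2)[OF X]] by (simp add: Cauchy_iff)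
    qed
    then obtain S where S: "(\<lambda>k. free_op M (fstar (rep X k))) \<longlonglongrightarrow> S"
      by (auto simp: Cauchy_convergent_iff convergent_def)
    then have "adj_op (compl_op X) = S"
      by (intro adj_op_eq is_adj_tendsto[OF free_op_adj r(2)[OF X]])
    then show ?thesis
      using r(1)[OF X] clsI(2)[OF _ S] by (simp add: universal_cstar_def fstar_in_free_star)
  qed
  ultimately show ?thesis
    unfolding star_iso_def bij_betw_def
    by (simp add: operator_algebra_def compl_op_inj compl_op_image)
qed

end

section \<open>The graph as a successor map on the natural numbers\<close>

text \<open>
  The vertices and edges in the numbering by natural numbers: \<open>edge_at n a\<close> is the only edge that
  leaves \<open>vertex_at n a\<close>, and it leads to the vertex with number \<open>next_index n a\<close>.  The loop consists of
  the numbers \<open>0, \<dots>, n - 1\<close>, traversed downwards and closed up by the edge from \<open>0\<close> to \<open>n - 1\<close>.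
\<close>

definition vertex_at :: "nat \<Rightarrow> nat \<Rightarrow> vertex" where
  "vertex_at n a = (if a < n then V (n - a) else W (Suc a - n))"

definition edge_at :: "nat \<Rightarrow> nat \<Rightarrow> edge" where
  "edge_at n a = (if a < n then LoopEdge (n - a) else if a = n then Entry else PathEdge (a - n))"

definition next_index :: "nat \<Rightarrow> nat \<Rightarrow> nat" where
  "next_index n a = (if a = 0 then n - 1 else a - 1)"

lemma inj_vertex_at: "inj (vertex_at n)"
  by (auto simp: inj_def vertex_at_def split: if_splits)

lemma inj_edge_at: "inj (edge_at n)"
  by (auto simp: inj_def edge_at_def split: if_splits)

lemma verts_loop_graph: "verts (loop_graph n) = range (vertex_at n)"
proof (intro set_eqI iffI)
  fix v assume "v \<in> verts (loop_graph n)"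
  then consider i where "v = V i" "1 \<le> i" "i \<le> n" | j where "v = W j" "1 \<le> j"
    by (auto simp: loop_graph_def)
  then show "v \<in> range (vertex_at n)"
  proof cases
    case 1
    then have "v = vertex_at n (n - i)" by (auto simp: vertex_at_def)
    then show ?thesis by blast
  next
    case 2
    then have "v = vertex_at n (n + j - 1)" by (auto simp: vertex_at_def)
    then show ?thesis by blast
  qed
qed (auto simp: loop_graph_def vertex_at_def)

lemma arcs_loop_graph: "arcs (loop_graph n) = range (edge_at n)"
proof (intro set_eqI iffI)
  fix e assume "e \<in> arcs (loop_graph n)"
  then consider i where "e = LoopEdge i" "1 \<le> i" "i \<le> n" | "e = Entry" | j where "e = PathEdge j" "1 \<le> j"
    by (auto simp: loop_graph_def)
  then show "e \<in> range (edge_at n)"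
  proof cases
    case 1
    then have "e = edge_at n (n - i)" by (auto simp: edge_at_def)
    then show ?thesis by blast
  next
    case 2
    then have "e = edge_at n n" by (auto simp: edge_at_def)
    then show ?thesis by blast
  next
    case 3
    then have "e = edge_at n (n + j)" by (auto simp: edge_at_def)
    then show ?thesis by blast
  qed
qed (auto simp: loop_graph_def edge_at_def)

lemma tail_edge_at: "tail (loop_graph n) (edge_at n a) = vertex_at n a"
  by (auto simp: loop_graph_def edge_at_def vertex_at_def Suc_diff_le)

lemma head_edge_at: "n \<ge> 1 \<Longrightarrow> head (loop_graph n) (edge_at n a) = vertex_at n (next_index n a)"
  by (auto simp: loop_graph_def edge_at_def vertex_at_def next_index_def)

lemma out_arcs_vertex_at: "out_arcs (loop_graph n) (vertex_at n a) = {edge_at n a}"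
  using inj_vertex_at[of n] by (auto simp: out_arcs_def arcs_loop_graph tail_edge_at inj_eq)

text \<open>
  The arrow \<open>(a, k, b)\<close> stands for words \<open>w\<close> that compare the vertices \<open>a\<close> and \<open>b\<close>, that is
  \<open>w w\<^sup>* = p\<^sub>a\<close> and \<open>w\<^sup>* w = p\<^sub>b\<close>, with winding number \<open>k\<close>.  The edge leaving \<open>0\<close> has winding number \<open>1\<close>
  and all other edges have winding number \<open>0\<close>.
\<close>

type_synonym arrow = "nat \<times> int \<times> nat"

text \<open>
  The arrow of a letter.  Outside the graph the inverse functions take arbitrary values, which are
  irrelevant.
\<close>

fun letter_arrow :: "nat \<Rightarrow> (vertex + edge) \<times> bool \<Rightarrow> arrow" where
  "letter_arrow n (Inl v, s) = (let a = inv (vertex_at n) v in (a, 0, a))"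
| "letter_arrow n (Inr e, s) = (let a = inv (edge_at n) e; k = of_bool (a = 0) in
      if s then (next_index n a, - k, a) else (a, k, next_index n a))"

lemma letter_arrow_simps [simp]:
  "letter_arrow n (Inl (vertex_at n a), s) = (a, 0, a)"
  "letter_arrow n (Inr (edge_at n a), False) = (a, of_bool (a = 0), next_index n a)"
  "letter_arrow n (Inr (edge_at n a), True) = (next_index n a, - of_bool (a = 0), a)"
  by (simp_all add: inv_f_f inj_vertex_at inj_edge_at)

lemma graph_gens_loop_graph: "graph_gens (loop_graph n) = Inl ` range (vertex_at n) \<union> Inr ` range (edge_at n)"
  by (simp add: graph_gens_def verts_loop_graph arcs_loop_graph)

lemma letter_cases:
  assumes "g \<in> graph_gens (loop_graph n)"
  obtains a where "(g, s) = (Inl (vertex_at n a), s)" | a where "(g, s) = (Inr (edge_at n a), s)"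
  using assms by (auto simp: graph_gens_loop_graph)

section \<open>The representation on \<open>\<ell>\<^sup>2(S\<^sup>1 \<times> \<nat>)\<close>\<close>

text \<open>
  The operator \<open>z\<^sup>k \<otimes> e\<^sub>a\<^sub>b\<close> of the arrow \<open>(a, k, b)\<close>.
\<close>

definition arrow_op :: "arrow \<Rightarrow> (circle \<times> nat) oper" where
  "arrow_op = (\<lambda>(a, k, b). weighted_op (\<lambda>(t, i). if i = a then point t powi k else 0) (\<lambda>(t, i). (t, b)))"

lemma norm_point [simp]: "cmod (point t) = 1"
  using point[of t] by simp

lemma point_nonzero [simp]: "point t \<noteq> 0"
  using norm_point[of t] by force

lemma cnj_point_powi: "cnj (point t powi k) = point t powi (- k)"
proof -
  have "cnj (point t) = inverse (point t)"
    using complex_norm_square[of "point t"] by (simp add: field_simps)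
  then show ?thesis by (simp add: power_int_def power_inverse)
qed

lemma arrow_op_aux:
  "inj_on (\<lambda>(t, i). (t, b)) {p :: circle \<times> nat. (case p of (t, i) \<Rightarrow> if i = a then point t powi k else 0) \<noteq> 0}"
  "cmod (case p of (t, i) \<Rightarrow> if i = a then point t powi k else 0) \<le> 1"
  by (auto simp: inj_on_def norm_power_int split: prod.splits if_splits)

lemma coord_arrow_op [simp]:
  "coord (blinfun_apply (arrow_op (a, k, b)) x) (t, i) = (if i = a then point t powi k * coord x (t, b) else 0)"
  unfolding arrow_op_def by (simp add: coord_weighted_op[OF arrow_op_aux])

lemma arrow_op_adj: "is_adj (arrow_op (a, k, b)) (arrow_op (b, - k, a))"
  unfolding arrow_op_def split
  by (rule weighted_op_adj[where B = 1]) (auto simp: arrow_op_aux cnj_point_powi simp del: complex_cnj_power_int split: if_splits)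

lemma arrow_op_compose: "arrow_op (a, k, b) o\<^sub>L arrow_op (c, l, d) = (if b = c then arrow_op (a, k + l, d) else 0)"
  by (auto intro!: blinfun_eqI ell2_eqI simp: power_int_add)

definition M_letter :: "nat \<Rightarrow> (vertex + edge) \<times> bool \<Rightarrow> (circle \<times> nat) oper" where
  "M_letter n l = arrow_op (letter_arrow n l)"

lemma M_letter_adj: "is_adj (M_letter n (g, b)) (M_letter n (g, \<not> b))"
proof (cases g)
  case (Inl v)
  then show ?thesis
    using arrow_op_adj[of "inv (vertex_at n) v" 0 "inv (vertex_at n) v"] by (simp add: M_letter_def Let_def)
next
  case (Inr e)
  let ?a = "inv (edge_at n) e" and ?k = "of_bool (inv (edge_at n) e = 0) :: int"
  show ?thesis
    using arrow_op_adj[of ?a ?k "next_index n ?a"] arrow_op_adj[of "next_index n ?a" "- ?k" ?a]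
    by (cases b) (simp_all add: Inr M_letter_def Let_def)
qed

interpretation graph_rep: star_rep "M_letter n" for n
  by unfold_locales (rule M_letter_adj)

abbreviation graph_op :: "nat \<Rightarrow> (vertex + edge) free_alg \<Rightarrow> (circle \<times> nat) oper" where
  "graph_op n \<equiv> free_op (M_letter n)"

lemma free_op_fstar_gen: "free_op M (fstar (gen g)) = M (g, True)"
  by (simp add: fstar_gen free_op_single cscale_op_simps)

lemma graph_op_gens:
  "graph_op n (proj (vertex_at n a)) = arrow_op (a, 0, a)"
  "graph_op n (fstar (proj (vertex_at n a))) = arrow_op (a, 0, a)"
  "graph_op n (piso (edge_at n a)) = arrow_op (a, of_bool (a = 0), next_index n a)"
  "graph_op n (fstar (piso (edge_at n a))) = arrow_op (next_index n a, - of_bool (a = 0), a)"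
  by (simp_all add: proj_def piso_def free_op_gen free_op_fstar_gen M_letter_def del: letter_arrow.simps)

lemma graph_op_rels:
  assumes n: "n \<ge> 1" and r: "r \<in> graph_rels (loop_graph n)"
  shows "graph_op n r = 0"
  using r inj_vertex_at[of n] unfolding graph_rels_def verts_loop_graph arcs_loop_graph
  by (auto simp: free_op_diff graph_rep.free_op_mult graph_op_gens arrow_op_compose head_edge_at[OF n] out_arcs_vertex_at
      inj_eq)

lemma graph_op_seminorm:
  "n \<ge> 1 \<Longrightarrow> (\<lambda>x. norm (graph_op n x)) \<in> cstar_seminorms G (graph_rels (loop_graph n))"
  by (rule graph_rep.free_op_seminorm) (rule graph_op_rels)

section \<open>Normal forms of words modulo a C*-seminorm\<close>

lemma cstar_seminormsD:
  assumes \<rho>: "\<rho> \<in> cstar_seminorms G R"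
  shows "x \<in> free_star G \<Longrightarrow> 0 \<le> \<rho> x"
    and "x \<in> free_star G \<Longrightarrow> y \<in> free_star G \<Longrightarrow> \<rho> (x + y) \<le> \<rho> x + \<rho> y"
    and "x \<in> free_star G \<Longrightarrow> \<rho> (fscale c x) = cmod c * \<rho> x"
    and "x \<in> free_star G \<Longrightarrow> y \<in> free_star G \<Longrightarrow> \<rho> (x * y) \<le> \<rho> x * \<rho> y"
    and "x \<in> free_star G \<Longrightarrow> \<rho> (fstar x * x) = (\<rho> x)\<^sup>2"
    and "r \<in> R \<Longrightarrow> \<rho> r = 0"
  using \<rho> by (simp_all add: cstar_seminorms_def)

text \<open>
  An arbitrary C*-seminorm \<open>\<rho>\<close> on the free algebra that vanishes on the relations of the graph.  The
  relation \<open>x \<simeq> y\<close> below is equality in the quotient by its null space.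
\<close>

locale graph_seminorm =
  fixes n :: nat and \<rho> :: "(vertex + edge) free_alg \<Rightarrow> real"
  assumes n: "n \<ge> 1"
    and \<rho>: "\<rho> \<in> cstar_seminorms (graph_gens (loop_graph n)) (graph_rels (loop_graph n))"
begin

abbreviation FS where "FS \<equiv> free_star (graph_gens (loop_graph n))"

abbreviation p where "p a \<equiv> proj (vertex_at n a) :: (vertex + edge) free_alg"
abbreviation s where "s a \<equiv> piso (edge_at n a) :: (vertex + edge) free_alg"

lemmas \<rho>_ge0 = cstar_seminormsD(1)[OF \<rho>]
  and \<rho>_add = cstar_seminormsD(2)[OF \<rho>]
  and \<rho>_scale = cstar_seminormsD(3)[OF \<rho>]
  and \<rho>_mult = cstar_seminormsD(4)[OF \<rho>]
  and \<rho>_cstar = cstar_seminormsD(5)[OF \<rho>]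
  and \<rho>_rel = cstar_seminormsD(6)[OF \<rho>]

lemma \<rho>_zero: "\<rho> 0 = 0"
  using \<rho>_scale[OF zero_in_free_star, of 0] by (simp add: fscale_def)

lemma \<rho>_minus: "x \<in> FS \<Longrightarrow> \<rho> (- x) = \<rho> x"
proof -
  have "fscale (- 1) x = - x"
    unfolding fscale_def single_uminus by simp
  then show "x \<in> FS \<Longrightarrow> \<rho> (- x) = \<rho> x" using \<rho>_scale[of x "- 1"] by simp
qed

lemma \<rho>_fstar_le: assumes x: "x \<in> FS" shows "\<rho> x \<le> \<rho> (fstar x)"
proof (cases "\<rho> x = 0")
  case False
  have "\<rho> x * \<rho> x \<le> \<rho> (fstar x) * \<rho> x"
    using \<rho>_cstar[OF x] \<rho>_mult[OF fstar_in_free_star[OF x] x] by (simp add: power2_eq_square)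
  then show ?thesis using False \<rho>_ge0[OF x] by simp
qed (simp add: \<rho>_ge0 fstar_in_free_star x)

lemma \<rho>_fstar: "x \<in> FS \<Longrightarrow> \<rho> (fstar x) = \<rho> x"
  using \<rho>_fstar_le[of x] \<rho>_fstar_le[of "fstar x"] by (simp add: fstar_in_free_star)

definition eqv (infix "\<simeq>" 50) where
  "x \<simeq> y \<longleftrightarrow> x \<in> FS \<and> y \<in> FS \<and> \<rho> (x - y) = 0"

lemma eqv_refl: "x \<in> FS \<Longrightarrow> x \<simeq> x"
  by (simp add: eqv_def \<rho>_zero)

lemma eqv_sym: "x \<simeq> y \<Longrightarrow> y \<simeq> x"
  using \<rho>_minus[of "x - y"] by (auto simp: eqv_def diff_in_free_star)

lemma eqv_add: "x \<simeq> x' \<Longrightarrow> y \<simeq> y' \<Longrightarrow> x + y \<simeq> x' + y'"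
  unfolding eqv_def
  using \<rho>_add[of "x - x'" "y - y'"] \<rho>_ge0[of "x - x' + (y - y')"]
  by (simp add: diff_in_free_star add_in_free_star algebra_simps)

lemma eqv_trans [trans]: assumes "x \<simeq> y" "y \<simeq> z" shows "x \<simeq> z"
  using assms \<rho>_add[of "x - y" "y - z"] \<rho>_ge0[of "x - z"]
  by (simp add: eqv_def diff_in_free_star)

lemma eqv_multL: assumes "x \<simeq> x'" "y \<in> FS" shows "x * y \<simeq> x' * y"
  using assms \<rho>_mult[of "x - x'" y] \<rho>_ge0[of "x * y - x' * y"]
  by (simp add: eqv_def diff_in_free_star mult_in_free_star algebra_simps)

lemma eqv_multR: assumes "y \<simeq> y'" "x \<in> FS" shows "x * y \<simeq> x * y'"
  using assms \<rho>_mult[of x "y - y'"] \<rho>_ge0[of "x * y - x * y'"]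
  by (simp add: eqv_def diff_in_free_star mult_in_free_star algebra_simps)

lemma eqv_fstar: "x \<simeq> y \<Longrightarrow> fstar x \<simeq> fstar y"
  using \<rho>_fstar[of "x - y"] by (simp add: eqv_def diff_in_free_star fstar_in_free_star fstar_minus)

lemma eqv_fscale: assumes "x \<simeq> y" shows "fscale c x \<simeq> fscale c y"
proof -
  have "fscale c x - fscale c y = fscale c (x - y)" by (simp add: fscale_def algebra_simps)
  then show ?thesis using assms \<rho>_scale[of "x - y" c]
    by (simp add: eqv_def fscale_in_free_star diff_in_free_star)
qed

lemma eqv_sum: "(\<And>i. i \<in> A \<Longrightarrow> f i \<simeq> g i) \<Longrightarrow> sum f A \<simeq> sum g A"
  by (induction A rule: infinite_finite_induct) (auto intro: eqv_add eqv_refl zero_in_free_star)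

lemma \<rho>_eqv: "x \<simeq> y \<Longrightarrow> \<rho> x = \<rho> y"
  using \<rho>_add[of "x - y" y] \<rho>_add[of "y - x" x] eqv_sym[of x y]
  by (fastforce simp: eqv_def diff_in_free_star)

lemma p_in: "p a \<in> FS" and s_in: "s a \<in> FS"
  by (auto simp: proj_def piso_def gen_def graph_gens_loop_graph intro!: single_in_free_star)

lemmas FS_intros = p_in s_in fstar_in_free_star mult_in_free_star zero_in_free_star

lemma eqv_relI: "x - y \<in> graph_rels (loop_graph n) \<Longrightarrow> x \<in> FS \<Longrightarrow> y \<in> FS \<Longrightarrow> x \<simeq> y"
  by (simp add: eqv_def \<rho>_rel)

lemma p_star: "fstar (p a) \<simeq> p a"
proof (rule eqv_relI)
  show "fstar (p a) - p a \<in> graph_rels (loop_graph n)"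
    unfolding graph_rels_def
    by (rule UnI1, rule UnI1, rule UnI1, rule UnI1, rule UnI1, rule CollectI, rule exI[of _ "vertex_at n a"])
      (simp add: verts_loop_graph)
qed (intro FS_intros)+

lemma p_idem: "p a * p a \<simeq> p a"
proof (rule eqv_relI)
  show "p a * p a - p a \<in> graph_rels (loop_graph n)"
    unfolding graph_rels_def
    by (rule UnI1, rule UnI1, rule UnI1, rule UnI1, rule UnI2, rule CollectI, rule exI[of _ "vertex_at n a"])
      (simp add: verts_loop_graph)
qed (intro FS_intros)+

lemma p_orth: assumes "a \<noteq> b" shows "p a * p b \<simeq> 0"
proof (rule eqv_relI)
  have ne: "vertex_at n a \<noteq> vertex_at n b" using inj_vertex_at[of n] assms by (simp add: inj_eq)
  have "p a * p b \<in> graph_rels (loop_graph n)"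
    unfolding graph_rels_def
    by (rule UnI1, rule UnI1, rule UnI1, rule UnI2, rule CollectI, rule exI[of _ "vertex_at n a"],
        rule exI[of _ "vertex_at n b"])
      (simp add: verts_loop_graph ne)
  then show "p a * p b - 0 \<in> graph_rels (loop_graph n)" by simp
qed (intro FS_intros)+

lemma s_iso: "s a * fstar (s a) * s a \<simeq> s a"
proof (rule eqv_relI)
  show "s a * fstar (s a) * s a - s a \<in> graph_rels (loop_graph n)"
    unfolding graph_rels_def
    by (rule UnI1, rule UnI1, rule UnI2, rule CollectI, rule exI[of _ "edge_at n a"])
      (simp add: arcs_loop_graph)
qed (intro FS_intros)+

lemma s_star_s: "fstar (s a) * s a \<simeq> p (next_index n a)"
proof (rule eqv_relI)
  show "fstar (s a) * s a - p (next_index n a) \<in> graph_rels (loop_graph n)"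
    unfolding graph_rels_def
    by (rule UnI1, rule UnI2, rule CollectI, rule exI[of _ "edge_at n a"])
      (simp add: arcs_loop_graph head_edge_at[OF n])
qed (intro FS_intros)+

lemma s_s_star: "s a * fstar (s a) \<simeq> p a"
proof (rule eqv_sym, rule eqv_relI)
  show "p a - s a * fstar (s a) \<in> graph_rels (loop_graph n)"
    unfolding graph_rels_def
    by (rule UnI2, rule CollectI, rule exI[of _ "vertex_at n a"]) (simp add: verts_loop_graph out_arcs_vertex_at)
qed (intro FS_intros)+

lemma s_p: "s a * p (next_index n a) \<simeq> s a"
proof -
  have "s a * p (next_index n a) \<simeq> s a * (fstar (s a) * s a)"
    by (intro eqv_multR eqv_sym[OF s_star_s] FS_intros)
  also have "\<dots> \<simeq> s a" using s_iso by (simp add: mult.assoc)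
  finally show ?thesis .
qed

lemma p_s: "p a * s a \<simeq> s a"
proof -
  have "p a * s a \<simeq> s a * fstar (s a) * s a"
    by (intro eqv_multL eqv_sym[OF s_s_star] FS_intros)
  also note s_iso
  finally show ?thesis .
qed

lemma s_star_p: "fstar (s a) * p a \<simeq> fstar (s a)"
proof -
  have "fstar (s a) * p a \<simeq> fstar (s a) * fstar (p a)"
    by (intro eqv_multR eqv_sym[OF p_star] FS_intros)
  also have "\<dots> \<simeq> fstar (s a)" using eqv_fstar[OF p_s[of a]] by (simp add: fstar_mult)
  finally show ?thesis .
qed

lemma p_s_star: "p (next_index n a) * fstar (s a) \<simeq> fstar (s a)"
proof -
  have "p (next_index n a) * fstar (s a) \<simeq> fstar (p (next_index n a)) * fstar (s a)"
    by (intro eqv_multL eqv_sym[OF p_star] FS_intros)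
  also have "\<dots> \<simeq> fstar (s a)" using eqv_fstar[OF s_p[of a]] by (simp add: fstar_mult)
  finally show ?thesis .
qed

text \<open>
  The path from the vertex \<open>a\<close> down to the vertex \<open>0\<close>; it is the projection \<open>p 0\<close> for \<open>a = 0\<close>.
\<close>

fun descent where
  "descent 0 = p 0"
| "descent (Suc a) = s (Suc a) * descent a"

text \<open>
  The unitary of the corner at the vertex \<open>0\<close> that runs once around the loop, and its powers with
  integer exponents.
\<close>

definition loop where "loop = s 0 * descent (n - 1)"

fun loop_pow where
  "loop_pow 0 = p 0"
| "loop_pow (Suc k) = loop * loop_pow k"

fun loop_star_pow where
  "loop_star_pow 0 = p 0"
| "loop_star_pow (Suc k) = fstar loop * loop_star_pow k"

definition loop_power :: "int \<Rightarrow> (vertex + edge) free_alg" where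
  "loop_power k = (if k \<ge> 0 then loop_pow (nat k) else loop_star_pow (nat (- k)))"

text \<open>
  The standard word with a given arrow \<open>(a, k, b)\<close>: down from \<open>a\<close> to \<open>0\<close>, \<open>k\<close> times around the loop, and
  back up to \<open>b\<close>.
\<close>

definition normal_form :: "arrow \<Rightarrow> (vertex + edge) free_alg" where
  "normal_form = (\<lambda>(a, k, b). descent a * loop_power k * fstar (descent b))"

lemma descent_in: "descent a \<in> FS" by (induction a) (auto intro: FS_intros)
lemma loop_in: "loop \<in> FS" unfolding loop_def by (intro FS_intros descent_in)
lemma loop_pow_in: "loop_pow k \<in> FS" by (induction k) (auto intro: FS_intros loop_in)
lemma loop_star_pow_in: "loop_star_pow k \<in> FS" by (induction k) (auto intro: FS_intros loop_in)
lemma loop_power_in: "loop_power k \<in> FS" unfolding loop_power_def by (simp add: loop_pow_in loop_star_pow_in)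
lemma normal_form_in: "normal_form g \<in> FS"
  unfolding normal_form_def by (auto split: prod.splits intro!: FS_intros descent_in loop_power_in)

lemmas FSI = FS_intros descent_in loop_in loop_pow_in loop_star_pow_in loop_power_in normal_form_in

lemma p_descent: "p a * descent a \<simeq> descent a"
proof (cases a)
  case 0
  then show ?thesis using p_idem by simp
next
  case (Suc b)
  then show ?thesis
    using eqv_multL[OF p_s[of a] descent_in[of b]] by (simp add: mult.assoc)
qed

lemma descent_p: "descent a * p 0 \<simeq> descent a"
proof (induction a)
  case (Suc a)
  show ?case using eqv_multR[OF Suc s_in] by (simp add: mult.assoc)
qed (simp add: p_idem)

lemma descent_star_descent: "fstar (descent a) * descent a \<simeq> p 0"
proof (induction a)
  case 0
  have "fstar (p 0) * p 0 \<simeq> p 0 * p 0" by (intro eqv_multL p_star FSI)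
  also note p_idem
  finally show ?case by simp
next
  case (Suc a)
  have "fstar (descent (Suc a)) * descent (Suc a) = fstar (descent a) * ((fstar (s (Suc a)) * s (Suc a)) * descent a)"
    by (simp add: fstar_mult mult.assoc)
  also have "\<dots> \<simeq> fstar (descent a) * (p a * descent a)"
    using s_star_s[of "Suc a"] by (intro eqv_multR eqv_multL FSI) (simp add: next_index_def)
  also have "\<dots> \<simeq> fstar (descent a) * descent a"
    by (intro eqv_multR p_descent FSI)
  also note Suc
  finally show ?case .
qed

lemma descent_descent_star: "descent a * fstar (descent a) \<simeq> p a"
proof (induction a)
  case 0
  have "p 0 * fstar (p 0) \<simeq> p 0 * p 0" by (intro eqv_multR p_star FSI)
  also note p_idem
  finally show ?case by simp
next
  case (Suc a)
  have "descent (Suc a) * fstar (descent (Suc a)) = s (Suc a) * (descent a * fstar (descent a)) * fstar (s (Suc a))"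
    by (simp add: fstar_mult mult.assoc)
  also have "\<dots> \<simeq> s (Suc a) * p a * fstar (s (Suc a))"
    by (intro eqv_multR eqv_multL Suc FSI)
  also have "\<dots> \<simeq> s (Suc a) * fstar (s (Suc a))"
    using s_p[of "Suc a"] by (intro eqv_multL FSI) (simp add: next_index_def)
  also note s_s_star
  finally show ?case .
qed

lemma p_loop: "p 0 * loop \<simeq> loop"
  using eqv_multL[OF p_s[of 0] descent_in[of "n - 1"]] by (simp add: loop_def mult.assoc)

text \<open>
  The loop is unitary in the corner at the vertex \<open>0\<close>.
\<close>

lemma loop_star_loop: "fstar loop * loop \<simeq> p 0"
proof -
  have "fstar loop * loop = fstar (descent (n - 1)) * ((fstar (s 0) * s 0) * descent (n - 1))"
    by (simp add: loop_def fstar_mult mult.assoc)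
  also have "\<dots> \<simeq> fstar (descent (n - 1)) * (p (n - 1) * descent (n - 1))"
    using s_star_s[of 0] by (intro eqv_multR eqv_multL FSI) (simp add: next_index_def)
  also have "\<dots> \<simeq> fstar (descent (n - 1)) * descent (n - 1)"
    by (intro eqv_multR p_descent FSI)
  also note descent_star_descent
  finally show ?thesis .
qed

lemma loop_loop_star: "loop * fstar loop \<simeq> p 0"
proof -
  have "loop * fstar loop = s 0 * (descent (n - 1) * fstar (descent (n - 1))) * fstar (s 0)"
    by (simp add: loop_def fstar_mult mult.assoc)
  also have "\<dots> \<simeq> s 0 * p (n - 1) * fstar (s 0)"
    by (intro eqv_multR eqv_multL descent_descent_star FSI)
  also have "\<dots> \<simeq> s 0 * fstar (s 0)"
    using s_p[of 0] by (intro eqv_multL FSI) (simp add: next_index_def)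
  also note s_s_star
  finally show ?thesis .
qed

lemma p_loop_star: "p 0 * fstar loop \<simeq> fstar loop"
proof -
  have "p 0 * fstar loop \<simeq> fstar (descent (n - 1)) * descent (n - 1) * fstar loop"
    by (intro eqv_multL eqv_sym[OF descent_star_descent] FSI)
  also have "\<dots> = fstar (descent (n - 1)) * (descent (n - 1) * fstar (descent (n - 1)) * fstar (s 0))"
    by (simp add: loop_def fstar_mult mult.assoc)
  also have "\<dots> \<simeq> fstar (descent (n - 1)) * (p (n - 1) * fstar (s 0))"
    by (intro eqv_multR eqv_multL descent_descent_star FSI)
  also have "\<dots> \<simeq> fstar (descent (n - 1)) * fstar (s 0)"
    using p_s_star[of 0] by (intro eqv_multR FSI) (simp add: next_index_def)
  also have "\<dots> = fstar loop" by (simp add: loop_def fstar_mult)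
  finally show ?thesis .
qed

lemma p_loop_power: "p 0 * loop_power k \<simeq> loop_power k"
proof -
  have "p 0 * loop_pow j \<simeq> loop_pow j" for j
    using p_idem eqv_multL[OF p_loop loop_pow_in] by (cases j) (simp_all add: mult.assoc)
  moreover have "p 0 * loop_star_pow j \<simeq> loop_star_pow j" for j
    using p_idem eqv_multL[OF p_loop_star loop_star_pow_in] by (cases j) (simp_all add: mult.assoc)
  ultimately show ?thesis by (simp add: loop_power_def)
qed

lemma loop_loop_power: "loop * loop_power k \<simeq> loop_power (k + 1)"
proof (cases "k \<ge> 0")
  case True
  then have "loop * loop_power k = loop_power (k + 1)" by (simp add: loop_power_def nat_add_distrib)
  then show ?thesis by (simp add: eqv_refl loop_power_in)
next
  case False
  define j where "j = nat (- k - 1)"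
  have k: "loop_power k = fstar loop * loop_star_pow j" "loop_power (k + 1) = loop_star_pow j"
  proof -
    have "nat (- k) = Suc j" using False by (simp add: j_def)
    then show "loop_power k = fstar loop * loop_star_pow j" using False by (simp add: loop_power_def)
    have "nat (- (k + 1)) = j" by (simp add: j_def)
    moreover have "loop_pow 0 = loop_star_pow 0" by simp
    ultimately show "loop_power (k + 1) = loop_star_pow j" using False by (auto simp: loop_power_def j_def)
  qed
  have "loop * loop_power k = loop * fstar loop * loop_star_pow j" by (simp add: k mult.assoc)
  also have "\<dots> \<simeq> p 0 * loop_star_pow j" by (intro eqv_multL loop_loop_star FSI)
  also have "\<dots> \<simeq> loop_star_pow j" using p_loop_power[of "k + 1"] by (simp add: k)
  finally show ?thesis by (simp add: k)
qed

lemma loop_star_loop_power: "fstar loop * loop_power k \<simeq> loop_power (k - 1)"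
proof -
  have "fstar loop * loop_power k \<simeq> fstar loop * (loop * loop_power (k - 1))"
    using eqv_sym[OF loop_loop_power[of "k - 1"]] by (intro eqv_multR FSI) simp
  also have "\<dots> = fstar loop * loop * loop_power (k - 1)" by (simp add: mult.assoc)
  also have "\<dots> \<simeq> p 0 * loop_power (k - 1)" by (intro eqv_multL loop_star_loop FSI)
  also note p_loop_power
  finally show ?thesis .
qed

lemma s_star_loop_power: "fstar (s 0) * loop_power k \<simeq> descent (n - 1) * loop_power (k - 1)"
proof -
  have "fstar (s 0) * loop_power k \<simeq> p (n - 1) * fstar (s 0) * loop_power k"
    using eqv_sym[OF p_s_star[of 0]] by (intro eqv_multL FSI) (simp add: next_index_def)
  also have "\<dots> \<simeq> descent (n - 1) * fstar (descent (n - 1)) * fstar (s 0) * loop_power k"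
    by (intro eqv_multL eqv_sym[OF descent_descent_star] FSI)
  also have "\<dots> = descent (n - 1) * (fstar loop * loop_power k)"
    by (simp add: loop_def fstar_mult mult.assoc)
  also have "\<dots> \<simeq> descent (n - 1) * loop_power (k - 1)"
    by (intro eqv_multR loop_star_loop_power FSI)
  finally show ?thesis .
qed

abbreviation word_elt where "word_elt ls \<equiv> Poly_Mapping.single (Word ls) (1::complex) :: (vertex + edge) free_alg"

lemma word_elt_letters:
  "word_elt [(Inl (vertex_at n a), False)] = p a" "word_elt [(Inl (vertex_at n a), True)] = fstar (p a)"
  "word_elt [(Inr (edge_at n a), False)] = s a" "word_elt [(Inr (edge_at n a), True)] = fstar (s a)"
  by (simp_all add: proj_def piso_def fstar_gen) (simp_all add: gen_def)

lemma word_elt_append: "word_elt (u @ v) = word_elt u * word_elt v"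
  by (simp add: mult_single plus_word_def)

lemma word_elt_in: "ls \<noteq> [] \<Longrightarrow> fst ` set ls \<subseteq> graph_gens (loop_graph n) \<Longrightarrow> word_elt ls \<in> FS"
  by (rule single_in_free_star) auto

text \<open>
  A letter with arrow \<open>(a, k, b)\<close> turns the first half of a normal form starting at \<open>b\<close> into one
  starting at \<open>a\<close>, with the winding numbers added.
\<close>

lemma letter_facts:
  assumes "fst l \<in> graph_gens (loop_graph n)" "letter_arrow n l = (a, k, b)"
  shows "word_elt [l] * p b \<simeq> word_elt [l]" "word_elt [l] * (descent b * loop_power j) \<simeq> descent a * loop_power (k + j)"
proof -
  obtain g sg where l: "l = (g, sg)" by fastforce
  with assms(1) have "g \<in> graph_gens (loop_graph n)" by simp
  then consider c where "l = (Inl (vertex_at n c), False)" | c where "l = (Inl (vertex_at n c), True)"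
    | c where "l = (Inr (edge_at n c), False)" | c where "l = (Inr (edge_at n c), True)"
    unfolding l by (elim letter_cases[where s = sg]; cases sg; blast)
  then have "word_elt [l] * p b \<simeq> word_elt [l] \<and> word_elt [l] * (descent b * loop_power j) \<simeq> descent a * loop_power (k + j)"
  proof cases
    case 1
    then have [simp]: "a = c" "b = c" "k = 0" using assms(2) by (auto simp del: letter_arrow.simps)
    show ?thesis unfolding 1 word_elt_letters
      using p_idem eqv_multL[OF p_descent loop_power_in] by (simp add: mult.assoc)
  next
    case 2
    then have [simp]: "a = c" "b = c" "k = 0" using assms(2) by (auto simp del: letter_arrow.simps)
    have "fstar (p c) * p c \<simeq> p c * p c" by (intro eqv_multL p_star FSI)
    also note p_idem
    also note eqv_sym[OF p_star]
    finally have 3: "fstar (p c) * p c \<simeq> fstar (p c)" .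
    have "fstar (p c) * (descent c * loop_power j) \<simeq> p c * (descent c * loop_power j)" by (intro eqv_multL p_star FSI)
    also have "\<dots> = p c * descent c * loop_power j" by (simp add: mult.assoc)
    also have "\<dots> \<simeq> descent c * loop_power j" by (intro eqv_multL p_descent FSI)
    finally show ?thesis unfolding 2 word_elt_letters using 3 by simp
  next
    case 3
    then have [simp]: "a = c" "b = next_index n c" "k = of_bool (c = 0)" using assms(2) by (auto simp del: letter_arrow.simps)
    have "s c * (descent (next_index n c) * loop_power j) \<simeq> descent c * loop_power (of_bool (c = 0) + j)"
    proof (cases c)
      case 0
      have "s 0 * (descent (n - 1) * loop_power j) = loop * loop_power j" by (simp add: loop_def mult.assoc)
      also have "\<dots> \<simeq> loop_power (j + 1)" by (rule loop_loop_power)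
      also have "\<dots> \<simeq> p 0 * loop_power (j + 1)" by (rule eqv_sym[OF p_loop_power])
      finally show ?thesis using 0 by (simp add: next_index_def add.commute)
    next
      case (Suc d)
      then show ?thesis
        by (simp add: next_index_def mult.assoc eqv_refl FSI)
    qed
    then show ?thesis unfolding 3 word_elt_letters using s_p by simp
  next
    case 4
    then have [simp]: "a = next_index n c" "b = c" "k = - of_bool (c = 0)" using assms(2) by (auto simp del: letter_arrow.simps)
    have "fstar (s c) * (descent c * loop_power j) \<simeq> descent (next_index n c) * loop_power (- of_bool (c = 0) + j)"
    proof (cases c)
      case 0
      have "fstar (s 0) * (p 0 * loop_power j) \<simeq> fstar (s 0) * loop_power j"
        by (intro eqv_multR p_loop_power FSI)
      also have "\<dots> \<simeq> descent (n - 1) * loop_power (j - 1)" by (rule s_star_loop_power)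
      finally show ?thesis using 0 by (simp add: next_index_def)
    next
      case (Suc d)
      have "fstar (s c) * (descent c * loop_power j) = fstar (s c) * s c * (descent d * loop_power j)"
        by (simp add: Suc mult.assoc)
      also have "\<dots> \<simeq> p d * (descent d * loop_power j)"
        using s_star_s[of c] Suc by (intro eqv_multL FSI) (simp add: next_index_def)
      also have "\<dots> = p d * descent d * loop_power j" by (simp add: mult.assoc)
      also have "\<dots> \<simeq> descent d * loop_power j" by (intro eqv_multL p_descent FSI)
      finally show ?thesis by (simp add: Suc next_index_def)
    qed
    then show ?thesis unfolding 4 word_elt_letters using s_star_p by simp
  qed
  then show "word_elt [l] * p b \<simeq> word_elt [l]" "word_elt [l] * (descent b * loop_power j) \<simeq> descent a * loop_power (k + j)" by auto
qed

end

text \<open>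
  Composition of a letter, and of a word, with an arrow from the left; \<open>None\<close> stands for zero, which
  arises when the end vertices do not match.
\<close>

definition letter_act :: "nat \<Rightarrow> (vertex + edge) \<times> bool \<Rightarrow> arrow \<Rightarrow> arrow option" where
  "letter_act n l = (\<lambda>(c, j, d). case letter_arrow n l of (a, k, b) \<Rightarrow> if b = c then Some (a, k + j, d) else None)"

definition word_act :: "nat \<Rightarrow> ((vertex + edge) \<times> bool) list \<Rightarrow> arrow \<Rightarrow> arrow option" where
  "word_act n ls g = foldr (\<lambda>l. \<lambda>og. Option.bind og (letter_act n l)) ls (Some g)"

lemma word_act_simps [simp]:
  "word_act n [] g = Some g" "word_act n (l # ls) g = Option.bind (word_act n ls g) (letter_act n l)"
  by (simp_all add: word_act_def)

text \<open>
  The arrow of a nonempty word, obtained by letting the word act on the identity arrow at the vertex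
  where its last letter ends.
\<close>

definition word_arrow :: "nat \<Rightarrow> ((vertex + edge) \<times> bool) list \<Rightarrow> arrow option" where
  "word_arrow n ls = (case letter_arrow n (last ls) of (a, k, b) \<Rightarrow> word_act n ls (b, 0, b))"

lemma blinfun_compose_assoc: "(A o\<^sub>L B) o\<^sub>L C = A o\<^sub>L (B o\<^sub>L C)"
  by (rule blinfun_eqI) simp

text \<open>
  The operator of an arrow, and zero for the absent arrow.
\<close>

definition arrow_op_opt :: "arrow option \<Rightarrow> (circle \<times> nat) oper" where
  "arrow_op_opt og = (case og of None \<Rightarrow> 0 | Some g \<Rightarrow> arrow_op g)"

lemma word_op_arrow_op: "word_op (M_letter n) ls o\<^sub>L arrow_op g = arrow_op_opt (word_act n ls g)"
proof (induction ls)
  case (Cons l ls)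
  have *: "M_letter n l o\<^sub>L arrow_op_opt og = arrow_op_opt (Option.bind og (letter_act n l))" for og
    by (cases og) (auto simp: arrow_op_opt_def M_letter_def letter_act_def arrow_op_compose
        bounded_bilinear.zero_right[OF bounded_bilinear_blinfun_compose] split: prod.splits)
  show ?case using Cons by (simp add: blinfun_compose_assoc *)
qed (simp add: arrow_op_opt_def)

lemma word_op_eq:
  assumes "ls \<noteq> []" shows "word_op (M_letter n) ls = arrow_op_opt (word_arrow n ls)"
proof -
  obtain a k b where l: "letter_arrow n (last ls) = (a, k, b)" by (metis prod_cases3)
  have "word_op (M_letter n) ls = word_op (M_letter n) (butlast ls @ [last ls])"
    using assms by simp
  also have "\<dots> = word_op (M_letter n) (butlast ls) o\<^sub>L M_letter n (last ls)"
    by (simp add: word_op_append)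
  also have "M_letter n (last ls) = M_letter n (last ls) o\<^sub>L arrow_op (b, 0, b)"
    by (simp add: M_letter_def l arrow_op_compose)
  also have "word_op (M_letter n) (butlast ls) o\<^sub>L \<dots> = word_op (M_letter n) (butlast ls @ [last ls]) o\<^sub>L arrow_op (b, 0, b)"
    by (simp add: word_op_append blinfun_compose_assoc)
  also have "\<dots> = arrow_op_opt (word_arrow n ls)"
    using assms by (simp add: word_op_arrow_op word_arrow_def l)
  finally show ?thesis .
qed

context graph_seminorm
begin

text \<open>
  The normal form of an arrow, and zero for the absent arrow.
\<close>

definition normal_form_opt :: "arrow option \<Rightarrow> (vertex + edge) free_alg" where
  "normal_form_opt og = (case og of None \<Rightarrow> 0 | Some g \<Rightarrow> normal_form g)"

lemma letter_normal_form:
  assumes l: "fst l \<in> graph_gens (loop_graph n)"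
  shows "word_elt [l] * normal_form_opt og \<simeq> normal_form_opt (Option.bind og (letter_act n l))"
proof (cases og)
  case None
  then show ?thesis using l by (simp add: normal_form_opt_def eqv_refl zero_in_free_star)
next
  case (Some g)
  obtain a k b where l3: "letter_arrow n l = (a, k, b)" by (metis prod_cases3)
  obtain c j d where g: "g = (c, j, d)" by (metis prod_cases3)
  have in1: "word_elt [l] \<in> FS" using l by (intro word_elt_in) auto
  show ?thesis
  proof (cases "b = c")
    case True
    have "word_elt [l] * normal_form g = word_elt [l] * (descent b * loop_power j) * fstar (descent d)"
      by (simp add: g normal_form_def True mult.assoc)
    also have "\<dots> \<simeq> descent a * loop_power (k + j) * fstar (descent d)"
      by (intro eqv_multL letter_facts[OF l l3] FSI)
    finally show ?thesis by (simp add: Some normal_form_opt_def g letter_act_def l3 True normal_form_def)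
  next
    case False
    let ?r = "descent c * loop_power j * fstar (descent d)"
    have r: "?r \<in> FS" by (intro FSI)
    have "word_elt [l] * ?r \<simeq> word_elt [l] * p b * ?r"
      by (intro eqv_multL eqv_sym[OF letter_facts(1)[OF l l3]] r)
    also have "\<dots> = word_elt [l] * p b * descent c * (loop_power j * fstar (descent d))" by (simp add: mult.assoc)
    also have "\<dots> \<simeq> word_elt [l] * p b * (p c * descent c) * (loop_power j * fstar (descent d))"
      by (intro eqv_multL eqv_multR eqv_sym[OF p_descent] FSI in1)
    also have "\<dots> = word_elt [l] * (p b * p c) * ?r" by (simp add: mult.assoc)
    also have "\<dots> \<simeq> word_elt [l] * 0 * ?r"
      by (intro eqv_multL eqv_multR p_orth False in1 r)
    finally show ?thesis using False by (simp add: Some normal_form_opt_def g letter_act_def l3 normal_form_def)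
  qed
qed

lemma word_elt_normal_form:
  assumes "fst ` set ls \<subseteq> graph_gens (loop_graph n)"
  shows "word_elt ls * normal_form g \<simeq> normal_form_opt (word_act n ls g)"
  using assms
proof (induction ls)
  case Nil
  have "word_elt [] = 1" by (simp add: zero_word_def[symmetric] single_one)
  then show ?case by (simp add: normal_form_opt_def eqv_refl FSI)
next
  case (Cons l ls)
  have l: "fst l \<in> graph_gens (loop_graph n)" using Cons by simp
  have "word_elt (l # ls) * normal_form g = word_elt [l] * (word_elt ls * normal_form g)"
    using word_elt_append[of "[l]" ls] by (simp add: mult.assoc)
  also have "\<dots> \<simeq> word_elt [l] * normal_form_opt (word_act n ls g)"
    using Cons by (intro eqv_multR word_elt_in) auto
  also have "\<dots> \<simeq> normal_form_opt (word_act n (l # ls) g)"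
    using letter_normal_form[OF l] by simp
  finally show ?case .
qed

text \<open>
  Modulo \<open>\<rho>\<close>, a word depends only on its arrow.
\<close>

lemma word_elt_eqv:
  assumes ls: "ls \<noteq> []" "fst ` set ls \<subseteq> graph_gens (loop_graph n)"
  shows "word_elt ls \<simeq> normal_form_opt (word_arrow n ls)"
proof -
  obtain a k b where l: "letter_arrow n (last ls) = (a, k, b)" by (metis prod_cases3)
  have lin: "fst (last ls) \<in> graph_gens (loop_graph n)" using ls last_in_set by blast
  have c: "normal_form (b, 0, b) \<simeq> p b"
  proof -
    have "normal_form (b, 0, b) = descent b * p 0 * fstar (descent b)" by (simp add: normal_form_def loop_power_def)
    also have "\<dots> \<simeq> descent b * fstar (descent b)" by (intro eqv_multL descent_p FSI)
    also note descent_descent_star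
    finally show ?thesis .
  qed
  have in1: "word_elt ls \<in> FS" "word_elt [last ls] \<in> FS" using ls lin by (auto intro!: word_elt_in)
  have "word_elt ls \<simeq> word_elt ls * p b"
  proof (cases "butlast ls = []")
    case True
    then have "ls = [last ls]" using append_butlast_last_id[OF ls(1)] by simp
    then show ?thesis using eqv_sym[OF letter_facts(1)[OF lin l]] by metis
  next
    case False
    have in2: "word_elt (butlast ls) \<in> FS"
      using False ls by (intro word_elt_in) (auto dest: in_set_butlastD)
    have e: "word_elt ls = word_elt (butlast ls) * word_elt [last ls]"
      using word_elt_append[of "butlast ls" "[last ls]"] ls by simp
    have "word_elt ls \<simeq> word_elt (butlast ls) * (word_elt [last ls] * p b)"
      unfolding e by (intro eqv_multR eqv_sym[OF letter_facts(1)[OF lin l]] in2)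
    then show ?thesis unfolding e by (simp add: mult.assoc)
  qed
  also have "\<dots> \<simeq> word_elt ls * normal_form (b, 0, b)" by (intro eqv_multR eqv_sym[OF c] in1)
  also have "\<dots> \<simeq> normal_form_opt (word_act n ls (b, 0, b))" by (rule word_elt_normal_form[OF ls(2)])
  finally show ?thesis by (simp add: word_arrow_def l)
qed

lemma \<rho>_word_elt_le: "ls \<noteq> [] \<Longrightarrow> fst ` set ls \<subseteq> graph_gens (loop_graph n) \<Longrightarrow> \<rho> (word_elt ls) \<le> 1"
  using graph_seminorms_bdd[OF wf_loop_graph[OF n] word_elt_in \<rho>, of ls] by simp

lemma \<rho>_mult_le1: "x \<in> FS \<Longrightarrow> y \<in> FS \<Longrightarrow> \<rho> x \<le> 1 \<Longrightarrow> \<rho> y \<le> 1 \<Longrightarrow> \<rho> (x * y) \<le> 1"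
  using \<rho>_mult[of x y] mult_le_one[of "\<rho> x" "\<rho> y"] \<rho>_ge0 by fastforce

lemma \<rho>_normal_form_le: "\<rho> (normal_form g) \<le> 1"
proof -
  have p: "\<rho> (p a) \<le> 1" and s: "\<rho> (s a) \<le> 1" for a
    using \<rho>_word_elt_le[of "[(Inl (vertex_at n a), False)]"] \<rho>_word_elt_le[of "[(Inr (edge_at n a), False)]"]
    by (auto simp: word_elt_letters graph_gens_loop_graph)
  have t: "\<rho> (descent a) \<le> 1" for a by (induction a) (simp_all add: p s \<rho>_mult_le1 FSI)
  have l: "\<rho> loop \<le> 1" unfolding loop_def by (intro \<rho>_mult_le1 s t FSI)
  have "\<rho> (loop_pow k) \<le> 1" "\<rho> (loop_star_pow k) \<le> 1" for k
    by (induction k) (simp_all add: p l \<rho>_mult_le1 FSI \<rho>_fstar)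
  then have lw: "\<rho> (loop_power k) \<le> 1" for k by (simp add: loop_power_def)
  show ?thesis
    unfolding normal_form_def by (auto split: prod.splits intro!: \<rho>_mult_le1 t lw FSI simp: \<rho>_fstar descent_in)
qed

end

section \<open>Comparison of the universal norm with the operator norm\<close>

lemma sum_roots_of_unity_powi:
  fixes d :: int and m :: nat
  assumes d: "d \<noteq> 0" "\<bar>d\<bar> < int m"
  shows "(\<Sum>j<m. cis (2 * pi * real j / real m) powi d) = 0"
proof -
  define q where "q = cis (2 * pi * real_of_int d / real m)"
  have m: "m > 0" using d by simp
  have "cis (2 * pi * real j / real m) powi d = q ^ j" for j
    unfolding q_def cis_power_int Complex.DeMoivre by (rule arg_cong[of _ _ cis]) (simp add: field_simps)
  moreover have "q ^ m = 1"
    unfolding q_def Complex.DeMoivre using m cis_multiple_2pi[of "real_of_int d"] by (simp add: mult.commute)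
  moreover have "q \<noteq> 1"
  proof
    assume "q = 1"
    then have "Re q = 1" by simp
    then have "cos (2 * pi * real_of_int d / real m) = 1" by (simp add: q_def)
    then obtain i :: int where "2 * pi * real_of_int d / real m = real_of_int i * (2 * pi)"
      by (auto simp: cos_one_2pi_int)
    then have "real_of_int d = real_of_int (i * int m)" using m by (simp add: field_simps)
    then have "d = i * int m" using of_int_eq_iff by blast
    then show False using d by (auto simp: abs_mult)
  qed
  ultimately show ?thesis by (simp add: geometric_sum)
qed

text \<open>
  A Fourier coefficient of a Laurent polynomial is bounded by the supremum norm.  The coefficient is
  recovered by averaging over the roots of unity of order \<open>2 D + 1\<close>, which separate the exponents from
  \<open>- D\<close> to \<open>D\<close>.
\<close>

lemma laurent_coeff_le:
  fixes c :: "int \<Rightarrow> complex" and D :: nat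
  assumes B: "\<And>z. cmod z = 1 \<Longrightarrow> cmod (\<Sum>k\<in>{- int D..int D}. c k * z powi k) \<le> B"
    and k: "k \<in> {- int D..int D}"
  shows "cmod (c k) \<le> B"
proof -
  define m where "m = 2 * D + 1"
  define w where "w j = cis (2 * pi * real j / real m)" for j
  let ?K = "{- int D..int D}"
  let ?f = "\<lambda>z. \<Sum>k\<in>?K. c k * z powi k"
  have w: "cmod (w j) = 1" "w j \<noteq> 0" for j by (auto simp: w_def)
  have "(\<Sum>j<m. ?f (w j) * w j powi (- k)) = (\<Sum>j<m. \<Sum>l\<in>?K. c l * w j powi (l - k))"
    using w(2) by (simp add: sum_distrib_right mult.assoc power_int_add[symmetric])
  also have "\<dots> = (\<Sum>l\<in>?K. c l * (\<Sum>j<m. w j powi (l - k)))"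
    by (subst sum.swap) (simp add: sum_distrib_left)
  also have "\<dots> = (\<Sum>l\<in>?K. if l = k then c k * of_nat m else 0)"
  proof (intro sum.cong refl)
    fix l assume l: "l \<in> ?K"
    have "(\<Sum>j<m. w j powi (l - k)) = 0" if "l \<noteq> k"
      unfolding w_def using l k that by (intro sum_roots_of_unity_powi) (auto simp: m_def)
    then show "c l * (\<Sum>j<m. w j powi (l - k)) = (if l = k then c k * of_nat m else 0)"
      by simp
  qed
  also have "\<dots> = c k * of_nat m" using k by simp
  finally have "cmod (c k) * real m = cmod (\<Sum>j<m. ?f (w j) * w j powi (- k))"
    by (simp add: norm_mult)
  also have "\<dots> \<le> (\<Sum>j<m. B)"
    using B w by (intro sum_norm_le) (simp add: norm_mult norm_power_int)
  finally show ?thesis by (simp add: m_def)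
qed

text \<open>
  Summation over words, grouped by their arrows.
\<close>

lemma sum_regroup:
  fixes f :: "complex \<Rightarrow> 'g \<Rightarrow> 'c::comm_monoid_add"
  assumes A: "finite A" and S: "finite S" and v: "\<And>w. w \<in> A \<Longrightarrow> v w \<in> insert None (Some ` S)"
    and f: "\<And>g. f 0 g = 0" "\<And>c d g. f (c + d) g = f c g + f d g"
  shows "(\<Sum>w\<in>A. case v w of None \<Rightarrow> 0 | Some g \<Rightarrow> f (c w) g)
       = (\<Sum>g\<in>S. f (\<Sum>w\<in>A. if v w = Some g then c w else 0) g)"
proof -
  have "f (\<Sum>w\<in>A. if v w = Some g then c w else 0) g = (\<Sum>w\<in>A. if v w = Some g then f (c w) g else 0)" for g
    using A by (induction A rule: finite_induct) (simp_all add: f)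
  then have "(\<Sum>g\<in>S. f (\<Sum>w\<in>A. if v w = Some g then c w else 0) g)
      = (\<Sum>w\<in>A. \<Sum>g\<in>S. if v w = Some g then f (c w) g else 0)"
    by (simp add: sum.swap[of _ S])
  also have "\<dots> = (\<Sum>w\<in>A. case v w of None \<Rightarrow> 0 | Some g \<Rightarrow> f (c w) g)"
  proof (intro sum.cong refl)
    fix w assume w: "w \<in> A"
    show "(\<Sum>g\<in>S. if v w = Some g then f (c w) g else 0) = (case v w of None \<Rightarrow> 0 | Some g \<Rightarrow> f (c w) g)"
      using v[OF w] S by (cases "v w") auto
  qed
  finally show ?thesis by simp
qed

text \<open>
  The coefficient of \<open>x\<close> at an arrow: the sum of its coefficients at the words with that arrow.
\<close>

definition coeff :: "nat \<Rightarrow> (vertex + edge) free_alg \<Rightarrow> arrow \<Rightarrow> complex" where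
  "coeff n x g = (\<Sum>w\<in>Poly_Mapping.keys x.
     if word_arrow n (letters w) = Some g then Poly_Mapping.lookup x w else 0)"

text \<open>
  The finite set of arrows between vertices below \<open>N\<close> with winding number at most \<open>D\<close> in modulus.
\<close>

definition box :: "nat \<Rightarrow> nat \<Rightarrow> arrow set" where
  "box N D = {..<N} \<times> {- int D..int D} \<times> {..<N}"

text \<open>
  Words of length at most \<open>D\<close> that only meet vertices below \<open>N\<close>, and elements of the free algebra
  composed of such words.  Their arrows lie in \<open>box N D\<close>, and \<open>D\<close> is additive under multiplication.
\<close>

definition word_bounded :: "nat \<Rightarrow> nat \<Rightarrow> nat \<Rightarrow> ((vertex + edge) \<times> bool) list \<Rightarrow> bool" where
  "word_bounded n N D ls \<longleftrightarrow> length ls \<le> D \<and> (\<forall>l\<in>set ls. case letter_arrow n l of (a, k, b) \<Rightarrow> a < N \<and> b < N)"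

definition alg_bounded :: "nat \<Rightarrow> nat \<Rightarrow> nat \<Rightarrow> (vertex + edge) free_alg \<Rightarrow> bool" where
  "alg_bounded n N D x \<longleftrightarrow> x \<in> free_star (graph_gens (loop_graph n)) \<and>
     (\<forall>w\<in>Poly_Mapping.keys x. word_bounded n N D (letters w))"

lemma finite_box: "finite (box N D)"
  by (simp add: box_def)

lemma letter_arrow_winding: "letter_arrow n l = (a, k, b) \<Longrightarrow> \<bar>k\<bar> \<le> 1"
  by (cases l; cases "fst l") (auto simp: Let_def split: if_splits)

lemma word_act_bounded:
  assumes "word_act n ls (c, j, d) = Some (a, k, b)" "word_bounded n N D ls" "c < N"
  shows "a < N \<and> b = d \<and> \<bar>k - j\<bar> \<le> int (length ls)"
  using assms
proof (induction ls arbitrary: a k b)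
  case (Cons l ls)
  from Cons.prems(1) obtain g where g: "word_act n ls (c, j, d) = Some g" "letter_act n l g = Some (a, k, b)"
    by (auto simp: bind_eq_Some_conv)
  obtain a' k' b' where g': "g = (a', k', b')" by (metis prod_cases3)
  obtain x y z where l: "letter_arrow n l = (x, y, z)" by (metis prod_cases3)
  have IH: "a' < N \<and> b' = d \<and> \<bar>k' - j\<bar> \<le> int (length ls)"
    using Cons.IH[OF g(1)[unfolded g']] Cons.prems by (auto simp: word_bounded_def)
  have e: "a = x" "k = y + k'" "b = b'" using g(2) by (auto simp: letter_act_def l g' split: if_splits)
  have "\<bar>y\<bar> \<le> 1" by (rule letter_arrow_winding[OF l])
  moreover have "x < N" using Cons.prems(2) l by (auto simp: word_bounded_def)
  ultimately show ?case using IH e by (simp add: abs_le_iff)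
qed simp

lemma word_arrow_box:
  assumes "ls \<noteq> []" "word_bounded n N D ls" shows "word_arrow n ls \<in> insert None (Some ` box N D)"
proof (cases "word_arrow n ls")
  case (Some g)
  obtain a k b where g: "g = (a, k, b)" by (metis prod_cases3)
  obtain x y z where l: "letter_arrow n (last ls) = (x, y, z)" by (metis prod_cases3)
  have "last ls \<in> set ls" using assms by simp
  then have z: "z < N" using assms(2) l by (auto simp: word_bounded_def)
  have "a < N \<and> b = z \<and> \<bar>k - 0\<bar> \<le> int (length ls)"
    using Some by (intro word_act_bounded[OF _ assms(2) z]) (simp add: word_arrow_def l g)
  then have "g \<in> box N D" using assms(2) z by (auto simp: box_def g word_bounded_def)
  then show ?thesis using Some by simp
qed simp

lemma alg_bounded_exists:
  assumes "x \<in> free_star (graph_gens (loop_graph n))"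
  obtains N D where "alg_bounded n N D x"
proof -
  let ?L = "\<Union>w\<in>Poly_Mapping.keys x. set (letters w)"
  let ?I = "(\<lambda>l. fst (letter_arrow n l)) ` ?L \<union> (\<lambda>l. snd (snd (letter_arrow n l))) ` ?L"
  have "finite ?I" by auto
  then obtain N where N: "\<forall>i\<in>?I. i < N" unfolding finite_nat_set_iff_bounded by blast
  have "finite ((\<lambda>w. length (letters w)) ` Poly_Mapping.keys x)" by simp
  then obtain D where D: "\<forall>i\<in>(\<lambda>w. length (letters w)) ` Poly_Mapping.keys x. i < D"
    unfolding finite_nat_set_iff_bounded by blast
  have "alg_bounded n N D x"
    unfolding alg_bounded_def word_bounded_def
  proof (intro conjI ballI)
    fix w l assume w: "w \<in> Poly_Mapping.keys x" "l \<in> set (letters w)"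
    then have "fst (letter_arrow n l) \<in> ?I" "snd (snd (letter_arrow n l)) \<in> ?I" by blast+
    then have "fst (letter_arrow n l) < N" "snd (snd (letter_arrow n l)) < N" using N by blast+
    then show "case letter_arrow n l of (a, k, b) \<Rightarrow> a < N \<and> b < N" by (cases "letter_arrow n l") auto
  qed (use assms D in \<open>auto simp: less_imp_le\<close>)
  then show ?thesis by (rule that)
qed

lemma alg_bounded_mult:
  assumes "alg_bounded n N D x" "alg_bounded n N D' y"
  shows "alg_bounded n N (D + D') (x * y)"
  unfolding alg_bounded_def
proof (intro conjI ballI)
  show "x * y \<in> free_star (graph_gens (loop_graph n))"
    using assms by (simp add: alg_bounded_def mult_in_free_star)
  fix w assume "w \<in> Poly_Mapping.keys (x * y)"
  then obtain u v where "w = u + v" "u \<in> Poly_Mapping.keys x" "v \<in> Poly_Mapping.keys y"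
    using keys_mult[of x y] by blast
  then have "letters w = letters u @ letters v" "word_bounded n N D (letters u)" "word_bounded n N D' (letters v)"
    using assms by (auto simp: alg_bounded_def plus_word_def)
  then show "word_bounded n N (D + D') (letters w)"
    by (auto simp: word_bounded_def)
qed

lemma alg_bounded_word_arrow:
  assumes "alg_bounded n N D x" "w \<in> Poly_Mapping.keys x"
  shows "letters w \<noteq> []" "fst ` set (letters w) \<subseteq> graph_gens (loop_graph n)"
    "word_arrow n (letters w) \<in> insert None (Some ` box N D)"
proof -
  show *: "letters w \<noteq> []" "fst ` set (letters w) \<subseteq> graph_gens (loop_graph n)"
    using assms unfolding alg_bounded_def free_star_def by auto
  then show "word_arrow n (letters w) \<in> insert None (Some ` box N D)"
    using assms word_arrow_box by (simp add: alg_bounded_def)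
qed

text \<open>
  The matrix entry at \<open>(a, b)\<close> of an operator, as a function of the point \<open>t\<close> of the circle.
\<close>

definition entry :: "(circle \<times> nat) oper \<Rightarrow> nat \<Rightarrow> nat \<Rightarrow> circle \<Rightarrow> complex" where
  "entry T a b t = coord (blinfun_apply T (ket (t, b))) (t, a)"

lemma entry_le_norm: "cmod (entry T a b t) \<le> norm T"
proof -
  have "cmod (entry T a b t) \<le> norm (blinfun_apply T (ket (t, b)))"
    unfolding entry_def by (rule coord_le_norm)
  also have "\<dots> \<le> norm T * norm (ket (t, b) :: (circle \<times> nat) ell2)" by (rule norm_blinfun)
  also have "\<dots> \<le> norm T" by (rule mult_left_le[OF norm_ket_le]) simp
  finally show ?thesis .
qed

lemma entry_simps:
  "entry 0 a b t = 0" "entry (S + T) a b t = entry S a b t + entry T a b t"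
  "entry (cscale_op c T) a b t = c * entry T a b t"
  by (simp_all add: entry_def blinfun.add_left)

lemma entry_sum: "entry (sum f A) a b t = (\<Sum>i\<in>A. entry (f i) a b t)"
  by (induction A rule: infinite_finite_induct) (simp_all add: entry_simps)

lemma entry_arrow_op: "entry (arrow_op (a', k, b')) a b t = (if a' = a \<and> b' = b then point t powi k else 0)"
  by (auto simp: entry_def)

lemma graph_op_eq_sum:
  assumes "alg_bounded n N D x"
  shows "graph_op n x = (\<Sum>g\<in>box N D. cscale_op (coeff n x g) (arrow_op g))"
proof -
  have "graph_op n x = (\<Sum>w\<in>Poly_Mapping.keys x. case word_arrow n (letters w) of None \<Rightarrow> 0
      | Some g \<Rightarrow> cscale_op (Poly_Mapping.lookup x w) (arrow_op g))"
    unfolding free_op_def lin_def using alg_bounded_word_arrow[OF assms]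
    by (intro sum.cong) (auto simp: word_op_eq arrow_op_opt_def cscale_op_simps split: option.splits)
  also have "\<dots> = (\<Sum>g\<in>box N D. cscale_op (coeff n x g) (arrow_op g))"
    unfolding coeff_def using alg_bounded_word_arrow[OF assms]
    by (intro sum_regroup) (simp_all add: cscale_op_simps finite_box)
  finally show ?thesis .
qed

lemma entry_graph_op:
  assumes "alg_bounded n N D x" "a < N" "b < N"
  shows "entry (graph_op n x) a b t = (\<Sum>k\<in>{- int D..int D}. coeff n x (a, k, b) * point t powi k)"
proof -
  have "entry (graph_op n x) a b t
      = (\<Sum>g\<in>box N D. coeff n x g * (case g of (a', k, b') \<Rightarrow> if a' = a \<and> b' = b then point t powi k else 0))"
    unfolding graph_op_eq_sum[OF assms(1)] entry_sum entry_simps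
    by (intro sum.cong refl) (auto simp: entry_arrow_op)
  also have "\<dots> = (\<Sum>g\<in>(\<lambda>k. (a, k, b)) ` {- int D..int D}. coeff n x g * (case g of (a', k, b') \<Rightarrow> if a' = a \<and> b' = b then point t powi k else 0))"
    using assms(2,3) by (intro sum.mono_neutral_right finite_box) (auto simp: box_def split: if_splits)
  also have "\<dots> = (\<Sum>k\<in>{- int D..int D}. coeff n x (a, k, b) * point t powi k)"
    by (subst sum.reindex) (auto simp: inj_on_def)
  finally show ?thesis .
qed

lemma coeff_le_norm:
  assumes x: "alg_bounded n N D x" and g: "g \<in> box N D"
  shows "cmod (coeff n x g) \<le> norm (graph_op n x)"
proof -
  obtain a k b where g': "g = (a, k, b)" by (metis prod_cases3)
  have "cmod (coeff n x (a, k, b)) \<le> norm (graph_op n x)"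
  proof (rule laurent_coeff_le)
    show "k \<in> {- int D..int D}" using g by (simp add: box_def g')
    fix z :: complex assume "cmod z = 1"
    then obtain t where z: "z = point t"
      using Abs_circle_inverse[of z] by (metis dist_0_norm mem_sphere)
    have "entry (graph_op n x) a b t = (\<Sum>k\<in>{- int D..int D}. coeff n x (a, k, b) * point t powi k)"
      using g by (intro entry_graph_op[OF x]) (auto simp: box_def g')
    then show "cmod (\<Sum>k\<in>{- int D..int D}. coeff n x (a, k, b) * z powi k) \<le> norm (graph_op n x)"
      using entry_le_norm[of "graph_op n x" a b t] by (simp add: z)
  qed
  then show ?thesis by (simp add: g')
qed

context graph_seminorm
begin

lemma seminorm_le_coeffs:
  assumes x: "alg_bounded n N D x"
  shows "\<rho> x \<le> (\<Sum>g\<in>box N D. cmod (coeff n x g))"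
proof -
  let ?K = "Poly_Mapping.keys x" and ?c = "Poly_Mapping.lookup x"
  note v = alg_bounded_word_arrow[OF x]
  have "x = (\<Sum>w\<in>?K. fscale (?c w) (word_elt (letters w)))"
    using pm_expand[of x] by (simp add: fscale_single)
  also have "\<dots> \<simeq> (\<Sum>w\<in>?K. fscale (?c w) (normal_form_opt (word_arrow n (letters w))))"
    using v by (intro eqv_sum eqv_fscale word_elt_eqv) auto
  also have "(\<Sum>w\<in>?K. fscale (?c w) (normal_form_opt (word_arrow n (letters w))))
      = (\<Sum>w\<in>?K. case word_arrow n (letters w) of None \<Rightarrow> 0 | Some g \<Rightarrow> fscale (?c w) (normal_form g))"
    by (intro sum.cong refl) (simp add: normal_form_opt_def fscale_def split: option.splits)
  also have "\<dots> = (\<Sum>g\<in>box N D. fscale (coeff n x g) (normal_form g))"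
    unfolding coeff_def using v
    by (intro sum_regroup) (simp_all add: finite_box fscale_def single_add algebra_simps)
  finally have "\<rho> x = \<rho> (\<Sum>g\<in>box N D. fscale (coeff n x g) (normal_form g))" by (rule \<rho>_eqv)
  also have "\<dots> \<le> (\<Sum>g\<in>S. cmod (coeff n x g))" if "S = box N D" for S
  proof -
    have "\<rho> (\<Sum>g\<in>S. fscale (coeff n x g) (normal_form g)) \<le> (\<Sum>g\<in>S. cmod (coeff n x g))" if "finite S" for S
      using that
    proof (induction S rule: finite_induct)
      case (insert g S)
      have "\<rho> (fscale (coeff n x g) (normal_form g) + (\<Sum>g\<in>S. fscale (coeff n x g) (normal_form g)))
          \<le> \<rho> (fscale (coeff n x g) (normal_form g)) + \<rho> (\<Sum>g\<in>S. fscale (coeff n x g) (normal_form g))"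
        by (intro \<rho>_add sum_in_free_star fscale_in_free_star normal_form_in)
      also have "\<rho> (fscale (coeff n x g) (normal_form g)) \<le> cmod (coeff n x g)"
        using \<rho>_normal_form_le[of g] by (simp add: \<rho>_scale normal_form_in mult_left_le)
      finally show ?case using insert by simp
    qed (simp add: \<rho>_zero)
    then show ?thesis using that finite_box by blast
  qed
  finally show ?thesis by simp
qed

lemma seminorm_le_poly:
  assumes x: "alg_bounded n N D x"
  shows "\<rho> x \<le> real (N * N * (2 * D + 1)) * norm (graph_op n x)"
proof -
  have "\<rho> x \<le> (\<Sum>g\<in>box N D. cmod (coeff n x g))" by (rule seminorm_le_coeffs[OF x])
  also have "\<dots> \<le> (\<Sum>g\<in>box N D. norm (graph_op n x))"
    by (intro sum_mono coeff_le_norm[OF x])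
  also have "card (box N D) = N * N * (2 * D + 1)"
    by (simp add: box_def card_cartesian_product algebra_simps nat_add_distrib nat_mult_distrib)
  then have "(\<Sum>g\<in>box N D. norm (graph_op n x)) = real (N * N * (2 * D + 1)) * norm (graph_op n x)"
    by simp
  finally show ?thesis .
qed

text \<open>
  The polynomial bound on the ratio of the two norms disappears on passing to high powers, since
  \<open>m / q\<^sup>m\<close> tends to \<open>0\<close> for \<open>q > 1\<close>.
\<close>

theorem seminorm_le_graph_op:
  assumes x: "x \<in> FS" shows "\<rho> x \<le> norm (graph_op n x)"
proof -
  define H where "H = fstar x * x"
  have Hin: "H \<in> FS" unfolding H_def by (intro mult_in_free_star fstar_in_free_star x)
  (* P j is H to the power 2 ^ j. *)
  define P where "P = rec_nat H (\<lambda>_ y. y * y)"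
  have P: "P 0 = H" "P (Suc j) = P j * P j" for j by (simp_all add: P_def)
  obtain N D where ND: "alg_bounded n N D H" using alg_bounded_exists[OF Hin] .
  have Pin: "P j \<in> FS" for j by (induction j) (simp_all add: P Hin mult_in_free_star)
  have Pstar: "fstar (P j) = P j" for j by (induction j) (simp_all add: P H_def fstar_mult)
  have \<rho>P: "\<rho> (P j) = \<rho> H ^ 2 ^ j" for j
  proof (induction j)
    case (Suc j)
    have "\<rho> (P (Suc j)) = (\<rho> (P j))\<^sup>2" using \<rho>_cstar[OF Pin[of j]] by (simp add: P Pstar)
    then show ?case using Suc by (simp add: power_mult[symmetric] mult.commute)
  qed (simp add: P)
  have opP: "norm (graph_op n (P j)) \<le> norm (graph_op n H) ^ 2 ^ j" for j
  proof (induction j)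
    case (Suc j)
    have "norm (graph_op n (P (Suc j))) \<le> norm (graph_op n (P j)) * norm (graph_op n (P j))"
      by (simp add: P graph_rep.free_op_mult norm_blinfun_compose)
    also have "\<dots> \<le> norm (graph_op n H) ^ 2 ^ j * norm (graph_op n H) ^ 2 ^ j"
      by (intro mult_mono Suc) auto
    finally show ?case by (simp add: power_add[symmetric] mult_2)
  qed (simp add: P)
  have bP: "alg_bounded n N (2 ^ j * D) (P j)" for j
  proof (induction j)
    case (Suc j)
    then show ?case using alg_bounded_mult[OF Suc Suc] by (simp add: P mult_2 algebra_simps)
  qed (simp add: P ND)
  define C where "C = real (N * N * (2 * D + 1))"
  have C0: "C \<ge> 0" by (simp add: C_def)
  have key: "\<rho> H ^ 2 ^ j \<le> C * real (2 ^ j) * norm (graph_op n H) ^ 2 ^ j" for j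
  proof -
    have "\<rho> H ^ 2 ^ j \<le> real (N * N * (2 * (2 ^ j * D) + 1)) * norm (graph_op n (P j))"
      using seminorm_le_poly[OF bP] by (simp add: \<rho>P)
    also have "\<dots> \<le> (C * real (2 ^ j)) * norm (graph_op n H) ^ 2 ^ j"
    proof (intro mult_mono opP)
      have "(1::nat) \<le> 2 ^ j" by simp
      then have "N * N * (2 * (2 ^ j * D) + 1) \<le> N * N * (2 * D + 1) * 2 ^ j"
        by (simp add: algebra_simps)
      then show "real (N * N * (2 * (2 ^ j * D) + 1)) \<le> C * real (2 ^ j)"
        unfolding C_def of_nat_mult[symmetric] by (simp only: of_nat_le_iff)
    qed (use C0 in auto)
    finally show ?thesis by simp
  qed
  have le: "\<rho> H \<le> norm (graph_op n H)"
  proof (rule ccontr)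
    let ?s = "norm (graph_op n H)"
    assume less: "\<not> \<rho> H \<le> ?s"
    have s: "?s > 0"
    proof (rule ccontr)
      assume "\<not> ?s > 0"
      then have "?s = 0" by simp
      then have "\<rho> H \<le> 0" using key[of 0] by simp
      then show False using less norm_ge_zero[of "graph_op n H"] by linarith
    qed
    define q where "q = \<rho> H / ?s"
    have q: "q > 1" using less s by (simp add: q_def)
    have "(\<lambda>m. of_nat m / q ^ m) \<longlonglongrightarrow> 0"
      using lim_n_over_pown[of q] q by simp
    moreover have "filterlim (\<lambda>j. 2 ^ j :: nat) sequentially sequentially"
      by (rule filterlim_subseq) (simp add: strict_mono_def)
    ultimately have "(\<lambda>j. of_nat (2 ^ j) / q ^ 2 ^ j) \<longlonglongrightarrow> 0"
      by (rule filterlim_compose)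
    then have "(\<lambda>j. C * (of_nat (2 ^ j) / q ^ 2 ^ j)) \<longlonglongrightarrow> C * 0"
      by (intro tendsto_intros)
    then have "\<forall>\<^sub>F j in sequentially. C * (of_nat (2 ^ j) / q ^ 2 ^ j) < 1"
      by (intro order_tendstoD) auto
    then obtain j where j: "C * (of_nat (2 ^ j) / q ^ 2 ^ j) < 1"
      by (meson eventually_happens sequentially_bot)
    have "q ^ 2 ^ j \<le> C * real (2 ^ j)"
      using key[of j] s unfolding q_def power_divide by (subst pos_divide_le_eq) auto
    then show False using j q by (simp add: field_simps)
  qed
  have "(\<rho> x)\<^sup>2 \<le> (norm (graph_op n x))\<^sup>2"
    using le \<rho>_cstar[OF x] is_adj_norm(2)[OF graph_rep.free_op_adj, of n x]
    by (simp add: H_def graph_rep.free_op_mult)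
  then show ?thesis by (rule power2_le_imp_le) simp
qed

end

theorem graph_universal_norm:
  assumes n: "n \<ge> 1" and x: "x \<in> free_star (graph_gens (loop_graph n))"
  shows "universal_norm (graph_gens (loop_graph n)) (graph_rels (loop_graph n)) x = norm (graph_op n x)"
  unfolding universal_norm_def
proof (rule cSup_eq_maximum)
  show "norm (graph_op n x) \<in> (\<lambda>\<rho>. \<rho> x) ` cstar_seminorms (graph_gens (loop_graph n)) (graph_rels (loop_graph n))"
    using graph_op_seminorm[OF n] by (intro image_eqI[where x = "\<lambda>x. norm (graph_op n x)"]) auto
  fix r assume "r \<in> (\<lambda>\<rho>. \<rho> x) ` cstar_seminorms (graph_gens (loop_graph n)) (graph_rels (loop_graph n))"
  then obtain \<rho> where r: "\<rho> \<in> cstar_seminorms (graph_gens (loop_graph n)) (graph_rels (loop_graph n))" "r = \<rho> x"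
    by blast
  interpret graph_seminorm n \<rho> by unfold_locales (use n r in auto)
  show "r \<le> norm (graph_op n x)" using seminorm_le_graph_op[OF x] r(2) by simp
qed

section \<open>Elementary tensors of functions and operators\<close>

text \<open>
  The restriction of a vector in \<open>\<ell>\<^sup>2(I \<times> J)\<close> to \<open>{t} \<times> J\<close>.
\<close>

definition slice :: "'i \<Rightarrow> ('i \<times> 'j) ell2 \<Rightarrow> 'j ell2" where
  "slice t x = Abs_ell2 (\<lambda>j. coord x (t, j))"

lemma coord_slice [simp]: "coord (slice t x) j = coord x (t, j)"
proof -
  have "(\<Sum>j\<in>F. (cmod (coord x (t, j)))\<^sup>2) \<le> (norm x)\<^sup>2" if "finite F" for F
  proof -
    have "(\<Sum>j\<in>F. (cmod (coord x (t, j)))\<^sup>2) = (\<Sum>p\<in>Pair t ` F. (cmod (coord x p))\<^sup>2)"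
      by (subst sum.reindex) (auto simp: inj_on_def)
    also have "\<dots> \<le> (norm x)\<^sup>2" using that by (intro sum_coord_le) auto
    finally show ?thesis .
  qed
  from ell2_bounded(1)[OF this] show ?thesis by (simp add: slice_def)
qed

lemma slice_linear: "slice t (x + y) = slice t x + slice t y" "slice t (r *\<^sub>R x) = r *\<^sub>R slice t x"
  by (auto intro!: ell2_eqI)

lemma sum_norm_slice_le:
  assumes "finite F" shows "(\<Sum>t\<in>F. (norm (slice t x))\<^sup>2) \<le> (norm x)\<^sup>2"
proof -
  let ?f = "\<lambda>p. (cmod (coord x p))\<^sup>2"
  have s: "?f summable_on A" for A
    by (rule summable_on_subset_banach[OF coord_sq_summable]) simp
  have "(\<Sum>t\<in>F. (norm (slice t x))\<^sup>2) = (\<Sum>\<^sub>\<infinity>t\<in>F. \<Sum>\<^sub>\<infinity>j. ?f (t, j))"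
    using assms by (simp add: norm_ell2_sq)
  also have "\<dots> = (\<Sum>\<^sub>\<infinity>p\<in>F \<times> UNIV. ?f p)"
    using infsum_Sigma_banach[of ?f F "\<lambda>_. UNIV"] s by simp
  also have "\<dots> \<le> (\<Sum>\<^sub>\<infinity>p. ?f p)"
    by (rule infsum_mono_neutral[OF s s]) auto
  finally show ?thesis by (simp add: norm_ell2_sq)
qed

text \<open>
  The elementary tensor of the multiplication operator of \<open>f\<close> with \<open>b\<close>, acting by \<open>f t * b\<close> on the slice at
  the point \<open>t\<close>.  It is bounded for bounded \<open>f\<close> and any bounded \<open>b\<close>, and for complex linear \<open>b\<close> it is the operator
  \<open>op_tensor (mult_op f) b\<close>, which is only defined by a description (\<open>op_tensor_eq_field_op\<close>).
\<close>

definition field_op :: "(complex \<Rightarrow> complex) \<Rightarrow> nat oper \<Rightarrow> (circle \<times> nat) oper" where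
  "field_op f b = Blinfun (\<lambda>x. Abs_ell2 (\<lambda>(t, j). f (point t) * coord (blinfun_apply b (slice t x)) j))"

text \<open>
  \<open>B\<close> bounds the modulus of \<open>f\<close> on the unit circle; values of \<open>f\<close> elsewhere are irrelevant.
\<close>

definition circle_bound :: "(complex \<Rightarrow> complex) \<Rightarrow> real \<Rightarrow> bool" where
  "circle_bound f B \<longleftrightarrow> (\<forall>t. cmod (f (point t)) \<le> B)"

lemma
  assumes f: "circle_bound f B"
  shows coord_field_op: "coord (blinfun_apply (field_op f b) x) (t, j) = f (point t) * coord (blinfun_apply b (slice t x)) j"
    and norm_field_op_le: "norm (field_op f b) \<le> B * norm b"
proof -
  have B: "cmod (f (point t)) \<le> B" for t using f by (simp add: circle_bound_def)
  have B0: "0 \<le> B" using B[of undefined] norm_ge_zero order_trans by blast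
  define T where "T = (\<lambda>x. Abs_ell2 (\<lambda>(t, j). f (point t) * coord (blinfun_apply b (slice t x)) j))"
  let ?y = "\<lambda>x. \<lambda>(t, j). f (point t) * coord (blinfun_apply b (slice t x)) j"
  have "(\<Sum>p\<in>F. (cmod (?y x p))\<^sup>2) \<le> (B * norm b * norm x)\<^sup>2" if F: "finite F" for F x
  proof -
    have "(\<Sum>p\<in>F. (cmod (?y x p))\<^sup>2) \<le> (\<Sum>p\<in>fst ` F \<times> snd ` F. (cmod (?y x p))\<^sup>2)"
      using F by (intro sum_mono2) force+
    also have "\<dots> = (\<Sum>t\<in>fst ` F. \<Sum>j\<in>snd ` F. (cmod (?y x (t, j)))\<^sup>2)"
      by (simp add: sum.cartesian_product case_prod_beta)
    also have "\<dots> \<le> (\<Sum>t\<in>fst ` F. (B * norm b)\<^sup>2 * (norm (slice t x))\<^sup>2)"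
    proof (intro sum_mono)
      fix t
      have "(\<Sum>j\<in>snd ` F. (cmod (?y x (t, j)))\<^sup>2)
          = (cmod (f (point t)))\<^sup>2 * (\<Sum>j\<in>snd ` F. (cmod (coord (blinfun_apply b (slice t x)) j))\<^sup>2)"
        by (simp add: norm_mult power_mult_distrib sum_distrib_left)
      also have "\<dots> \<le> B\<^sup>2 * (norm (blinfun_apply b (slice t x)))\<^sup>2"
        using F B by (intro mult_mono power_mono sum_coord_le sum_nonneg) auto
      also have "\<dots> \<le> B\<^sup>2 * (norm b * norm (slice t x))\<^sup>2"
        by (intro mult_left_mono power_mono norm_blinfun) auto
      finally show "(\<Sum>j\<in>snd ` F. (cmod (?y x (t, j)))\<^sup>2) \<le> (B * norm b)\<^sup>2 * (norm (slice t x))\<^sup>2"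
        by (simp add: power_mult_distrib mult_ac)
    qed
    also have "\<dots> = (B * norm b)\<^sup>2 * (\<Sum>t\<in>fst ` F. (norm (slice t x))\<^sup>2)"
      by (simp add: sum_distrib_left)
    also have "\<dots> \<le> (B * norm b)\<^sup>2 * (norm x)\<^sup>2"
      using F by (intro mult_left_mono sum_norm_slice_le) auto
    finally show ?thesis by (simp add: power_mult_distrib)
  qed
  note * = ell2_bounded[OF this]
  have c: "coord (T x) (t, j) = f (point t) * coord (blinfun_apply b (slice t x)) j" for x t j
    using *(1)[of x] B0 by (simp add: T_def)
  have nrm: "norm (T x) \<le> B * norm b * norm x" for x
    using *(2)[of x] B0 by (simp add: T_def)
  have bl: "bounded_linear T"
  proof (rule bounded_linear_intro[where K = "B * norm b"])
    show "T (x + y) = T x + T y" for x y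
      by (rule ell2_eqI) (auto simp: c slice_linear blinfun.add_right algebra_simps)
    show "T (r *\<^sub>R x) = r *\<^sub>R T x" for r x
      by (rule ell2_eqI) (auto simp: c slice_linear blinfun.scaleR_right)
    show "norm (T x) \<le> norm x * (B * norm b)" for x using nrm[of x] by (simp add: mult_ac)
  qed
  have app: "blinfun_apply (field_op f b) x = T x" for x
    using bounded_linear_Blinfun_apply[OF bl] by (simp add: field_op_def T_def)
  show "coord (blinfun_apply (field_op f b) x) (t, j) = f (point t) * coord (blinfun_apply b (slice t x)) j"
    by (simp add: app c)
  show "norm (field_op f b) \<le> B * norm b"
    using B0 nrm by (intro norm_blinfun_bound) (auto simp: app)
qed

lemma circle_bound_exists:
  assumes "continuous_on (sphere 0 1) f"
  obtains B where "circle_bound f B"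
proof -
  have "compact (f ` sphere 0 1)" using assms by (intro compact_continuous_image) auto
  then obtain B where B: "\<forall>x\<in>f ` sphere 0 1. norm x \<le> B"
    using compact_imp_bounded bounded_iff by blast
  have "circle_bound f B"
    unfolding circle_bound_def using B by (auto simp: image_iff)
  then show ?thesis by (rule that)
qed

lemma circle_bound_power [simp]: "circle_bound (\<lambda>z. z powi k) 1"
  by (simp add: circle_bound_def norm_power_int)

lemma coord_vec_tensor [simp]: "coord (vec_tensor x y) (i, j) = coord x i * coord y j"
proof -
  have "(\<Sum>p\<in>F. (cmod ((\<lambda>(i, j). coord x i * coord y j) p))\<^sup>2) \<le> (norm x * norm y)\<^sup>2" if F: "finite F" for F
  proof -
    have "(\<Sum>p\<in>F. (cmod ((\<lambda>(i, j). coord x i * coord y j) p))\<^sup>2)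
        \<le> (\<Sum>p\<in>fst ` F \<times> snd ` F. (cmod ((\<lambda>(i, j). coord x i * coord y j) p))\<^sup>2)"
      using F by (intro sum_mono2) force+
    also have "\<dots> = (\<Sum>i\<in>fst ` F. (cmod (coord x i))\<^sup>2) * (\<Sum>j\<in>snd ` F. (cmod (coord y j))\<^sup>2)"
      by (simp add: sum_product sum.cartesian_product norm_mult power_mult_distrib case_prod_beta)
    also have "\<dots> \<le> (norm x)\<^sup>2 * (norm y)\<^sup>2"
      using F by (intro mult_mono sum_coord_le sum_nonneg) auto
    finally show ?thesis by (simp add: power_mult_distrib)
  qed
  from ell2_bounded(1)[OF this] show ?thesis by (simp add: vec_tensor_def)
qed

lemma coord_mult_op:
  assumes "circle_bound f B"
  shows "coord (blinfun_apply (mult_op f) x) t = f (point t) * coord x t"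
proof -
  have "mult_op f = weighted_op (\<lambda>t. f (point t)) (\<lambda>t. t)" by (simp add: mult_op_def weighted_op_def)
  then show ?thesis using assms by (simp add: coord_weighted_op[of "\<lambda>t. t" _ B] circle_bound_def)
qed

lemma op_tensor_eq_field_op:
  assumes f: "circle_bound f B" and b: "clinear_op b"
  shows "op_tensor (mult_op f) b = field_op f b"
  unfolding op_tensor_def
proof (rule the_equality)
  have sl: "slice t (vec_tensor x y) = coord x t *\<^sub>C y" for t x and y :: "nat ell2"
    by (rule ell2_eqI) simp
  show *: "\<forall>x y. blinfun_apply (field_op f b) (vec_tensor x y)
      = vec_tensor (blinfun_apply (mult_op f) x) (blinfun_apply b y)"
    using b by (auto intro!: ell2_eqI simp: coord_field_op[OF f] coord_mult_op[OF f] sl clinear_op_def)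
  fix T assume T: "\<forall>x y. blinfun_apply T (vec_tensor x y)
      = vec_tensor (blinfun_apply (mult_op f) x) (blinfun_apply b y)"
  show "T = field_op f b"
  proof (rule oper_eqI)
    fix c and p :: "circle \<times> nat"
    have "c *\<^sub>C ket p = vec_tensor (c *\<^sub>C ket (fst p)) (ket (snd p))"
      by (rule ell2_eqI, rename_tac q, case_tac q, case_tac p) auto
    then show "blinfun_apply T (c *\<^sub>C ket p) = blinfun_apply (field_op f b) (c *\<^sub>C ket p)"
      using T * by simp
  qed
qed

text \<open>
  The matrix unit \<open>e\<^sub>a\<^sub>b\<close> on \<open>\<ell>\<^sup>2(\<nat>)\<close>.
\<close>

definition munit :: "nat \<Rightarrow> nat \<Rightarrow> nat oper" where
  "munit a b = weighted_op (\<lambda>i. if i = a then 1 else 0) (\<lambda>_. b)"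

lemma munit_aux: "inj_on (\<lambda>_. b) {i :: nat. (if i = a then 1 else 0 :: complex) \<noteq> 0}"
  "cmod (if i = a then 1 else 0) \<le> 1"
  by (auto simp: inj_on_def)

lemma coord_munit [simp]:
  "coord (blinfun_apply (munit a b) x) i = (if i = a then coord x b else 0)"
  unfolding munit_def by (simp add: coord_weighted_op[OF munit_aux])

lemma norm_munit_le: "norm (munit a b) \<le> 1"
  unfolding munit_def by (rule norm_weighted_op_le[OF munit_aux])

lemma clinear_munit: "clinear_op (munit a b)"
  unfolding munit_def by (rule clinear_weighted_op[OF munit_aux])

lemma bounded_linear_scaleC_left: "bounded_linear (\<lambda>c. c *\<^sub>C x)"
  by (rule bounded_linear_intro[where K = "norm x"]) (auto intro!: ell2_eqI simp: algebra_simps scaleR_conv_of_real)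

lemma munit_compact: "munit a b \<in> compact_ops"
proof -
  let ?K = "(\<lambda>c. c *\<^sub>C ket a) ` cball (0 :: complex) 1"
  have K: "compact ?K"
    by (intro compact_continuous_image linear_continuous_on bounded_linear_scaleC_left) auto
  have "blinfun_apply (munit a b) ` cball 0 1 \<subseteq> ?K"
  proof
    fix y assume "y \<in> blinfun_apply (munit a b) ` cball 0 1"
    then obtain x where x: "norm x \<le> 1" "y = blinfun_apply (munit a b) x" by auto
    have "y = coord x b *\<^sub>C ket a" unfolding x(2) by (rule ell2_eqI) auto
    moreover have "cmod (coord x b) \<le> 1" using coord_le_norm[of x b] x(1) by simp
    ultimately show "y \<in> ?K" by auto
  qed
  then have "closure (blinfun_apply (munit a b) ` cball 0 1) \<subseteq> ?K"
    using K by (intro closure_minimal compact_imp_closed)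
  then have "compact (closure (blinfun_apply (munit a b) ` cball 0 1))"
    using compact_Int_closed[OF K closed_closure] by (metis inf.absorb2)
  then show ?thesis by (simp add: compact_ops_def clinear_munit)
qed

section \<open>Compact operators are limits of finite matrices\<close>

text \<open>
  The \<open>i\<close>-th row of a bounded operator is square summable, hence the functional \<open>y \<mapsto> (b y) i\<close> is small on
  vectors supported far out.
\<close>

lemma op_row_tail:
  fixes b :: "nat oper"
  assumes b: "clinear_op b" and e: "e > 0"
  obtains N where "\<And>y. (\<And>j. j < N \<Longrightarrow> coord y j = 0) \<Longrightarrow> cmod (coord (blinfun_apply b y) i) \<le> e * norm y"
proof -
  define c where "c j = coord (blinfun_apply b (ket j)) i" for j
  have fin: "coord (blinfun_apply b (truncation F y)) i = (\<Sum>j\<in>F. coord y j * c j)" if "finite F" for F y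
    using b that by (simp add: truncation_eq_sum blinfun.sum_right clinear_op_def c_def)
  have "(\<Sum>j\<in>F. (cmod (c j))\<^sup>2) \<le> (norm b)\<^sup>2" if F: "finite F" for F
  proof -
    let ?S = "\<Sum>j\<in>F. (cmod (c j))\<^sup>2"
    (* On this vector the functional takes the square sum of the c j with j in F as its value. *)
    define v where "v = (\<Sum>j\<in>F. cnj (c j) *\<^sub>C ket j)"
    have v: "coord v j = (if j \<in> F then cnj (c j) else 0)" for j
      using F by (simp add: v_def if_distrib cong: if_cong)
    have S0: "?S \<ge> 0" by (intro sum_nonneg) auto
    have "norm v \<le> sqrt ?S"
    proof (rule norm_ell2_leI)
      fix A :: "nat set" assume A: "finite A"
      have "(\<Sum>j\<in>A. (cmod (coord v j))\<^sup>2) = (\<Sum>j\<in>A \<inter> F. (cmod (c j))\<^sup>2)"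
        using A by (intro sum.mono_neutral_cong_right) (auto simp: v)
      also have "\<dots> \<le> ?S" using F by (intro sum_mono2) auto
      finally show "(\<Sum>j\<in>A. (cmod (coord v j))\<^sup>2) \<le> (sqrt ?S)\<^sup>2" using S0 by simp
    qed (use S0 in simp)
    have "truncation F v = v" by (rule ell2_eqI) (simp add: v)
    then have "coord (blinfun_apply b v) i = (\<Sum>j\<in>F. cnj (c j) * c j)"
      using fin[OF F, of v] by (simp add: v)
    also have "\<dots> = of_real ?S"
      unfolding of_real_sum complex_norm_square by (simp add: mult.commute)
    finally have "?S = cmod (coord (blinfun_apply b v) i)"
      using S0 by (simp only: norm_of_real abs_of_nonneg)
    also have "\<dots> \<le> norm (blinfun_apply b v)" by (rule coord_le_norm)
    also have "\<dots> \<le> norm b * norm v" by (rule norm_blinfun)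
    also have "\<dots> \<le> norm b * sqrt ?S" using \<open>norm v \<le> sqrt ?S\<close> by (intro mult_left_mono) auto
    finally have le: "sqrt ?S * sqrt ?S \<le> norm b * sqrt ?S" using S0 by simp
    have "sqrt ?S \<le> norm b"
    proof (cases "?S = 0")
      case False
      then have "sqrt ?S > 0" using S0 by simp
      then show ?thesis by (rule mult_right_le_imp_le[OF le])
    qed simp
    then have "(sqrt ?S)\<^sup>2 \<le> (norm b)\<^sup>2" using S0 by (intro power_mono) auto
    then show ?thesis using S0 by simp
  qed
  from ell2_bounded(1)[OF this] have r: "coord (Abs_ell2 c) = c" by simp
  obtain F0 where F0: "finite F0" "\<And>F'. F0 \<subseteq> F' \<Longrightarrow> norm (Abs_ell2 c - truncation F' (Abs_ell2 c)) < e"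
    using truncation_approx[OF e, of "Abs_ell2 c"] by blast
  obtain N where N: "F0 \<subseteq> {..<N}" using F0(1) finite_nat_set_iff_bounded by auto
  let ?d = "Abs_ell2 c - truncation {..<N} (Abs_ell2 c)"
  have d: "norm ?d \<le> e" using F0(2)[OF N] by simp
  have fine: "cmod (coord (blinfun_apply b (truncation F y)) i) \<le> e * norm y"
    if F: "finite F" and y: "\<And>j. j < N \<Longrightarrow> coord y j = 0" for F y
  proof -
    have "cmod (coord (blinfun_apply b (truncation F y)) i) = cmod (\<Sum>j\<in>F. coord y j * coord ?d j)"
      unfolding fin[OF F] using y by (intro arg_cong[of _ _ cmod] sum.cong) (auto simp: r)
    also have "\<dots> \<le> (\<Sum>j\<in>F. cmod (coord y j) * cmod (coord ?d j))"
      by (intro sum_norm_le) (simp add: norm_mult)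
    also have "\<dots> \<le> norm y * e"
    proof (rule power2_le_imp_le)
      have "(\<Sum>j\<in>F. cmod (coord y j) * cmod (coord ?d j))\<^sup>2
          \<le> (\<Sum>j\<in>F. (cmod (coord y j))\<^sup>2) * (\<Sum>j\<in>F. (cmod (coord ?d j))\<^sup>2)"
        by (rule Cauchy_Schwarz_ineq_sum)
      also have "\<dots> \<le> (norm y)\<^sup>2 * (norm ?d)\<^sup>2"
        using F by (intro mult_mono sum_coord_le sum_nonneg) auto
      also have "\<dots> \<le> (norm y)\<^sup>2 * e\<^sup>2"
        using d by (intro mult_left_mono power_mono) auto
      finally show "(\<Sum>j\<in>F. cmod (coord y j) * cmod (coord ?d j))\<^sup>2 \<le> (norm y * e)\<^sup>2"
        by (simp add: power_mult_distrib)
    qed (use e in simp)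
    finally show ?thesis by (simp add: mult.commute)
  qed
  have "cmod (coord (blinfun_apply b y) i) \<le> e * norm y" if y: "\<And>j. j < N \<Longrightarrow> coord y j = 0" for y
  proof (rule field_le_epsilon)
    fix d :: real assume d: "d > 0"
    then obtain F where F: "finite F" "\<And>F'. F \<subseteq> F' \<Longrightarrow> norm (y - truncation F' y) < d / (norm b + 1)"
      using truncation_approx[of "d / (norm b + 1)" y] by (auto simp: add_nonneg_pos)
    have "coord (blinfun_apply b y) i = coord (blinfun_apply b (truncation F y)) i + coord (blinfun_apply b (y - truncation F y)) i"
      by (simp add: blinfun.diff_right)
    then have "cmod (coord (blinfun_apply b y) i)
        \<le> cmod (coord (blinfun_apply b (truncation F y)) i) + cmod (coord (blinfun_apply b (y - truncation F y)) i)"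
      by (metis norm_triangle_ineq)
    also have "\<dots> \<le> e * norm y + norm (blinfun_apply b (y - truncation F y))"
      by (intro add_mono fine F y coord_le_norm)
    also have "\<dots> \<le> e * norm y + norm b * norm (y - truncation F y)"
      by (intro add_left_mono norm_blinfun)
    also have "\<dots> \<le> e * norm y + (norm b + 1) * (d / (norm b + 1))"
      using F(2)[of F] by (intro add_left_mono mult_mono) auto
    also have "\<dots> = e * norm y + d" by (simp add: add_nonneg_eq_0_iff)
    finally show "cmod (coord (blinfun_apply b y) i) \<le> e * norm y + d" .
  qed
  then show ?thesis by (rule that)
qed

text \<open>
  The upper left \<open>M \<times> N\<close> block of the matrix of \<open>b\<close>.
\<close>

definition corner :: "nat \<Rightarrow> nat \<Rightarrow> nat oper \<Rightarrow> nat oper" where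
  "corner M N b = (\<Sum>i<M. \<Sum>j<N. cscale_op (coord (blinfun_apply b (ket j)) i) (munit i j))"

lemma corner_apply:
  assumes "clinear_op b"
  shows "blinfun_apply (corner M N b) x = truncation {..<M} (blinfun_apply b (truncation {..<N} x))"
proof (rule ell2_eqI)
  fix i
  have "coord (blinfun_apply (corner M N b) x) i
      = (\<Sum>i'<M. \<Sum>j<N. if i = i' then coord (blinfun_apply b (ket j)) i' * coord x j else 0)"
    by (simp add: corner_def blinfun.sum_left if_distrib cong: if_cong)
  also have "\<dots> = (\<Sum>i'<M. if i = i' then \<Sum>j<N. coord (blinfun_apply b (ket j)) i' * coord x j else 0)"
    by (intro sum.cong) auto
  also have "\<dots> = coord (truncation {..<M} (blinfun_apply b (truncation {..<N} x))) i"
    using assms by (simp add: truncation_eq_sum[of "{..<N}"] blinfun.sum_right clinear_op_def mult.commute)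
  finally show "coord (blinfun_apply (corner M N b) x) i = coord (truncation {..<M} (blinfun_apply b (truncation {..<N} x))) i" .
qed

text \<open>
  The image of the unit ball has a finite net, so cutting off all but \<open>M\<close> rows changes \<open>b\<close> little; each
  of the finitely many remaining rows has a small tail.
\<close>

lemma compact_op_approx:
  assumes b: "b \<in> compact_ops" and e: "e > 0"
  obtains M N where "norm (b - corner M N b) \<le> e"
proof -
  have cl: "clinear_op b" and cp: "compact (closure (blinfun_apply b ` cball 0 1))"
    using b by (auto simp: compact_ops_def)
  have e6: "e / 6 > 0" using e by simp
  obtain K where K: "finite K" "closure (blinfun_apply b ` cball 0 1) \<subseteq> (\<Union>y\<in>K. ball y (e / 6))"
    using cp e6 unfolding compact_eq_totally_bounded by blast
  have "\<exists>M. \<forall>F'. {..<M} \<subseteq> F' \<longrightarrow> norm (y - truncation F' y) < e / 6" for y :: "nat ell2"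
  proof -
    obtain F where F: "finite F" "\<And>F'. F \<subseteq> F' \<Longrightarrow> norm (y - truncation F' y) < e / 6"
      using truncation_approx[OF e6, of y] by blast
    obtain M where "F \<subseteq> {..<M}" using F(1) finite_nat_set_iff_bounded by auto
    then show ?thesis using F(2) by (meson order_trans)
  qed
  then obtain m where m: "\<And>y F'. {..<m y} \<subseteq> F' \<Longrightarrow> norm (y - truncation F' (y :: nat ell2)) < e / 6" by metis
  define M where "M = Max (insert 0 (m ` K))"
  have M: "m y \<le> M" if "y \<in> K" for y using that K(1) by (simp add: M_def)
  have truncation_zero: "truncation F 0 = (0 :: nat ell2)" for F
    by (rule ell2_eqI) simp
  have truncation_diff: "truncation F (x - y) = truncation F x - truncation F y" for F and x y :: "nat ell2"
    by (rule ell2_eqI) simp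
  have close1: "norm (y - truncation {..<M} y) \<le> e / 2" if y: "y \<in> closure (blinfun_apply b ` cball 0 1)" for y
  proof -
    obtain k where k: "k \<in> K" "norm (k - y) < e / 6" using K(2) y by (auto simp: dist_norm)
    have "y - truncation {..<M} y = (k - truncation {..<M} k) - (k - y) + truncation {..<M} (k - y)"
      by (simp add: truncation_diff)
    then have "norm (y - truncation {..<M} y) \<le> norm (k - truncation {..<M} k) + norm (k - y) + norm (truncation {..<M} (k - y))"
      by (simp only:) (rule order_trans[OF norm_triangle_ineq add_right_mono[OF norm_triangle_ineq4]])
    also have "\<dots> \<le> e / 6 + e / 6 + e / 6"
      using m[of k "{..<M}"] M[OF k(1)] k(2) norm_truncation_le[of "{..<M}" "k - y"] by (intro add_mono) auto
    finally show ?thesis by simp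
  qed
  (* Each of the M rows may contribute d; the summand 1 covers M = 0. *)
  define d where "d = e / (2 * (real M + 1))"
  have d: "d > 0" using e by (simp add: d_def)
  have "\<exists>N. \<forall>y. (\<forall>j<N. coord y j = 0) \<longrightarrow> cmod (coord (blinfun_apply b y) i) \<le> d * norm y" for i
    using op_row_tail[OF cl d, of i] by metis
  then obtain r where r: "\<And>i y. (\<And>j. j < r i \<Longrightarrow> coord y j = 0) \<Longrightarrow> cmod (coord (blinfun_apply b y) i) \<le> d * norm y"
    by metis
  define N where "N = Max (insert 0 (r ` {..<M}))"
  have N: "r i \<le> N" if "i < M" for i using that by (simp add: N_def)
  have "norm (b - corner M N b) \<le> e"
  proof (rule norm_blinfun_bound)
    fix x :: "nat ell2"
    let ?y = "x - truncation {..<N} x"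
    have le: "norm (blinfun_apply b x - truncation {..<M} (blinfun_apply b x)) \<le> e / 2 * norm x"
    proof (cases "x = 0")
      case False
      let ?u = "(1 / norm x) *\<^sub>R x"
      have "blinfun_apply b ?u \<in> closure (blinfun_apply b ` cball 0 1)"
        using False by (intro subsetD[OF closure_subset] imageI) simp
      note 1 = close1[OF this]
      have 2: "blinfun_apply b ?u - truncation {..<M} (blinfun_apply b ?u)
          = (1 / norm x) *\<^sub>R (blinfun_apply b x - truncation {..<M} (blinfun_apply b x))"
        by (rule ell2_eqI) (auto simp: blinfun.scaleR_right algebra_simps)
      have "norm (blinfun_apply b x - truncation {..<M} (blinfun_apply b x)) / norm x \<le> e / 2"
        using 1 unfolding 2 norm_scaleR by simp
      then show ?thesis using False by (simp add: pos_divide_le_eq)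
    qed (simp add: truncation_zero blinfun.zero_right)
    have y: "norm ?y \<le> norm x"
    proof -
      have "?y = truncation (- {..<N}) x" by (rule ell2_eqI) simp
      then show ?thesis using norm_truncation_le by metis
    qed
    have "truncation {..<M} (blinfun_apply b ?y) = (\<Sum>i<M. coord (blinfun_apply b ?y) i *\<^sub>C ket i)"
      by (simp add: truncation_eq_sum)
    then have "norm (truncation {..<M} (blinfun_apply b ?y)) \<le> (\<Sum>i<M. norm (coord (blinfun_apply b ?y) i *\<^sub>C ket i :: nat ell2))"
      by (metis norm_sum)
    also have "\<dots> \<le> (\<Sum>i<M. d * norm x)"
    proof (intro sum_mono)
      fix i assume "i \<in> {..<M}"
      then have "coord ?y j = 0" if "j < r i" for j using N[of i] that by simp
      then have "cmod (coord (blinfun_apply b ?y) i) \<le> d * norm ?y" by (rule r)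
      also have "\<dots> \<le> d * norm x" using y d by (intro mult_left_mono) auto
      finally have 1: "cmod (coord (blinfun_apply b ?y) i) \<le> d * norm x" .
      have "norm (coord (blinfun_apply b ?y) i *\<^sub>C ket i :: nat ell2) \<le> cmod (coord (blinfun_apply b ?y) i) * 1"
        unfolding norm_scaleC by (intro mult_left_mono norm_ket_le) auto
      with 1 show "norm (coord (blinfun_apply b ?y) i *\<^sub>C ket i :: nat ell2) \<le> d * norm x" by simp
    qed
    also have "\<dots> = real M / (real M + 1) * (e / 2) * norm x" by (simp add: d_def mult_ac)
    also have "\<dots> \<le> 1 * (e / 2) * norm x" using e by (intro mult_right_mono) auto
    finally have le2: "norm (truncation {..<M} (blinfun_apply b ?y)) \<le> e / 2 * norm x" by simp
    have "blinfun_apply (b - corner M N b) x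
        = (blinfun_apply b x - truncation {..<M} (blinfun_apply b x)) + truncation {..<M} (blinfun_apply b ?y)"
      by (simp add: blinfun.diff_left corner_apply[OF cl] blinfun.diff_right truncation_diff)
    then have "norm (blinfun_apply (b - corner M N b) x)
        \<le> norm (blinfun_apply b x - truncation {..<M} (blinfun_apply b x)) + norm (truncation {..<M} (blinfun_apply b ?y))"
      by (metis norm_triangle_ineq)
    also have "\<dots> \<le> e / 2 * norm x + e / 2 * norm x" by (intro add_mono le le2)
    finally show "norm (blinfun_apply (b - corner M N b) x) \<le> e * norm x" by simp
  qed (use e in simp)
  then show ?thesis by (rule that)
qed

section \<open>The closed range is \<open>C(S\<^sup>1) \<otimes> K\<close>\<close>

context graph_seminorm
begin

lemma graph_op_fstar: "graph_op n x = arrow_op (a, k, b) \<Longrightarrow> graph_op n (fstar x) = arrow_op (b, - k, a)"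
  using adj_op_eq[OF graph_rep.free_op_adj, of n x] adj_op_eq[OF arrow_op_adj, of a k b] by simp

lemma graph_op_descent: "graph_op n (descent a) = arrow_op (a, 0, 0)"
  by (induction a) (simp_all add: graph_op_gens graph_rep.free_op_mult arrow_op_compose next_index_def)

lemma graph_op_loop: "graph_op n loop = arrow_op (0, 1, 0)"
  by (simp add: loop_def graph_op_gens graph_rep.free_op_mult arrow_op_compose next_index_def graph_op_descent)

lemma graph_op_loop_power: "graph_op n (loop_power k) = arrow_op (0, k, 0)"
proof -
  have "graph_op n (loop_pow j) = arrow_op (0, int j, 0)" for j
    by (induction j) (simp_all add: graph_op_gens graph_rep.free_op_mult arrow_op_compose graph_op_loop)
  moreover have "graph_op n (loop_star_pow j) = arrow_op (0, - int j, 0)" for j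
    by (induction j) (simp_all add: graph_op_gens graph_rep.free_op_mult arrow_op_compose graph_op_fstar[OF graph_op_loop])
  ultimately show ?thesis by (simp add: loop_power_def)
qed

lemma graph_op_normal_form: "graph_op n (normal_form g) = arrow_op g"
  by (cases g) (simp add: normal_form_def graph_rep.free_op_mult arrow_op_compose graph_op_descent graph_op_loop_power
      graph_op_fstar[OF graph_op_descent])

end

text \<open>
  The closed range of the representation.
\<close>

definition graph_range :: "nat \<Rightarrow> (circle \<times> nat) oper set" where
  "graph_range n = closure (graph_op n ` free_star (graph_gens (loop_graph n)))"

lemma arrow_op_in_range:
  assumes "n \<ge> 1" shows "arrow_op g \<in> graph_range n"
proof -
  interpret graph_seminorm n "\<lambda>x. norm (graph_op n x)"
    by unfold_locales (use assms graph_op_seminorm in auto)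
  have "arrow_op g \<in> graph_op n ` FS"
    using imageI[OF normal_form_in, of "graph_op n" g] by (simp add: graph_op_normal_form)
  then show ?thesis unfolding graph_range_def by (rule subsetD[OF closure_subset])
qed

lemma graph_range_closed: "closed (graph_range n)"
  by (simp add: graph_range_def)

lemma range_closure2:
  assumes c: "continuous_on UNIV (\<lambda>(x, y). f x y)" and "x \<in> closure A" "y \<in> closure A"
    and cl: "\<And>x y. x \<in> A \<Longrightarrow> y \<in> A \<Longrightarrow> f x y \<in> A"
  shows "f x y \<in> closure A"
proof -
  have "(\<lambda>(x, y). f x y) ` closure (A \<times> A) \<subseteq> closure A"
    by (rule image_closure_subset[OF continuous_on_subset[OF c]])
      (use cl closure_subset in auto)
  then show ?thesis using assms(2,3) unfolding closure_Times by auto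
qed

lemma range_add:
  assumes "S \<in> graph_range n" "T \<in> graph_range n" shows "S + T \<in> graph_range n"
  using _ assms unfolding graph_range_def
proof (rule range_closure2)
  show "continuous_on UNIV (\<lambda>(x, y). x + y :: (circle \<times> nat) oper)"
    unfolding case_prod_beta by (intro continuous_intros)
  fix S T assume "S \<in> graph_op n ` free_star (graph_gens (loop_graph n))"
    "T \<in> graph_op n ` free_star (graph_gens (loop_graph n))"
  then show "S + T \<in> graph_op n ` free_star (graph_gens (loop_graph n))"
    by (auto simp: free_op_add[symmetric] intro!: imageI add_in_free_star)
qed

lemma range_compose:
  assumes "S \<in> graph_range n" "T \<in> graph_range n" shows "S o\<^sub>L T \<in> graph_range n"
  using _ assms unfolding graph_range_def
proof (rule range_closure2)
  show "continuous_on UNIV (\<lambda>(x, y). x o\<^sub>L y :: (circle \<times> nat) oper)"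
    unfolding case_prod_beta
    by (intro bounded_bilinear.continuous_on[OF bounded_bilinear_blinfun_compose] continuous_intros)
  fix S T assume "S \<in> graph_op n ` free_star (graph_gens (loop_graph n))"
    "T \<in> graph_op n ` free_star (graph_gens (loop_graph n))"
  then show "S o\<^sub>L T \<in> graph_op n ` free_star (graph_gens (loop_graph n))"
    by (auto simp: graph_rep.free_op_mult[symmetric] intro!: imageI mult_in_free_star)
qed

lemma range_cscale: "T \<in> graph_range n \<Longrightarrow> cscale_op c T \<in> graph_range n"
proof -
  have "cscale_op c ` closure A \<subseteq> closure A" if "\<And>x. x \<in> A \<Longrightarrow> cscale_op c x \<in> A" for A :: "(circle \<times> nat) oper set"
    using that closure_subset
    by (intro image_closure_subset linear_continuous_on bounded_linear_cscale_op) auto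
  from this[of "graph_op n ` free_star (graph_gens (loop_graph n))"]
  show "T \<in> graph_range n \<Longrightarrow> cscale_op c T \<in> graph_range n"
    unfolding graph_range_def
    by (force simp: free_op_fscale[symmetric] intro: imageI fscale_in_free_star)
qed

lemma range_zero: "0 \<in> graph_range n"
  unfolding graph_range_def
  by (rule subsetD[OF closure_subset], rule image_eqI[of _ _ 0]) (simp_all add: zero_in_free_star)

lemma range_sum: "(\<And>i. i \<in> A \<Longrightarrow> f i \<in> graph_range n) \<Longrightarrow> sum f A \<in> graph_range n"
  by (induction A rule: infinite_finite_induct) (auto intro: range_add range_zero)

text \<open>
  The functions \<open>g\<close> for which all \<open>g \<otimes> e\<^sub>a\<^sub>b\<close> lie in the closed range form an algebra, and it contains the
  real linear functions because \<open>Re z\<close> and \<open>Im z\<close> are combinations of \<open>z\<close> and its inverse on the circle.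
\<close>

lemma range_poly:
  assumes n: "n \<ge> 1" and g: "real_polynomial_function (g :: complex \<Rightarrow> real)"
  shows "(\<exists>B. circle_bound (\<lambda>z. of_real (g z)) B) \<and> (\<forall>a b. field_op (\<lambda>z. of_real (g z)) (munit a b) \<in> graph_range n)"
proof -
  have cb: "\<exists>B. circle_bound (\<lambda>z. of_real (g z)) B" if "real_polynomial_function g" for g :: "complex \<Rightarrow> real"
  proof -
    have "continuous_on (sphere 0 1) (\<lambda>z. complex_of_real (g z))"
      using that by (intro continuous_on_of_real continuous_on_polymonial_function)
        (simp add: real_polynomial_function_eq[symmetric])
    then show ?thesis using circle_bound_exists by metis
  qed
  have "field_op (\<lambda>z. of_real (g z)) (munit a b) \<in> graph_range n" for a b
    using g
  proof (induction g arbitrary: a b)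
    case (linear g)
    obtain B where B: "circle_bound (\<lambda>z. of_real (g z)) B" using cb linear by blast
    define \<alpha> \<beta> where "\<alpha> = Complex (g 1 / 2) (- g \<i> / 2)" and "\<beta> = Complex (g 1 / 2) (g \<i> / 2)"
    have gz: "of_real (g z) = \<alpha> * z powi 1 + \<beta> * z powi (- 1)" if "cmod z = 1" for z
    proof -
      have "z = Re z *\<^sub>R 1 + Im z *\<^sub>R \<i>" by (simp add: complex_eq_iff)
      then have "g z = g (Re z *\<^sub>R 1 + Im z *\<^sub>R \<i>)" by simp
      also have "\<dots> = Re z * g 1 + Im z * g \<i>"
        using linear by (simp only: linear_add linear_scale bounded_linear.linear real_scaleR_def)
      finally have 1: "g z = Re z * g 1 + Im z * g \<i>" .
      have "inverse z = cnj z" using that complex_norm_square[of z] by (simp add: field_simps inverse_eq_divide divide_eq_eq)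
      then show ?thesis
        by (simp add: 1 \<alpha>_def \<beta>_def complex_eq_iff power_int_minus algebra_simps)
    qed
    have "field_op (\<lambda>z. of_real (g z)) (munit a b) = cscale_op \<alpha> (arrow_op (a, 1, b)) + cscale_op \<beta> (arrow_op (a, - 1, b))"
    proof (intro blinfun_eqI ell2_eqI)
      fix x and p :: "circle \<times> nat"
      obtain t i where p: "p = (t, i)" by fastforce
      show "coord (blinfun_apply (field_op (\<lambda>z. of_real (g z)) (munit a b)) x) p
        = coord (blinfun_apply (cscale_op \<alpha> (arrow_op (a, 1, b)) + cscale_op \<beta> (arrow_op (a, - 1, b))) x) p"
        unfolding p coord_field_op[OF B] gz[OF norm_point]
        by (simp add: blinfun.add_left algebra_simps)
    qed
    then show ?case using arrow_op_in_range[OF n] by (simp add: range_add range_cscale)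
  next
    case (const c)
    have B: "circle_bound (\<lambda>z. complex_of_real c) \<bar>c\<bar>" by (simp add: circle_bound_def)
    have "field_op (\<lambda>z. of_real c) (munit a b) = cscale_op c (arrow_op (a, 0, b))"
      by (auto intro!: blinfun_eqI ell2_eqI simp: coord_field_op[OF B])
    then show ?case using arrow_op_in_range[OF n] by (simp add: range_cscale)
  next
    case (add f g)
    obtain B where B: "circle_bound (\<lambda>z. of_real (f z)) B" using cb add by blast
    obtain C where C: "circle_bound (\<lambda>z. of_real (g z)) C" using cb add by blast
    obtain D where D: "circle_bound (\<lambda>z. of_real (f z + g z)) D"
      using cb real_polynomial_function.intros(3)[OF add.hyps] by blast
    have "field_op (\<lambda>z. of_real (f z + g z)) (munit a b)
        = field_op (\<lambda>z. of_real (f z)) (munit a b) + field_op (\<lambda>z. of_real (g z)) (munit a b)"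
      by (rule blinfun_eqI, rule ell2_eqI) (auto simp: coord_field_op[OF B] coord_field_op[OF C]
          coord_field_op[OF D[unfolded of_real_add]] blinfun.add_left algebra_simps)
    then show ?case using add by (simp add: range_add)
  next
    case (mult f g)
    obtain B where B: "circle_bound (\<lambda>z. of_real (f z)) B" using cb mult by blast
    obtain C where C: "circle_bound (\<lambda>z. of_real (g z)) C" using cb mult by blast
    obtain D where D: "circle_bound (\<lambda>z. of_real (f z * g z)) D"
      using cb real_polynomial_function.intros(4)[OF mult.hyps] by blast
    have "field_op (\<lambda>z. of_real (f z * g z)) (munit a b)
        = field_op (\<lambda>z. of_real (f z)) (munit a a) o\<^sub>L field_op (\<lambda>z. of_real (g z)) (munit a b)"
      by (rule blinfun_eqI, rule ell2_eqI) (auto simp: coord_field_op[OF B] coord_field_op[OF C]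
          coord_field_op[OF D[unfolded of_real_mult]])
    then show ?case using mult by (simp add: range_compose)
  qed
  then show ?thesis using cb[OF g] by blast
qed

lemma range_continuous_munit:
  assumes n: "n \<ge> 1" and f: "continuous_on (sphere 0 1) f"
  shows "field_op f (munit a b) \<in> graph_range n"
proof -
  have "field_op f (munit a b) \<in> closure (graph_range n)"
    unfolding closure_approachable
  proof (intro allI impI)
    fix e :: real assume e: "e > 0"
    have c: "continuous_on (sphere 0 1) (\<lambda>z. Re (f z))" "continuous_on (sphere 0 1) (\<lambda>z. Im (f z))"
      using f by (auto intro: continuous_intros)
    have e3: "e / 3 > 0" using e by simp
    obtain g where g: "real_polynomial_function g" "\<And>z. z \<in> sphere 0 1 \<Longrightarrow> \<bar>Re (f z) - g z\<bar> < e / 3"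
      using Stone_Weierstrass_real_polynomial_function[OF compact_sphere c(1) e3] by blast
    obtain h where h: "real_polynomial_function h" "\<And>z. z \<in> sphere 0 1 \<Longrightarrow> \<bar>Im (f z) - h z\<bar> < e / 3"
      using Stone_Weierstrass_real_polynomial_function[OF compact_sphere c(2) e3] by blast
    obtain B where B: "circle_bound (\<lambda>z. of_real (g z)) B" using range_poly[OF n g(1)] by blast
    obtain C where C: "circle_bound (\<lambda>z. of_real (h z)) C" using range_poly[OF n h(1)] by blast
    obtain D where D: "circle_bound f D" using circle_bound_exists[OF f] .
    let ?T = "field_op (\<lambda>z. of_real (g z)) (munit a b) + cscale_op \<i> (field_op (\<lambda>z. of_real (h z)) (munit a b))"
    let ?d = "\<lambda>z. of_real (g z) + \<i> * of_real (h z) - f z"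
    have d: "circle_bound ?d (2 * (e / 3))"
      unfolding circle_bound_def
    proof
      fix t
      have p: "point t \<in> sphere 0 1" by simp
      have "cmod (?d (point t)) \<le> \<bar>Re (?d (point t))\<bar> + \<bar>Im (?d (point t))\<bar>" by (rule cmod_le)
      also have "\<dots> \<le> e / 3 + e / 3"
        using g(2)[OF p] h(2)[OF p] by (intro add_mono) (simp_all add: abs_minus_commute)
      finally show "cmod (?d (point t)) \<le> 2 * (e / 3)" by simp
    qed
    have "?T - field_op f (munit a b) = field_op ?d (munit a b)"
      by (rule blinfun_eqI, rule ell2_eqI) (auto simp: coord_field_op[OF B] coord_field_op[OF C] coord_field_op[OF D]
          coord_field_op[OF d] blinfun.add_left blinfun.diff_left algebra_simps)
    then have "norm (?T - field_op f (munit a b)) \<le> 2 * (e / 3) * norm (munit a b)"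
      using norm_field_op_le[OF d] by simp
    also have "\<dots> \<le> 2 * (e / 3) * 1" using e norm_munit_le by (intro mult_left_mono) auto
    also have "\<dots> < e" using e by simp
    finally have "dist ?T (field_op f (munit a b)) < e" by (simp add: dist_norm)
    moreover have "?T \<in> graph_range n"
      using range_poly[OF n] g(1) h(1) by (intro range_add range_cscale) auto
    ultimately show "\<exists>y\<in>graph_range n. dist y (field_op f (munit a b)) < e" by blast
  qed
  then show ?thesis using graph_range_closed by simp
qed

lemma range_field_op:
  assumes n: "n \<ge> 1" and f: "continuous_on (sphere 0 1) f" and b: "b \<in> compact_ops"
  shows "field_op f b \<in> graph_range n"
proof -
  obtain B where B: "circle_bound f B" using circle_bound_exists[OF f] .
  have B0: "B \<ge> 0" using B norm_ge_zero order_trans unfolding circle_bound_def by blast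
  have "field_op f b \<in> closure (graph_range n)"
    unfolding closure_approachable
  proof (intro allI impI)
    fix e :: real assume e: "e > 0"
    then have "e / (2 * (B + 1)) > 0" using B0 by simp
    then obtain M N where MN: "norm (b - corner M N b) \<le> e / (2 * (B + 1))"
      using compact_op_approx[OF b] by blast
    have "field_op f (corner M N b) = (\<Sum>i<M. \<Sum>j<N. cscale_op (coord (blinfun_apply b (ket j)) i) (field_op f (munit i j)))"
      by (auto intro!: blinfun_eqI ell2_eqI simp: coord_field_op[OF B] corner_def blinfun.sum_left
          sum_distrib_left mult_ac intro!: sum.cong)
    also have "\<dots> \<in> graph_range n"
      by (intro range_sum range_cscale range_continuous_munit n f)
    finally have in_range: "field_op f (corner M N b) \<in> graph_range n" .
    have "field_op f b - field_op f (corner M N b) = field_op f (b - corner M N b)"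
      by (rule blinfun_eqI, rule ell2_eqI) (auto simp: coord_field_op[OF B] blinfun.diff_left right_diff_distrib)
    then have "norm (field_op f b - field_op f (corner M N b)) \<le> B * norm (b - corner M N b)"
      using norm_field_op_le[OF B] by simp
    also have "\<dots> \<le> (B + 1) * (e / (2 * (B + 1)))" using MN B0 by (intro mult_mono) auto
    also have "\<dots> = e / 2" using B0 by (simp add: field_simps add_nonneg_eq_0_iff)
    also have "\<dots> < e" using e by simp
    finally have "dist (field_op f (corner M N b)) (field_op f b) < e" by (simp add: dist_norm norm_minus_commute)
    with in_range show "\<exists>y\<in>graph_range n. dist y (field_op f b) < e" by blast
  qed
  then show ?thesis using graph_range_closed by simp
qed

theorem graph_range_eq:
  assumes n: "n \<ge> 1"
  shows "graph_range n = spatial_tensor circle_functions compact_ops"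
proof
  let ?S = "{op_tensor a b | a b. a \<in> circle_functions \<and> b \<in> compact_ops}"
  have "?S \<subseteq> graph_range n"
  proof
    fix T assume "T \<in> ?S"
    then obtain f b where f: "continuous_on (sphere 0 1) f" and b: "b \<in> compact_ops" and T: "T = op_tensor (mult_op f) b"
      unfolding circle_functions_def by blast
    obtain B where B: "circle_bound f B" using circle_bound_exists[OF f] .
    have "T = field_op f b" using b unfolding T by (intro op_tensor_eq_field_op[OF B]) (simp add: compact_ops_def)
    then show "T \<in> graph_range n" using range_field_op[OF n f b] by simp
  qed
  moreover have "subspace (graph_range n)"
  proof (rule subspaceI)
    fix c :: real and T assume "T \<in> graph_range n"
    moreover have "c *\<^sub>R T = cscale_op (of_real c) T"
      by (auto intro!: blinfun_eqI ell2_eqI simp: blinfun.scaleR_left)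
    ultimately show "c *\<^sub>R T \<in> graph_range n" by (simp add: range_cscale)
  qed (auto intro: range_zero range_add)
  ultimately have "span ?S \<subseteq> graph_range n" by (rule span_minimal)
  then show "spatial_tensor circle_functions compact_ops \<subseteq> graph_range n"
    unfolding spatial_tensor_def using graph_range_closed by (rule closure_minimal)
  have M: "cscale_op c (arrow_op g) \<in> ?S" for c g
  proof -
    obtain a k b where g: "g = (a, k, b)" by (metis prod_cases3)
    let ?f = "\<lambda>z. c * z powi k"
    have f: "continuous_on (sphere 0 1) ?f"
      by (intro continuous_intros) (auto simp: sphere_def)
    obtain B where B: "circle_bound ?f B" using circle_bound_exists[OF f] .
    have "cscale_op c (arrow_op g) = field_op ?f (munit a b)"
      by (auto intro!: blinfun_eqI ell2_eqI simp: coord_field_op[OF B] g)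
    also have "\<dots> = op_tensor (mult_op ?f) (munit a b)"
      by (rule op_tensor_eq_field_op[OF B clinear_munit, symmetric])
    finally show ?thesis using f munit_compact unfolding circle_functions_def by blast
  qed
  have "graph_op n x \<in> span ?S" if "x \<in> free_star (graph_gens (loop_graph n))" for x
  proof -
    obtain N D where "alg_bounded n N D x" using alg_bounded_exists[OF \<open>x \<in> _\<close>] .
    then show ?thesis
      unfolding graph_op_eq_sum[OF \<open>alg_bounded n N D x\<close>] by (intro span_sum span_base M)
  qed
  then show "graph_range n \<subseteq> spatial_tensor circle_functions compact_ops"
    unfolding graph_range_def spatial_tensor_def by (intro closure_mono) blast
qed

section \<open>The gauge action and the core\<close>

text \<open>
  Rotation of the circle by \<open>\<zeta>\<close>, for \<open>\<zeta>\<close> of modulus \<open>1\<close>.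
\<close>

definition rot :: "complex \<Rightarrow> circle \<Rightarrow> circle" where
  "rot \<zeta> t = Abs_circle (\<zeta> * point t)"

lemma point_rot [simp]: "cmod \<zeta> = 1 \<Longrightarrow> point (rot \<zeta> t) = \<zeta> * point t"
  unfolding rot_def by (rule Abs_circle_inverse) (simp add: norm_mult)

lemma circle_eqI: "point s = point t \<Longrightarrow> s = t"
  by (simp add: point_inject)

lemma cnj_mult_self: "cmod \<zeta> = 1 \<Longrightarrow> cnj \<zeta> * \<zeta> = 1" "cmod \<zeta> = 1 \<Longrightarrow> \<zeta> * cnj \<zeta> = 1"
  using complex_norm_square[of \<zeta>] by (simp_all add: mult.commute)

lemma rot_rot:
  assumes "cmod \<zeta> = 1"
  shows "rot (cnj \<zeta> ^ n) (rot (\<zeta> ^ n) t) = t" "rot (\<zeta> ^ n) (rot (cnj \<zeta> ^ n) t) = t"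
  using assms cnj_mult_self[OF assms]
  by (auto intro!: circle_eqI simp: norm_power mult.assoc[symmetric] power_mult_distrib[symmetric])

text \<open>
  The unitary \<open>(U x) (t, i) = \<zeta>\<^sup>i x (\<zeta>\<^sup>n t, i)\<close> that implements the gauge automorphism for \<open>\<zeta>\<close>.  The
  factor \<open>\<zeta>\<^sup>i\<close> gives weight \<open>1\<close> to the edges from \<open>a + 1\<close> to \<open>a\<close>, and the rotation by \<open>\<zeta>\<^sup>n\<close> corrects the
  weight of the edge from \<open>0\<close> to \<open>n - 1\<close>, of winding number \<open>1\<close>, to \<open>1\<close> as well.
\<close>

definition gauge_op :: "nat \<Rightarrow> complex \<Rightarrow> (circle \<times> nat) oper" where
  "gauge_op n \<zeta> = weighted_op (\<lambda>(t, i). \<zeta> ^ i) (\<lambda>(t, i). (rot (\<zeta> ^ n) t, i))"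

lemma gauge_op_aux:
  assumes "cmod \<zeta> = 1"
  shows "inj_on (\<lambda>(t, i). (rot (\<zeta> ^ n) t, i)) {p :: circle \<times> nat. (case p of (t, i) \<Rightarrow> \<zeta> ^ i) \<noteq> 0}"
    "cmod (case p of (t, i) \<Rightarrow> \<zeta> ^ i) \<le> 1"
proof -
  show "inj_on (\<lambda>(t, i). (rot (\<zeta> ^ n) t, i)) {p :: circle \<times> nat. (case p of (t, i) \<Rightarrow> \<zeta> ^ i) \<noteq> 0}"
    by (rule inj_on_inverseI[of _ "\<lambda>(t, i). (rot (cnj \<zeta> ^ n) t, i)"]) (auto simp: rot_rot[OF assms])
  show "cmod (case p of (t, i) \<Rightarrow> \<zeta> ^ i) \<le> 1"
    using assms by (simp add: norm_power split: prod.splits)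
qed

lemma coord_gauge_op:
  "cmod \<zeta> = 1 \<Longrightarrow> coord (blinfun_apply (gauge_op n \<zeta>) x) (t, i) = \<zeta> ^ i * coord x (rot (\<zeta> ^ n) t, i)"
  unfolding gauge_op_def by (simp add: coord_weighted_op[OF gauge_op_aux])

lemma gauge_op_adj:
  assumes "cmod \<zeta> = 1" shows "is_adj (gauge_op n \<zeta>) (gauge_op n (cnj \<zeta>))"
  unfolding gauge_op_def
  by (rule weighted_op_adj[where B = 1]) (use assms in \<open>auto simp: gauge_op_aux rot_rot[OF assms] norm_power\<close>)

lemma gauge_op_inverse:
  assumes "cmod \<zeta> = 1"
  shows "gauge_op n \<zeta> o\<^sub>L gauge_op n (cnj \<zeta>) = id_blinfun" "gauge_op n (cnj \<zeta>) o\<^sub>L gauge_op n \<zeta> = id_blinfun"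
  using assms cnj_mult_self[OF assms]
  by (auto intro!: blinfun_eqI ell2_eqI
      simp: coord_gauge_op rot_rot[OF assms] mult.assoc[symmetric] power_mult_distrib[symmetric])

text \<open>
  Conjugation by the gauge unitary, whose inverse is the one for the conjugate of \<open>\<zeta>\<close>.
\<close>

definition conj_gauge :: "nat \<Rightarrow> complex \<Rightarrow> (circle \<times> nat) oper \<Rightarrow> (circle \<times> nat) oper" where
  "conj_gauge n \<zeta> T = gauge_op n \<zeta> o\<^sub>L T o\<^sub>L gauge_op n (cnj \<zeta>)"

lemma conj_gauge_add: "conj_gauge n \<zeta> (S + T) = conj_gauge n \<zeta> S + conj_gauge n \<zeta> T"
  by (simp add: conj_gauge_def compose_add)

lemma conj_gauge_cscale:
  assumes "cmod \<zeta> = 1"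
  shows "conj_gauge n \<zeta> (cscale_op c T) = cscale_op c (conj_gauge n \<zeta> T)"
proof -
  have "clinear_op (gauge_op n \<zeta>)" using gauge_op_adj[OF assms] by (simp add: is_adj_def)
  then show ?thesis
    by (auto intro!: blinfun_eqI simp: conj_gauge_def clinear_op_def)
qed

lemma conj_gauge_compose:
  assumes "cmod \<zeta> = 1"
  shows "conj_gauge n \<zeta> (S o\<^sub>L T) = conj_gauge n \<zeta> S o\<^sub>L conj_gauge n \<zeta> T"
proof -
  have "conj_gauge n \<zeta> S o\<^sub>L conj_gauge n \<zeta> T
      = gauge_op n \<zeta> o\<^sub>L S o\<^sub>L (gauge_op n (cnj \<zeta>) o\<^sub>L gauge_op n \<zeta>) o\<^sub>L T o\<^sub>L gauge_op n (cnj \<zeta>)"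
    by (simp add: conj_gauge_def blinfun_compose_assoc)
  then show ?thesis
    by (simp add: gauge_op_inverse[OF assms]) (simp add: conj_gauge_def blinfun_compose_assoc)
qed

lemma conj_gauge_id: "cmod \<zeta> = 1 \<Longrightarrow> conj_gauge n \<zeta> id_blinfun = id_blinfun"
  by (simp add: conj_gauge_def gauge_op_inverse)

text \<open>
  The exponent \<open>a + n k - b\<close> is the degree of the words with arrow \<open>(a, k, b)\<close>.
\<close>

lemma conj_gauge_arrow_op:
  assumes "cmod \<zeta> = 1"
  shows "conj_gauge n \<zeta> (arrow_op (a, k, b)) = cscale_op (\<zeta> powi (int a + int n * k - int b)) (arrow_op (a, k, b))"
proof -
  have z: "\<zeta> \<noteq> 0" using assms by auto
  have inv: "cnj \<zeta> = inverse \<zeta>" using cnj_mult_self(1)[OF assms] z by (simp add: field_simps)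
  have "\<zeta> powi (int a + int n * k - int b) = \<zeta> ^ a * (\<zeta> ^ n) powi k * cnj \<zeta> ^ b"
    using z by (simp add: power_int_add power_int_diff power_int_mult inv divide_inverse power_inverse)
  then have c: "\<zeta> ^ a * ((\<zeta> ^ n * w) powi k * (cnj \<zeta> ^ b * y)) = \<zeta> powi (int a + int n * k - int b) * (w powi k * y)" for w y
    by (simp add: power_int_mult_distrib mult_ac)
  show ?thesis
    using assms
    by (auto intro!: blinfun_eqI ell2_eqI simp: conj_gauge_def coord_gauge_op norm_power rot_rot[OF assms] c)
qed

lemma gauge_letter:
  assumes n: "n \<ge> 1" and \<zeta>: "cmod \<zeta> = 1"
  defines "\<phi> \<equiv> case_sum proj (\<lambda>e. fscale \<zeta> (piso e))"
  shows "graph_op n (if s then fstar (\<phi> g) else \<phi> g) = conj_gauge n \<zeta> (M_letter n (g, s))"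
proof -
  have 1: "graph_op n (\<phi> g) = conj_gauge n \<zeta> (M_letter n (g, False))" for g
  proof (cases g)
    case (Inl v)
    then show ?thesis
      by (simp add: \<phi>_def proj_def free_op_gen M_letter_def Let_def conj_gauge_arrow_op[OF \<zeta>] cscale_op_simps)
  next
    case (Inr e)
    have "int a + int n * of_bool (a = 0) - int (next_index n a) = 1" for a
      using n by (auto simp: next_index_def)
    then show ?thesis
      by (simp add: Inr \<phi>_def piso_def free_op_fscale free_op_gen M_letter_def Let_def conj_gauge_arrow_op[OF \<zeta>])
  qed
  have "is_adj (conj_gauge n \<zeta> (M_letter n (g, False))) (conj_gauge n \<zeta> (M_letter n (g, True)))"
    using is_adj_simps(4)[OF is_adj_simps(4)[OF gauge_op_adj[OF \<zeta>] M_letter_adj[of n g False]]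
        gauge_op_adj[of "cnj \<zeta>"]] \<zeta>
    by (simp add: conj_gauge_def blinfun_compose_assoc)
  then have "graph_op n (fstar (\<phi> g)) = conj_gauge n \<zeta> (M_letter n (g, True))"
    using adj_op_eq[OF graph_rep.free_op_adj, of n "\<phi> g"] by (simp add: 1 adj_op_eq)
  then show ?thesis using 1 by simp
qed

lemma free_subst_lin: "free_subst \<phi> = lin (\<lambda>w c. fscale c
    (prod_list (map (\<lambda>(g, b). if b then fstar (\<phi> g) else \<phi> g) (letters w))))"
  by (rule ext) (simp add: free_subst_def lin_def)

lemma free_subst_add: "free_subst \<phi> (x + y) = free_subst \<phi> x + free_subst \<phi> y"
  unfolding free_subst_lin by (rule lin_add) (simp_all add: fscale_def single_add algebra_simps)

lemma free_subst_single: "free_subst \<phi> (Poly_Mapping.single w c) = fscale c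
    (prod_list (map (\<lambda>(g, b). if b then fstar (\<phi> g) else \<phi> g) (letters w)))"
  unfolding free_subst_lin by (rule lin_single) (simp add: fscale_def)

lemma free_op_one: "free_op M 1 = id_blinfun"
  unfolding single_one[symmetric] free_op_single by (simp add: zero_word_def cscale_op_simps)

lemma graph_op_gauge_free:
  assumes n: "n \<ge> 1" and \<zeta>: "cmod \<zeta> = 1"
  shows "graph_op n (gauge_free \<zeta> x) = conj_gauge n \<zeta> (graph_op n x)"
proof (induction x rule: poly_mapping_add_induct)
  case (single w c)
  let ?\<phi> = "case_sum proj (\<lambda>e. fscale \<zeta> (piso e))"
  have "graph_op n (prod_list (map (\<lambda>(g, b). if b then fstar (?\<phi> g) else ?\<phi> g) ls))
      = conj_gauge n \<zeta> (word_op (M_letter n) ls)" for ls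
  proof (induction ls)
    case (Cons l ls)
    then show ?case
      by (cases l) (simp only: list.map prod_list.Cons graph_rep.free_op_mult split gauge_letter[OF n \<zeta>]
          word_op_simps conj_gauge_compose[OF \<zeta>])
  qed (simp add: free_op_one conj_gauge_id[OF \<zeta>])
  then show ?case
    by (simp add: gauge_free_def free_subst_single free_op_fscale free_op_single conj_gauge_cscale[OF \<zeta>])
qed (simp add: gauge_free_def free_subst_add free_op_add conj_gauge_add)

lemma gauge_free_in:
  assumes "x \<in> free_star (graph_gens E)"
  shows "gauge_free \<zeta> x \<in> free_star (graph_gens E)"
  using assms
proof (induction rule: free_star_induct)
  case (single w c)
  let ?\<phi> = "case_sum proj (\<lambda>e. fscale \<zeta> (piso e))"
  have g: "?\<phi> g \<in> free_star (graph_gens E)" if "g \<in> graph_gens E" for g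
    using that by (auto simp: graph_gens_def proj_def piso_def gen_def intro!: fscale_in_free_star single_in_free_star)
  have "prod_list (map (\<lambda>(g, b). if b then fstar (?\<phi> g) else ?\<phi> g) ls) \<in> free_star (graph_gens E)"
    if "ls \<noteq> []" "fst ` set ls \<subseteq> graph_gens E" for ls
    using that
  proof (induction ls rule: list_nonempty_induct)
    case (single l)
    then show ?case using g[of "fst l"] by (cases l) (simp add: fstar_in_free_star)
  next
    case (cons l ls)
    have "(case l of (g, b) \<Rightarrow> if b then fstar (?\<phi> g) else ?\<phi> g) \<in> free_star (graph_gens E)"
      using cons g[of "fst l"] by (cases l) (simp add: fstar_in_free_star)
    then show ?case using cons by (simp add: mult_in_free_star)
  qed
  then show ?case
    using single by (simp add: gauge_free_def free_subst_single fscale_in_free_star)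
qed (simp_all add: gauge_free_def free_subst_add add_in_free_star, simp add: free_subst_lin zero_in_free_star)

lemma faithful_graph_rep:
  assumes "n \<ge> 1"
  shows "faithful_rep (M_letter n) (graph_gens (loop_graph n)) (graph_rels (loop_graph n))"
  by unfold_locales (rule graph_universal_norm[OF assms])

abbreviation graph_iso :: "nat \<Rightarrow> (nat \<Rightarrow> (vertex + edge) free_alg) set \<Rightarrow> (circle \<times> nat) oper" where
  "graph_iso n \<equiv> faithful_rep.compl_op (M_letter n)"

lemma star_iso_graph_iso:
  assumes "n \<ge> 1"
  shows "star_iso (graph_iso n) (graph_cstar (loop_graph n)) (operator_algebra (graph_range n))"
  using faithful_rep.star_iso_compl_op[OF faithful_graph_rep[OF assms]]
  by (simp add: graph_cstar_def graph_range_def)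

text \<open>
  The image of the core in the closed range.
\<close>

definition core_range :: "nat \<Rightarrow> (circle \<times> nat) oper set" where
  "core_range n = {T \<in> graph_range n. \<forall>\<zeta>. cmod \<zeta> = 1 \<longrightarrow> conj_gauge n \<zeta> T = T}"

lemma graph_iso_core:
  assumes n: "n \<ge> 1"
  shows "graph_iso n ` core (loop_graph n) = core_range n"
proof -
  interpret faithful_rep "M_letter n" "graph_gens (loop_graph n)" "graph_rels (loop_graph n)"
    by (rule faithful_graph_rep[OF n])
  let ?A = "elts (graph_cstar (loop_graph n))"
  have g: "gauge (loop_graph n) \<zeta> X \<in> ?A \<and> graph_iso n (gauge (loop_graph n) \<zeta> X) = conj_gauge n \<zeta> (graph_iso n X)"
    if X: "X \<in> ?A" and \<zeta>: "cmod \<zeta> = 1" for X \<zeta>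
  proof -
    have X': "X \<in> elts (universal_cstar (graph_gens (loop_graph n)) (graph_rels (loop_graph n)))"
      using X by (simp add: graph_cstar_def)
    have "(\<lambda>k. graph_op n (gauge_free \<zeta> (rep X k))) \<longlonglongrightarrow> conj_gauge n \<zeta> (graph_iso n X)"
      unfolding graph_op_gauge_free[OF n \<zeta>] conj_gauge_def
      by (intro bounded_bilinear.tendsto[OF bounded_bilinear_blinfun_compose] tendsto_const rep_seq(2)[OF X'])
    from clsI[OF gauge_free_in[OF rep_seq(1)[OF X']] this] show ?thesis
      by (simp add: gauge_def graph_cstar_def)
  qed
  have inj: "inj_on (graph_iso n) ?A" and img: "graph_iso n ` ?A = graph_range n"
    using compl_op_inj compl_op_image by (simp_all add: graph_cstar_def graph_range_def)
  have "X \<in> core (loop_graph n) \<longleftrightarrow> graph_iso n X \<in> core_range n" if X: "X \<in> ?A" for X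
  proof -
    have "gauge (loop_graph n) \<zeta> X = X \<longleftrightarrow> conj_gauge n \<zeta> (graph_iso n X) = graph_iso n X" if "cmod \<zeta> = 1" for \<zeta>
      using g[OF X that] inj_on_eq_iff[OF inj _ X] by metis
    then show ?thesis using X img by (auto simp: core_def core_range_def)
  qed
  moreover have "core (loop_graph n) \<subseteq> ?A" by (auto simp: core_def)
  moreover have "core_range n \<subseteq> graph_iso n ` ?A" by (auto simp: core_range_def img)
  ultimately show ?thesis by blast
qed

section \<open>Matrix entries of elements of the core\<close>

lemma bounded_linear_coord: "bounded_linear (\<lambda>x. coord x p)"
  by (rule bounded_linear_intro[where K = 1]) (auto simp: scaleR_conv_of_real coord_le_norm)

lemma continuous_coord_apply: "continuous_on UNIV (\<lambda>T. coord (blinfun_apply T x) p)"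
  by (intro bounded_linear.continuous_on[OF bounded_linear_coord] continuous_intros)

lemma graph_range_induct:
  assumes "T \<in> graph_range n" "closed {T. P T}" "\<And>x. x \<in> free_star (graph_gens (loop_graph n)) \<Longrightarrow> P (graph_op n x)"
  shows "P T"
proof -
  have "graph_range n \<subseteq> {T. P T}"
    unfolding graph_range_def using assms(2,3) by (intro closure_minimal) auto
  then show ?thesis using assms(1) by blast
qed

lemma graph_range_clinear:
  assumes "T \<in> graph_range n" shows "clinear_op T"
proof -
  have "coord (blinfun_apply T (c *\<^sub>C x)) p = c * coord (blinfun_apply T x) p" for c x p
    using assms
  proof (rule graph_range_induct)
    show "closed {T. coord (blinfun_apply T (c *\<^sub>C x)) p = c * coord (blinfun_apply T x) p}"
      by (intro closed_Collect_eq continuous_intros continuous_coord_apply)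
    show "coord (blinfun_apply (graph_op n y) (c *\<^sub>C x)) p = c * coord (blinfun_apply (graph_op n y) x) p" for y
      using graph_rep.clinear_free_op[of n y] by (simp add: clinear_op_def)
  qed
  then show ?thesis by (auto simp: clinear_op_def intro!: ell2_eqI)
qed

text \<open>
  Elements of the closed range act on each point of the circle separately.
\<close>

lemma graph_range_diagonal:
  assumes T: "T \<in> graph_range n" and st: "s \<noteq> t"
  shows "coord (blinfun_apply T (ket (t, b))) (s, a) = 0"
  using T
proof (rule graph_range_induct)
  show "closed {T. coord (blinfun_apply T (ket (t, b))) (s, a) = 0}"
    by (intro closed_Collect_eq continuous_intros continuous_coord_apply)
  fix x assume "x \<in> free_star (graph_gens (loop_graph n))"
  then obtain N D where x: "alg_bounded n N D x" using alg_bounded_exists by blast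
  have "coord (blinfun_apply (cscale_op c (arrow_op g)) (ket (t, b))) (s, a) = 0" for c g
    using st by (cases g) auto
  then show "coord (blinfun_apply (graph_op n x) (ket (t, b))) (s, a) = 0"
    unfolding graph_op_eq_sum[OF x] blinfun.sum_left coord_sum by (intro sum.neutral) blast
qed

lemma graph_range_nonzero:
  assumes T: "T \<in> graph_range n" "T \<noteq> 0"
  obtains a b t where "entry T a b t \<noteq> 0"
proof -
  have "\<exists>a b t. entry T a b t \<noteq> 0"
  proof (rule ccontr)
    assume "\<not> ?thesis"
    then have 0: "entry T a b t = 0" for a b t by blast
    have "blinfun_apply T (ket p) = 0" for p
    proof (rule ell2_eqI)
      fix q :: "circle \<times> nat"
      obtain t b s a where "p = (t, b)" "q = (s, a)" by fastforce
      then show "coord (blinfun_apply T (ket p)) q = coord 0 q"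
        using 0[of a b t] graph_range_diagonal[OF T(1), of s t b a] by (cases "s = t") (auto simp: entry_def)
    qed
    then have "T = 0"
      using graph_range_clinear[OF T(1)] by (intro oper_eqI) (simp add: clinear_op_def)
    then show False using T(2) by simp
  qed
  then show ?thesis using that by blast
qed

lemma entry_sandwich:
  assumes S: "S \<in> graph_range n" and T: "T \<in> graph_range n"
  shows "entry (S o\<^sub>L arrow_op (b, k, c) o\<^sub>L T) a d t = entry S a b t * point t powi k * entry T c d t"
proof -
  have "blinfun_apply (arrow_op (b, k, c)) (blinfun_apply T (ket (t, d)))
      = (point t powi k * entry T c d t) *\<^sub>C ket (t, b)"
  proof (rule ell2_eqI)
    fix q :: "circle \<times> nat"
    obtain s i where q: "q = (s, i)" by fastforce
    show "coord (blinfun_apply (arrow_op (b, k, c)) (blinfun_apply T (ket (t, d)))) q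
        = coord ((point t powi k * entry T c d t) *\<^sub>C ket (t, b)) q"
      using graph_range_diagonal[OF T, of s t d c] by (auto simp: q entry_def)
  qed
  then show ?thesis
    using graph_range_clinear[OF S] by (simp add: entry_def clinear_op_def)
qed

lemma entry_conj_gauge:
  assumes T: "clinear_op T" and \<zeta>: "cmod \<zeta> = 1"
  shows "entry (conj_gauge n \<zeta> T) a b t = \<zeta> ^ a * cnj \<zeta> ^ b * entry T a b (rot (\<zeta> ^ n) t)"
proof -
  have "blinfun_apply (gauge_op n (cnj \<zeta>)) (ket (t, b)) = (cnj \<zeta> ^ b) *\<^sub>C ket (rot (\<zeta> ^ n) t, b)"
  proof (rule ell2_eqI)
    fix q :: "circle \<times> nat"
    obtain s i where q: "q = (s, i)" by fastforce
    have "rot (cnj \<zeta> ^ n) s = t \<longleftrightarrow> s = rot (\<zeta> ^ n) t" using rot_rot[OF \<zeta>] by metis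
    then show "coord (blinfun_apply (gauge_op n (cnj \<zeta>)) (ket (t, b))) q
        = coord ((cnj \<zeta> ^ b) *\<^sub>C ket (rot (\<zeta> ^ n) t, b)) q"
      using \<zeta> by (auto simp: q coord_gauge_op)
  qed
  then show ?thesis
    using T \<zeta> by (simp add: entry_def conj_gauge_def coord_gauge_op clinear_op_def)
qed

text \<open>
  Gauge invariance reads \<open>T\<^sub>a\<^sub>b(t) = \<zeta>\<^bsup>a - b\<^esup> T\<^sub>a\<^sub>b(\<zeta>\<^sup>n t)\<close> for all \<open>\<zeta>\<close>.  Choosing \<open>\<zeta>\<^sup>n = t' / t\<close> transports
  nonvanishing from \<open>t\<close> to \<open>t'\<close>, and choosing a primitive \<open>n\<close>-th root of unity forces \<open>a\<close> and \<open>b\<close> to be congruent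
  modulo \<open>n\<close>.
\<close>

lemma core_entry:
  assumes n: "n \<ge> 1" and T: "T \<in> core_range n" and nz: "entry T a b t \<noteq> 0"
  shows "entry T a b t' \<noteq> 0" "a mod n = b mod n"
proof -
  have cl: "clinear_op T" using T graph_range_clinear by (auto simp: core_range_def)
  have inv: "entry T a b t = \<zeta> ^ a * cnj \<zeta> ^ b * entry T a b (rot (\<zeta> ^ n) t)" if "cmod \<zeta> = 1" for \<zeta> t
    using entry_conj_gauge[OF cl that, of n a b t] T that by (simp add: core_range_def)
  show "entry T a b t' \<noteq> 0"
  proof -
    define w where "w = point t' / point t"
    have w: "cmod w = 1" by (simp add: w_def norm_divide)
    define \<zeta> where "\<zeta> = cis (Arg w / real n)"
    have "\<zeta> ^ n = w"
      using n w by (simp add: \<zeta>_def Complex.DeMoivre cis_Arg sgn_div_norm) (metis cis_Arg norm_zero sgn_eq zero_neq_one div_by_1 of_real_1)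
    then have "rot (\<zeta> ^ n) t = t'" using w by (intro circle_eqI) (simp add: w_def)
    then show ?thesis using inv[of \<zeta> t] nz by (auto simp: \<zeta>_def)
  qed
  define \<zeta> where "\<zeta> = exp (2 * of_real pi * \<i> / of_nat n)"
  have \<zeta>: "cmod \<zeta> = 1" by (simp add: \<zeta>_def)
  have loop_pow: "\<zeta> ^ j = exp (2 * of_real pi * \<i> * of_nat j / of_nat n)" for j
    unfolding \<zeta>_def exp_of_nat_mult[symmetric] by (simp add: mult_ac)
  have "\<zeta> ^ n = 1" using n by (simp add: loop_pow)
  then have "rot (\<zeta> ^ n) t = t" by (intro circle_eqI) simp
  then have "\<zeta> ^ a * cnj \<zeta> ^ b = 1" using inv[OF \<zeta>, of t] nz by simp
  then have "\<zeta> ^ a * (cnj \<zeta> ^ b * \<zeta> ^ b) = \<zeta> ^ b" by (simp add: mult.assoc[symmetric])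
  then have "\<zeta> ^ a = \<zeta> ^ b" by (simp add: power_mult_distrib[symmetric] cnj_mult_self[OF \<zeta>])
  then show "a mod n = b mod n" unfolding loop_pow using complex_root_unity_eq[OF n] by blast
qed

lemma arrow_op_core:
  assumes "n \<ge> 1" "int a + int n * k = int b"
  shows "arrow_op (a, k, b) \<in> core_range n"
  using assms arrow_op_in_range by (simp add: core_range_def conj_gauge_arrow_op cscale_op_simps)

section \<open>Orthogonal families in the core\<close>

text \<open>
  The matrix units \<open>e\<^sub>i\<^sub>i\<close> with \<open>i < n\<close> are orthogonal over the core.  If \<open>m < n\<close>, two of their images have
  nonzero entries in the same residue class modulo \<open>m\<close>, and an arrow of degree zero between the two
  entries gives a nonzero product.
\<close>

lemma core_iso_le:
  assumes n: "n \<ge> 1" and m: "m \<ge> 1"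
    and bij: "bij_betw \<Psi> (graph_range n) (graph_range m)"
    and mult: "\<And>S T. S \<in> graph_range n \<Longrightarrow> T \<in> graph_range n \<Longrightarrow> \<Psi> (S o\<^sub>L T) = \<Psi> S o\<^sub>L \<Psi> T"
    and zero: "\<Psi> 0 = 0"
    and cr: "\<Psi> ` core_range n = core_range m"
  shows "n \<le> m"
proof (rule ccontr)
  assume "\<not> n \<le> m"
  define e where "e i = arrow_op (i, 0, i)" for i :: nat
  have e: "e i \<in> core_range n" for i unfolding e_def by (rule arrow_op_core[OF n]) simp
  have sub: "core_range k \<subseteq> graph_range k" for k by (auto simp: core_range_def)
  have e_range: "e i \<in> graph_range n" for i using e sub by blast
  have e_nz: "e i \<noteq> 0" for i
    using entry_arrow_op[of i 0 i i i undefined] by (auto simp: e_def entry_simps)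
  have orth: "e i o\<^sub>L y o\<^sub>L e j = 0" if "i < n" "j < n" "i \<noteq> j" "y \<in> core_range n" for i j y
  proof (rule ccontr)
    assume nz: "e i o\<^sub>L y o\<^sub>L e j \<noteq> 0"
    have y: "y \<in> graph_range n" using that(4) sub by blast
    have "e i o\<^sub>L y o\<^sub>L e j \<in> graph_range n" by (intro range_compose e_range y)
    then obtain a b t where abt: "entry (e i o\<^sub>L y o\<^sub>L e j) a b t \<noteq> 0"
      using graph_range_nonzero nz by blast
    have "entry y i j t \<noteq> 0"
    proof
      assume 0: "entry y i j t = 0"
      have "entry (e i o\<^sub>L y o\<^sub>L e j) a b t = (if a = i then coord (blinfun_apply y (blinfun_apply (e j) (ket (t, b)))) (t, i) else 0)"
        by (simp add: entry_def e_def)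
      moreover have "blinfun_apply (e j) (ket (t, b)) = (if b = j then ket (t, j) else 0)"
        by (rule ell2_eqI) (auto simp: e_def split: if_splits)
      ultimately have "entry (e i o\<^sub>L y o\<^sub>L e j) a b t = 0"
        using 0 by (auto simp: entry_def blinfun.zero_right)
      then show False using abt by simp
    qed
    then have "i mod n = j mod n" using core_entry(2)[OF n that(4)] by blast
    then show False using that by simp
  qed
  define x where "x i = \<Psi> (e i)" for i
  have x: "x i \<in> core_range m" for i unfolding x_def using e cr by blast
  have x_range: "x i \<in> graph_range m" for i using x sub by blast
  have x_nz: "x i \<noteq> 0" for i
  proof
    assume "x i = 0"
    then have "\<Psi> (e i) = \<Psi> 0" by (simp add: x_def zero)
    then have "e i = 0" using bij e_range range_zero unfolding bij_betw_def inj_on_def by blast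
    then show False using e_nz by simp
  qed
  have x_orth: "x i o\<^sub>L y o\<^sub>L x j = 0" if ij: "i < n" "j < n" "i \<noteq> j" and y: "y \<in> core_range m" for i j y
  proof -
    obtain y' where y': "y' \<in> core_range n" "y = \<Psi> y'" using y cr by blast
    have "y' \<in> graph_range n" using y' sub by blast
    then have "x i o\<^sub>L y o\<^sub>L x j = \<Psi> (e i o\<^sub>L y' o\<^sub>L e j)"
      by (simp add: x_def y'(2) mult e_range range_compose)
    then show ?thesis using orth[OF ij y'(1)] zero by simp
  qed
  have "\<exists>a b t. entry (x i) a b t \<noteq> 0" for i
    using graph_range_nonzero[OF x_range x_nz] by metis
  then obtain f g t where nz: "\<And>i. entry (x i) (f i) (g i) (t i) \<noteq> 0" by metis
  have cong: "f i mod m = g i mod m" for i using core_entry(2)[OF m x nz] .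
  have "\<not> inj_on (\<lambda>i. f i mod m) {..<n}"
  proof (rule pigeonhole)
    have "(\<lambda>i. f i mod m) ` {..<n} \<subseteq> {..<m}" using m by auto
    then have "card ((\<lambda>i. f i mod m) ` {..<n}) \<le> m" using card_mono[of "{..<m}"] by fastforce
    then show "card ((\<lambda>i. f i mod m) ` {..<n}) < card {..<n}" using \<open>\<not> n \<le> m\<close> by simp
  qed
  then obtain i j where ij: "i < n" "j < n" "i \<noteq> j" "f i mod m = f j mod m" by (auto simp: inj_on_def)
  have "int (g i) mod int m = int (f j) mod int m"
    using ij(4) cong[of i] by (metis of_nat_mod)
  (* Winding number k makes the arrow from g i to f j homogeneous of degree zero. *)
  then obtain k where k: "int (f j) - int (g i) = int m * k"
    by (metis mod_eq_dvd_iff dvd_def)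
  have y: "arrow_op (g i, k, f j) \<in> core_range m" by (rule arrow_op_core[OF m]) (use k in simp)
  have "entry (x i o\<^sub>L arrow_op (g i, k, f j) o\<^sub>L x j) (f i) (g j) (t j) \<noteq> 0"
    unfolding entry_sandwich[OF x_range x_range]
    using nz[of j] core_entry(1)[OF m x nz, of i "t j"] by simp
  then show False using x_orth[OF ij(1-3) y] by (simp add: entry_simps)
qed

lemma core_iso_eq:
  assumes n: "n \<ge> 1" and m: "m \<ge> 1"
    and h: "star_iso h (graph_cstar (loop_graph n)) (graph_cstar (loop_graph m))"
    and hc: "h ` core (loop_graph n) = core (loop_graph m)"
  shows "n = m"
proof -
  let ?A = "elts (graph_cstar (loop_graph n))" and ?B = "elts (graph_cstar (loop_graph m))"
  note f = star_iso_graph_iso[OF n] and g = star_iso_graph_iso[OF m]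
  define f' where "f' = inv_into ?A (graph_iso n)"
  define \<Psi> where "\<Psi> = graph_iso m \<circ> h \<circ> f'"
  have bf: "bij_betw (graph_iso n) ?A (graph_range n)" and bg: "bij_betw (graph_iso m) ?B (graph_range m)"
    and bh: "bij_betw h ?A ?B"
    using f g h by (simp_all add: star_iso_def operator_algebra_def)
  have bf': "bij_betw f' (graph_range n) ?A" unfolding f'_def using bf by (rule bij_betw_inv_into)
  have ff': "graph_iso n (f' T) = T" "f' T \<in> ?A" if "T \<in> graph_range n" for T
    using that bf bf' unfolding f'_def by (auto simp: bij_betw_inv_into_right bij_betw_apply)
  have f'f: "f' (graph_iso n X) = X" if "X \<in> ?A" for X
    using that bf unfolding f'_def by (simp add: bij_betw_inv_into_left)
  have bij: "bij_betw \<Psi> (graph_range n) (graph_range m)"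
    unfolding \<Psi>_def by (intro bij_betw_trans[OF bf'] bij_betw_trans[OF bh] bg)
  have closed_ops: "mult (graph_cstar (loop_graph n)) X Y \<in> ?A" "add (graph_cstar (loop_graph n)) X Y \<in> ?A"
    if "X \<in> ?A" "Y \<in> ?A" for X Y
    using faithful_rep.elts_closed[OF faithful_graph_rep[OF n]] that by (simp_all add: graph_cstar_def)
  have hX: "h X \<in> ?B" if "X \<in> ?A" for X using bij_betw_apply[OF bh that] .
  have mult: "\<Psi> (S o\<^sub>L T) = \<Psi> S o\<^sub>L \<Psi> T" if "S \<in> graph_range n" "T \<in> graph_range n" for S T
  proof -
    define X Y where "X = f' S" and "Y = f' T"
    have XY: "X \<in> ?A" "Y \<in> ?A" "S = graph_iso n X" "T = graph_iso n Y"
      using that ff' by (simp_all add: X_def Y_def)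
    have "S o\<^sub>L T = graph_iso n (mult (graph_cstar (loop_graph n)) X Y)"
      using f XY by (simp add: star_iso_def operator_algebra_def)
    then have "\<Psi> (S o\<^sub>L T) = graph_iso m (h (mult (graph_cstar (loop_graph n)) X Y))"
      using f'f[OF closed_ops(1)[OF XY(1,2)]] by (simp add: \<Psi>_def)
    also have "\<dots> = graph_iso m (h X) o\<^sub>L graph_iso m (h Y)"
      using g h XY(1,2) hX by (simp add: star_iso_def operator_algebra_def)
    finally show ?thesis by (simp add: \<Psi>_def X_def Y_def)
  qed
  have zero: "\<Psi> 0 = 0"
  proof -
    define X where "X = f' 0"
    have X: "X \<in> ?A" "0 = graph_iso n X" using ff'[OF range_zero] by (simp_all add: X_def)
    have "graph_iso n X + graph_iso n X = graph_iso n (add (graph_cstar (loop_graph n)) X X)"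
      using f X(1) by (simp add: star_iso_def operator_algebra_def)
    then have "graph_iso n (add (graph_cstar (loop_graph n)) X X) = graph_iso n X"
      using X(2) by simp
    then have XX: "add (graph_cstar (loop_graph n)) X X = X"
      using f'f[OF closed_ops(2)[OF X(1) X(1)]] f'f[OF X(1)] by metis
    have "graph_iso m (h (add (graph_cstar (loop_graph n)) X X)) = graph_iso m (h X) + graph_iso m (h X)"
      using g h X(1) hX by (simp add: star_iso_def operator_algebra_def)
    then show ?thesis unfolding XX by (simp add: \<Psi>_def X_def)
  qed
  have cr: "\<Psi> ` core_range n = core_range m"
  proof -
    have "f' ` core_range n = core (loop_graph n)"
      unfolding f'_def graph_iso_core[OF n, symmetric]
      by (rule inv_into_image_cancel) (use bf in \<open>auto simp: bij_betw_def core_def\<close>)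
    moreover have "\<Psi> ` core_range n = graph_iso m ` h ` f' ` core_range n"
      by (simp add: \<Psi>_def image_comp comp_assoc)
    ultimately show ?thesis by (simp add: hc graph_iso_core[OF m])
  qed
  have "n \<le> m" by (rule core_iso_le[OF n m bij mult zero cr])
  define \<Theta> where "\<Theta> = inv_into (graph_range n) \<Psi>"
  have bij': "bij_betw \<Theta> (graph_range m) (graph_range n)"
    unfolding \<Theta>_def by (rule bij_betw_inv_into[OF bij])
  have \<Theta>\<Psi>: "\<Theta> (\<Psi> T) = T" if "T \<in> graph_range n" for T
    unfolding \<Theta>_def using bij that by (rule bij_betw_inv_into_left)
  have mult': "\<Theta> (S o\<^sub>L T) = \<Theta> S o\<^sub>L \<Theta> T" if ST: "S \<in> graph_range m" "T \<in> graph_range m" for S T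
  proof -
    obtain S' T' where "S' \<in> graph_range n" "T' \<in> graph_range n" "S = \<Psi> S'" "T = \<Psi> T'"
      using bij ST unfolding bij_betw_def by blast
    then show ?thesis by (simp add: mult[symmetric] \<Theta>\<Psi> range_compose)
  qed
  have "\<Theta> 0 = 0" using \<Theta>\<Psi>[OF range_zero] by (simp add: zero)
  moreover have "\<Theta> ` core_range m = core_range n"
    unfolding \<Theta>_def cr[symmetric]
    by (rule inv_into_image_cancel) (use bij in \<open>auto simp: bij_betw_def core_range_def\<close>)
  ultimately have "m \<le> n" using core_iso_le[OF m n bij' mult'] by blast
  with \<open>n \<le> m\<close> show ?thesis by simp
qed

theorem corollary6p6:
  shows "(\<forall>n\<ge>1. star_isomorphic (graph_cstar (loop_graph n)) circle_tensor_compacts) \<and>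
         (\<forall>n\<ge>1. \<forall>m\<ge>1.
            (\<exists>h. star_iso h (graph_cstar (loop_graph n)) (graph_cstar (loop_graph m)) \<and>
                 h ` core (loop_graph n) = core (loop_graph m)) \<longrightarrow> n = m)"
proof (intro conjI allI impI)
  fix n :: nat assume "n \<ge> 1"
  then show "star_isomorphic (graph_cstar (loop_graph n)) circle_tensor_compacts"
    using star_iso_graph_iso[of n] graph_range_eq[of n]
    unfolding star_isomorphic_def circle_tensor_compacts_def by auto
next
  fix n m :: nat
  assume "n \<ge> 1" "m \<ge> 1" and "\<exists>h. star_iso h (graph_cstar (loop_graph n)) (graph_cstar (loop_graph m)) \<and>
    h ` core (loop_graph n) = core (loop_graph m)"
  then show "n = m" using core_iso_eq by blast
qed

end
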